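(* Let $\mathcal{L}(X_i^O)(u)=\sum_{k=1}^\infty\xi_{ik}^O\,\tilde\phi_k^O(u)$, $u\in M$, and let $\mathcal{Z}_i:=X_i^M-\mathcal{L}(X_i^O)\in\mathbb{L}^2(M)$ be the reconstruction error. Then: (a) For every $v\in O$ and $u\in M$, $$\mathbb{E}\big(X_i^O(v)\mathcal{Z}_i(u)\big)=0\quad\text{and}\quad \mathbb{V}(\mathcal{Z}_i(u))=\mathbb{E}\big((\mathcal{Z}_i(u))^2\big)=\gamma(u,u)-\sum_{k=1}^\infty\lambda_k^O\big(\tilde\phi_k^O(u)\big)^2 .$$ (b) For any linear operator $L:\mathbb{L}^2(O)\to\mathbb{L}^2(M)$ that is a reconstruction operator with respect to $X_i^O$, $$\mathbb{E}\Big(\big(X_i^M(u)-L(X_i^O)(u)\big)^2\Big)\ge\mathbb{V}(\mathcal{Z}_i(u))\quad\text{for all }u\in M .$$ (c) Assume that the underlying process $X_i$ is Gaussian, and let $X_{i,1}$ and $X_{i,2}$ be two independent copies of $X_i$. Then for all $u\in M$ the variance of the reconstruction error can be written as $$\mathbb{V}(\mathcal{Z}_i(u))=\frac12\,\mathbb{E}\Big(\mathbb{E}\Big(\big(X_{i,1}(u)-X_{i,2}(u)\big)^2\,\Big|\,X_{i,1}^O=X_{i,2}^O\Big)\Big),$$ where $X_{i,1}^O=X_{i,2}^O$ means that $X_{i,1}(v)=X_{i,2}(v)$ for all $v\in O$.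
   Context: Let $[a,b]\subset\mathbb{R}$ and let $X_i$ be a continuous random function on $[a,b]$, an element of $\mathbb{L}^2([a,b])$, centered ($\mathbb{E}(X_i(u))=0$ for all $u$), with $\mathbb{E}(\|X_i\|_2^4)<\infty$ and with covariance function $\gamma(u,v)=\mathbb{E}(X_i(u)X_i(v))$ continuous on $[a,b]^2$. Let $O=\bigcup_{j=1}^J[A_j,B_j]\subseteq[a,b]$, $1\le J<\infty$, be a union of mutually disjoint subintervals of positive length (observed part; fixed, $X_i$ being independent of the observation domain), and $M=[a,b]\setminus O$ (missing part). $X_i^O$ and $X_i^M$ denote $X_i$ restricted to $O$ and $M$. $\langle\cdot,\cdot\rangle_2$ is the inner product of $\mathbb{L}^2(O)$; $\mathbb{V}$ denotes variance. $(\phi_k^O,\lambda_k^O)_{k\ge1}$ are the pairs of orthonormal eigenfunctions and nonzero eigenvalues $\lambda_1^O>\lambda_2^O>\dots>0$ of the covariance operator $x\mapsto\int_O\gamma(\cdot,v)x(v)\,dv$ on $\mathbb{L}^2(O)$. $X_i^O$ has the Karhunen-Loève representation $X_i^O(u)=\sum_{k\ge1}\xi_{ik}^O\phi_k^O(u)$, $u\in O$, with $\xi_{ik}^O=\langle X_i^O,\phi_k^O\rangle_2$, $\mathbb{E}(\xi_{ik}^O)=0$, $\mathbb{E}(\xi_{ik}^O\xi_{il}^O)=\lambda_k^O$ if $k=l$ and $0$ otherwise. For $u\in M$ put $\gamma_u(v)=\mathbb{E}(X_i^M(u)X_i^O(v))$, $v\in O$, and $$\tilde\phi_k^O(u)=\frac{\langle\phi_k^O,\gamma_u\rangle_2}{\lambda_k^O}.$$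 Definition: a linear operator $L:\mathbb{L}^2(O)\to\mathbb{L}^2(M)$ is called a reconstruction operator with respect to $X_i^O$ if $\mathbb{V}(L(X_i^O)(u))<\infty$ for all $u\in M$.
   Formalization: In (b), L is additionally assumed continuous along the Karhunen-Loève expansion: L applied to X_i^O minus its n-term truncation tends to 0 in mean square at each u in M. For arbitrary discontinuous linear L (built from a Hamel basis) the inequality in (b) can fail. *)

theory Defs
  imports "HOL-Probability.Probability"
begin

section \<open>Square-integrable functions on a set of reals\<close>

text \<open>Elements of \<open>L\<^sup>2(S)\<close> are represented by functions on the reals; only their values
  on \<open>S\<close> matter, and two of them are the same element iff they agree
  \<open>lebesgue_on S\<close>-almost everywhere.\<close>

definition L2 :: "real set \<Rightarrow> (real \<Rightarrow> real) set" where
  "L2 S = {f \<in> borel_measurable (lebesgue_on S). integrable (lebesgue_on S) (\<lambda>x. (f x)\<^sup>2)}"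

definition l2_inner :: "real set \<Rightarrow> (real \<Rightarrow> real) \<Rightarrow> (real \<Rightarrow> real) \<Rightarrow> real" where
  "l2_inner S f g = (\<integral>x. f x * g x \<partial>lebesgue_on S)"

definition l2_norm :: "real set \<Rightarrow> (real \<Rightarrow> real) \<Rightarrow> real" where
  "l2_norm S f = sqrt (l2_inner S f f)"

section \<open>Random functions\<close>

text \<open>A random function on \<open>P\<close> is written \<open>X \<omega> t\<close>.\<close>

definition continuous_random_function ::
    "'w measure \<Rightarrow> real \<Rightarrow> real \<Rightarrow> ('w \<Rightarrow> real \<Rightarrow> real) \<Rightarrow> bool" where
  "continuous_random_function P a b X \<longleftrightarrow>
     (\<forall>t\<in>{a..b}. (\<lambda>\<omega>. X \<omega> t) \<in> borel_measurable P) \<and>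
     (\<forall>\<omega>\<in>space P. continuous_on {a..b} (X \<omega>))"

text \<open>The covariance function of a centered process; also \<open>\<gamma>\<^sub>u = cov P X u\<close>.\<close>

definition cov :: "'w measure \<Rightarrow> ('w \<Rightarrow> real \<Rightarrow> real) \<Rightarrow> real \<Rightarrow> real \<Rightarrow> real" where
  "cov P X u v = (\<integral>\<omega>. X \<omega> u * X \<omega> v \<partial>P)"

definition variance :: "'w measure \<Rightarrow> ('w \<Rightarrow> real) \<Rightarrow> real" where
  "variance P Y = (\<integral>\<omega>. (Y \<omega> - (\<integral>\<omega>'. Y \<omega>' \<partial>P))\<^sup>2 \<partial>P)"

text \<open>Integrability is spelled out because the Bochner integral of a non-integrable function
  is 0; square integrability at every point is what makes the covariance function exist.\<close>

definition centered_process ::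
    "'w measure \<Rightarrow> real \<Rightarrow> real \<Rightarrow> ('w \<Rightarrow> real \<Rightarrow> real) \<Rightarrow> bool" where
  "centered_process P a b X \<longleftrightarrow>
     continuous_random_function P a b X \<and>
     (\<forall>t\<in>{a..b}. integrable P (\<lambda>\<omega>. (X \<omega> t)\<^sup>2) \<and> (\<integral>\<omega>. X \<omega> t \<partial>P) = 0) \<and>
     integrable P (\<lambda>\<omega>. l2_norm {a..b} (X \<omega>) ^ 4) \<and>
     continuous_on ({a..b} \<times> {a..b}) (\<lambda>(u, v). cov P X u v)"

text \<open>Every finite linear combination is normal, possibly degenerate.\<close>

definition gaussian_process ::
    "'w measure \<Rightarrow> real \<Rightarrow> real \<Rightarrow> ('w \<Rightarrow> real \<Rightarrow> real) \<Rightarrow> bool" where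
  "gaussian_process P a b X \<longleftrightarrow>
     (\<forall>T c. finite T \<longrightarrow> T \<subseteq> {a..b} \<longrightarrow>
        (\<exists>m s. 0 < s \<and>
           distributed P lborel (\<lambda>\<omega>. \<Sum>t\<in>T. c t * X \<omega> t) (\<lambda>x. ennreal (normal_density m s x))) \<or>
        (\<exists>m. AE \<omega> in P. (\<Sum>t\<in>T. c t * X \<omega> t) = m))"

section \<open>Spectral decomposition on the observed part\<close>

definition cov_operator ::
    "'w measure \<Rightarrow> ('w \<Rightarrow> real \<Rightarrow> real) \<Rightarrow> real set \<Rightarrow> (real \<Rightarrow> real) \<Rightarrow> real \<Rightarrow> real" where
  "cov_operator P X S f u = (\<integral>v. cov P X u v * f v \<partial>lebesgue_on S)"

text \<open>\<open>(\<phi> k, l k)\<close> lists all eigenpairs with nonzero eigenvalue. The indices start at 0, so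
  \<open>\<phi> k\<close> is the eigenfunction with number \<open>k + 1\<close>. Since the eigenvalues are strictly
  decreasing, all eigenspaces are one-dimensional, which is the last clause.\<close>

definition eigen_system ::
    "'w measure \<Rightarrow> ('w \<Rightarrow> real \<Rightarrow> real) \<Rightarrow> real set \<Rightarrow> (nat \<Rightarrow> real \<Rightarrow> real) \<Rightarrow> (nat \<Rightarrow> real) \<Rightarrow> bool" where
  "eigen_system P X S \<phi> l \<longleftrightarrow>
     (\<forall>k. 0 < l k \<and> l (Suc k) < l k) \<and>
     (\<forall>k. \<phi> k \<in> L2 S) \<and>
     (\<forall>j k. l2_inner S (\<phi> j) (\<phi> k) = (if j = k then 1 else 0)) \<and>
     (\<forall>k. AE u in lebesgue_on S. cov_operator P X S (\<phi> k) u = l k * \<phi> k u) \<and>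
     (\<forall>f\<in>L2 S. \<forall>\<mu>. \<mu> \<noteq> 0 \<longrightarrow>
        \<not> (AE u in lebesgue_on S. f u = 0) \<longrightarrow>
        (AE u in lebesgue_on S. cov_operator P X S f u = \<mu> * f u) \<longrightarrow>
        (\<exists>k c. \<mu> = l k \<and> (AE u in lebesgue_on S. f u = c * \<phi> k u)))"

definition score ::
    "('w \<Rightarrow> real \<Rightarrow> real) \<Rightarrow> real set \<Rightarrow> (nat \<Rightarrow> real \<Rightarrow> real) \<Rightarrow> nat \<Rightarrow> 'w \<Rightarrow> real" where
  "score X S \<phi> k \<omega> = l2_inner S (X \<omega>) (\<phi> k)"

definition phi_tilde ::
    "'w measure \<Rightarrow> ('w \<Rightarrow> real \<Rightarrow> real) \<Rightarrow> real set \<Rightarrow> (nat \<Rightarrow> real \<Rightarrow> real) \<Rightarrow> (nat \<Rightarrow> real)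
      \<Rightarrow> nat \<Rightarrow> real \<Rightarrow> real" where
  "phi_tilde P X S \<phi> l k u = l2_inner S (\<phi> k) (cov P X u) / l k"

text \<open>The scores are merely uncorrelated, so the series defining the reconstruction converges
  in mean square and not necessarily almost surely: for each \<open>u\<close> its sum is a random
  variable determined up to null sets. \<open>R\<close> is any choice of these sums that is
  jointly measurable.\<close>

definition is_reconstruction ::
    "'w measure \<Rightarrow> ('w \<Rightarrow> real \<Rightarrow> real) \<Rightarrow> real set \<Rightarrow> real set
      \<Rightarrow> (nat \<Rightarrow> real \<Rightarrow> real) \<Rightarrow> (nat \<Rightarrow> real) \<Rightarrow> ('w \<Rightarrow> real \<Rightarrow> real) \<Rightarrow> bool" where
  "is_reconstruction P X S T \<phi> l R \<longleftrightarrow>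
     (\<lambda>(\<omega>, u). R \<omega> u) \<in> borel_measurable (P \<Otimes>\<^sub>M lebesgue_on T) \<and>
     (\<forall>u\<in>T. integrable P (\<lambda>\<omega>. (R \<omega> u)\<^sup>2) \<and>
        (\<lambda>n. \<integral>\<omega>. (R \<omega> u - (\<Sum>k<n. score X S \<phi> k \<omega> * phi_tilde P X S \<phi> l k u))\<^sup>2 \<partial>P)
          \<longlonglongrightarrow> 0)"

section \<open>Linear operators and reconstruction operators\<close>

text \<open>Reconstruction operators are evaluated at every single point of \<open>T\<close>, so \<open>L f\<close> is an
  actual function on \<open>T\<close> depending only on the class of \<open>f\<close>.\<close>

definition linear_L2_operator ::
    "real set \<Rightarrow> real set \<Rightarrow> ((real \<Rightarrow> real) \<Rightarrow> real \<Rightarrow> real) \<Rightarrow> bool" where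
  "linear_L2_operator S T L \<longleftrightarrow>
     (\<forall>f\<in>L2 S. L f \<in> L2 T) \<and>
     (\<forall>f\<in>L2 S. \<forall>g\<in>L2 S. (AE x in lebesgue_on S. f x = g x) \<longrightarrow> (\<forall>u\<in>T. L f u = L g u)) \<and>
     (\<forall>f\<in>L2 S. \<forall>g\<in>L2 S. \<forall>c d. \<forall>u\<in>T. L (\<lambda>x. c * f x + d * g x) u = c * L f u + d * L g u)"

definition reconstruction_operator ::
    "'w measure \<Rightarrow> ('w \<Rightarrow> real \<Rightarrow> real) \<Rightarrow> real set \<Rightarrow> real set
      \<Rightarrow> ((real \<Rightarrow> real) \<Rightarrow> real \<Rightarrow> real) \<Rightarrow> bool" where
  "reconstruction_operator P X S T L \<longleftrightarrow>
     linear_L2_operator S T L \<and>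
     (\<forall>u\<in>T. (\<lambda>\<omega>. L (X \<omega>) u) \<in> borel_measurable P \<and> integrable P (\<lambda>\<omega>. (L (X \<omega>) u)\<^sup>2))"

definition kl_remainder ::
    "('w \<Rightarrow> real \<Rightarrow> real) \<Rightarrow> real set \<Rightarrow> (nat \<Rightarrow> real \<Rightarrow> real) \<Rightarrow> nat \<Rightarrow> 'w \<Rightarrow> real \<Rightarrow> real" where
  "kl_remainder X S \<phi> n \<omega> v = X \<omega> v - (\<Sum>k<n. score X S \<phi> k \<omega> * \<phi> k v)"

text \<open>Continuity of \<open>L\<close> along the Karhunen-Loeve expansion of the process: \<open>L\<close> may be applied
  to the expansion term by term. Optimality in mean square fails for arbitrary discontinuous linear operators:
  if \<open>X\<close> takes countably many, up to sign linearly independent values, a Hamel basis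
  argument makes \<open>L (X \<omega>) u\<close> an arbitrary odd, hence non-linear, function of the observed
  path. The condition does not require \<open>L\<close> to be bounded: point evaluations and the
  optimal reconstruction, extended linearly to \<open>L\<^sup>2\<close>, are admissible, and bounded evaluations always are
  (next lemma).\<close>

definition kl_continuous ::
    "'w measure \<Rightarrow> ('w \<Rightarrow> real \<Rightarrow> real) \<Rightarrow> real set \<Rightarrow> real set
      \<Rightarrow> (nat \<Rightarrow> real \<Rightarrow> real) \<Rightarrow> ((real \<Rightarrow> real) \<Rightarrow> real \<Rightarrow> real) \<Rightarrow> bool" where
  "kl_continuous P X S T \<phi> L \<longleftrightarrow>
     (\<forall>u\<in>T. (\<lambda>n. \<integral>\<omega>. (L (kl_remainder X S \<phi> n \<omega>) u)\<^sup>2 \<partial>P) \<longlonglongrightarrow> 0)"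

lemma kl_continuous_if_bounded:
  assumes bound: "\<And>u. u \<in> T \<Longrightarrow> \<exists>C. \<forall>f\<in>L2 S. \<bar>L f u\<bar> \<le> C * l2_norm S f"
    and rem: "\<And>n \<omega>. \<omega> \<in> space P \<Longrightarrow> kl_remainder X S \<phi> n \<omega> \<in> L2 S"
    and int: "\<And>n. integrable P (\<lambda>\<omega>. (l2_norm S (kl_remainder X S \<phi> n \<omega>))\<^sup>2)"
    and kl: "(\<lambda>n. \<integral>\<omega>. (l2_norm S (kl_remainder X S \<phi> n \<omega>))\<^sup>2 \<partial>P) \<longlonglongrightarrow> 0"
  shows "kl_continuous P X S T \<phi> L"
  unfolding kl_continuous_def
proof
  fix u assume "u \<in> T"
  then obtain C where C: "\<And>f. f \<in> L2 S \<Longrightarrow> \<bar>L f u\<bar> \<le> C * l2_norm S f"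
    using bound by blast
  let ?r = "kl_remainder X S \<phi>"
  have le: "(\<integral>\<omega>. (L (?r n \<omega>) u)\<^sup>2 \<partial>P) \<le> C\<^sup>2 * (\<integral>\<omega>. (l2_norm S (?r n \<omega>))\<^sup>2 \<partial>P)" for n
  proof -
    have "(\<integral>\<omega>. (L (?r n \<omega>) u)\<^sup>2 \<partial>P) \<le> (\<integral>\<omega>. C\<^sup>2 * (l2_norm S (?r n \<omega>))\<^sup>2 \<partial>P)"
    proof (rule integral_mono')
      show "integrable P (\<lambda>\<omega>. C\<^sup>2 * (l2_norm S (?r n \<omega>))\<^sup>2)" using int by simp
      show "(L (?r n \<omega>) u)\<^sup>2 \<le> C\<^sup>2 * (l2_norm S (?r n \<omega>))\<^sup>2" if "\<omega> \<in> space P" for \<omega>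
        using power_mono[OF C[OF rem[OF that]], of n 2] by (simp add: power_mult_distrib)
    qed simp
    then show ?thesis by simp
  qed
  have "(\<lambda>n. C\<^sup>2 * (\<integral>\<omega>. (l2_norm S (?r n \<omega>))\<^sup>2 \<partial>P)) \<longlonglongrightarrow> 0"
    using tendsto_mult_left[OF kl, of "C\<^sup>2"] by simp
  then show "(\<lambda>n. \<integral>\<omega>. (L (?r n \<omega>) u)\<^sup>2 \<partial>P) \<longlonglongrightarrow> 0"
    by (rule Lim_null_comparison[rotated]) (use le in auto)
qed

section \<open>Independent copies and conditioning on equal observed parts\<close>

abbreviation path_space :: "real set \<Rightarrow> (real \<Rightarrow> real) measure" where
  "path_space S \<equiv> PiM S (\<lambda>_. borel)"

definition observed :: "('w \<Rightarrow> real \<Rightarrow> real) \<Rightarrow> real set \<Rightarrow> 'w \<Rightarrow> real \<Rightarrow> real" where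
  "observed X S \<omega> = restrict (X \<omega>) S"

definition independent_copies ::
    "'q measure \<Rightarrow> ('q \<Rightarrow> real \<Rightarrow> real) \<Rightarrow> ('q \<Rightarrow> real \<Rightarrow> real)
      \<Rightarrow> 'w measure \<Rightarrow> ('w \<Rightarrow> real \<Rightarrow> real) \<Rightarrow> real \<Rightarrow> real \<Rightarrow> bool" where
  "independent_copies Q X1 X2 P X a b \<longleftrightarrow>
     prob_space Q \<and>
     continuous_random_function Q a b X1 \<and> continuous_random_function Q a b X2 \<and>
     distr Q (path_space {a..b}) (observed X1 {a..b}) = distr P (path_space {a..b}) (observed X {a..b}) \<and>
     distr Q (path_space {a..b}) (observed X2 {a..b}) = distr P (path_space {a..b}) (observed X {a..b}) \<and>
     prob_space.indep_var Q (path_space {a..b}) (observed X1 {a..b})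
                            (path_space {a..b}) (observed X2 {a..b})"

text \<open>\<open>K\<close> is a regular conditional distribution of \<open>W\<close> given \<open>Y\<close>.\<close>

definition cond_distribution ::
    "'q measure \<Rightarrow> 'y measure \<Rightarrow> ('q \<Rightarrow> 'y) \<Rightarrow> 'z measure \<Rightarrow> ('q \<Rightarrow> 'z) \<Rightarrow> ('y \<Rightarrow> 'z measure) \<Rightarrow> bool" where
  "cond_distribution Q N Y S W K \<longleftrightarrow>
     K \<in> N \<rightarrow>\<^sub>M prob_algebra S \<and>
     (\<forall>A\<in>sets N. \<forall>B\<in>sets S.
        emeasure Q {\<omega> \<in> space Q. Y \<omega> \<in> A \<and> W \<omega> \<in> B} = (\<integral>\<^sup>+y\<in>A. emeasure (K y) B \<partial>distr Q N Y))"

text \<open>The event that two independent copies coincide on the observed part is typically null,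
  so conditioning on it has to be understood through a disintegration. \<open>\<kappa>\<^sub>1 x\<^sub>1 \<Otimes> \<kappa>\<^sub>2 x\<^sub>2\<close> is a
  conditional distribution of the pair \<open>(X1 u, X2 u)\<close> given that the observed parts are
  \<open>x\<^sub>1\<close> and \<open>x\<^sub>2\<close>. A general version of it is not determined on the diagonal; a version of
  product form, as suggested by independence, is determined there for almost every
  \<open>x = x\<^sub>1 = x\<^sub>2\<close> under the law of the observed part.\<close>

definition cond_pair_distribution ::
    "'q measure \<Rightarrow> ('q \<Rightarrow> real \<Rightarrow> real) \<Rightarrow> ('q \<Rightarrow> real \<Rightarrow> real) \<Rightarrow> real set \<Rightarrow> real
      \<Rightarrow> ((real \<Rightarrow> real) \<Rightarrow> real measure) \<Rightarrow> ((real \<Rightarrow> real) \<Rightarrow> real measure) \<Rightarrow> bool" where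
  "cond_pair_distribution Q X1 X2 S u \<kappa>1 \<kappa>2 \<longleftrightarrow>
     \<kappa>1 \<in> path_space S \<rightarrow>\<^sub>M prob_algebra borel \<and> \<kappa>2 \<in> path_space S \<rightarrow>\<^sub>M prob_algebra borel \<and>
     cond_distribution Q
       (path_space S \<Otimes>\<^sub>M path_space S) (\<lambda>\<omega>. (observed X1 S \<omega>, observed X2 S \<omega>))
       (borel \<Otimes>\<^sub>M borel) (\<lambda>\<omega>. (X1 \<omega> u, X2 \<omega> u))
       (\<lambda>(x1, x2). \<kappa>1 x1 \<Otimes>\<^sub>M \<kappa>2 x2)"

text \<open>\<open>E((X1 u - X2 u)\<^sup>2 | X1 = x = X2 on S)\<close>, as an extended nonnegative number.\<close>

definition cond_sq_diff ::
    "((real \<Rightarrow> real) \<Rightarrow> real measure) \<Rightarrow> ((real \<Rightarrow> real) \<Rightarrow> real measure) \<Rightarrow> (real \<Rightarrow> real) \<Rightarrow> ennreal" where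
  "cond_sq_diff \<kappa>1 \<kappa>2 x = (\<integral>\<^sup>+y. ennreal ((fst y - snd y)\<^sup>2) \<partial>(\<kappa>1 x \<Otimes>\<^sub>M \<kappa>2 x))"

end

theory Submission
  imports Defs "HOL-Complex_Analysis.Great_Picard"
begin

text \<open>
  Write \<open>\<xi> k\<close> for the scores, \<open>\<psi> k\<close> for the extended eigenfunctions and \<open>S\<close> for the observed part. Since
  \<open>E (X u * \<xi> k) = l k * \<psi> k u\<close> and the scores are orthogonal with mean squares \<open>l k\<close>, the partial sums of the
  reconstruction at \<open>u\<close> are the orthogonal projections of \<open>X u\<close> onto the first scores. Bessel's
  inequality makes them converge in mean square, so the reconstruction \<open>R u\<close> is the projection of \<open>X u\<close>
  onto the closed span of all scores, the error \<open>Z u\<close> is orthogonal to that span, and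
  Pythagoras gives its mean square.

  Part (a) needs more: the error must be orthogonal to the values \<open>X v\<close> with \<open>v\<close> in \<open>S\<close>, so these have to
  lie in the closed span of the scores, at every single point \<open>v\<close> (lemma \<open>Karhunen_Loeve\<close>). The
  mean square defect at \<open>v\<close> is the diagonal of the remainder kernel
  \<open>\<gamma> - (\<Sum>k. l k * \<psi> k * \<psi> k)\<close>. This kernel is continuous and symmetric. If it did not vanish on \<open>S\<close>, it would
  have an eigenfunction with nonzero eigenvalue (lemma \<open>eigenvalue_exists\<close>), which would be
  orthogonal to all \<open>\<phi> k\<close> and would thus be an eigenfunction of the covariance operator that is not in
  the list.

  For part (b), continuity along the expansion puts \<open>L X u\<close> into the closed span of the scores, so
  Pythagoras applies to \<open>Z u\<close> and \<open>R u - L X u\<close>.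

  For part (c), the scores are mean square limits of finite combinations of observed values, because a
  path can be replaced by a step function (lemma \<open>score_in_observed_span\<close>). Hence \<open>R u\<close> is almost surely
  a function of the observed path, and the observed values together with \<open>Z u\<close> are jointly Gaussian and
  uncorrelated. Characteristic functions and a Cramer-Wold argument turn this into independence of
  the observed path and \<open>Z u\<close> (lemma \<open>observed_independent_error\<close>). So the conditional law of \<open>X u\<close> given the path
  \<open>x\<close> is the law of \<open>r x + Z u\<close> for a measurable \<open>r\<close>, and this disintegration is essentially unique
  (lemma \<open>kernel_unique\<close>). Two conditionally independent copies with the same path differ by two
  independent copies of \<open>Z u\<close>, whose mean square difference is twice the variance.
\<close>

section \<open>Convergence in mean square\<close>

definition sq_integrable :: "'a measure \<Rightarrow> ('a \<Rightarrow> real) \<Rightarrow> bool" where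
  "sq_integrable M f \<longleftrightarrow> f \<in> borel_measurable M \<and> integrable M (\<lambda>x. (f x)\<^sup>2)"

lemma L2_iff_sq_integrable: "f \<in> L2 S \<longleftrightarrow> sq_integrable (lebesgue_on S) f"
  by (simp add: L2_def sq_integrable_def)

lemma sq_integrable_measurable [measurable_dest]: "sq_integrable M f \<Longrightarrow> f \<in> borel_measurable M"
  by (simp add: sq_integrable_def)

lemma sq_integrable_square: "sq_integrable M f \<Longrightarrow> integrable M (\<lambda>x. (f x)\<^sup>2)"
  by (simp add: sq_integrable_def)

lemma sq_integrable_times:
  assumes f: "sq_integrable M f" and g: "sq_integrable M g"
  shows "integrable M (\<lambda>x. f x * g x)"
proof (rule Bochner_Integration.integrable_bound)
  show "integrable M (\<lambda>x. (f x)\<^sup>2 + (g x)\<^sup>2)"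
    using f g by (simp add: sq_integrable_square)
  show "(\<lambda>x. f x * g x) \<in> borel_measurable M"
    using f g by measurable
  have "\<bar>p * q\<bar> \<le> p\<^sup>2 + q\<^sup>2" for p q :: real
  proof -
    have "2 * (\<bar>p\<bar> * \<bar>q\<bar>) \<le> p\<^sup>2 + q\<^sup>2"
      using sum_squares_bound[of "\<bar>p\<bar>" "\<bar>q\<bar>"] by simp
    moreover have "0 \<le> \<bar>p\<bar> * \<bar>q\<bar>" by simp
    ultimately show ?thesis unfolding abs_mult by linarith
  qed
  then show "AE x in M. norm (f x * g x) \<le> norm ((f x)\<^sup>2 + (g x)\<^sup>2)" by simp
qed

lemma sq_integrable_cmult: "sq_integrable M f \<Longrightarrow> sq_integrable M (\<lambda>x. c * f x)"
  unfolding sq_integrable_def power_mult_distrib by auto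

lemma sq_integrable_add:
  assumes f: "sq_integrable M f" and g: "sq_integrable M g"
  shows "sq_integrable M (\<lambda>x. f x + g x)"
  unfolding sq_integrable_def power2_sum
  using assms sq_integrable_times[OF sq_integrable_cmult[OF f, of 2] g]
  by (auto simp: sq_integrable_def)

lemma sq_integrable_diff:
  assumes f: "sq_integrable M f" and g: "sq_integrable M g"
  shows "sq_integrable M (\<lambda>x. f x - g x)"
  using sq_integrable_add[OF f sq_integrable_cmult[OF g, of "-1"]] by simp

lemma sq_integrable_zero: "sq_integrable M (\<lambda>_. 0)"
  by (simp add: sq_integrable_def)

lemma sq_integrable_sum:
  "(\<And>i. i \<in> I \<Longrightarrow> sq_integrable M (f i)) \<Longrightarrow> sq_integrable M (\<lambda>x. \<Sum>i\<in>I. f i x)"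
  by (induction I rule: infinite_finite_induct) (auto simp: sq_integrable_zero sq_integrable_add)

text \<open>Expanding the square of a combination turns every statement about a mean square distance
  into one about inner products.\<close>

lemma integral_square_diff:
  assumes f: "sq_integrable M f" and g: "sq_integrable M g"
  shows "(\<integral>x. (f x - c * g x)\<^sup>2 \<partial>M)
    = (\<integral>x. (f x)\<^sup>2 \<partial>M) - 2 * c * (\<integral>x. f x * g x \<partial>M) + c\<^sup>2 * (\<integral>x. (g x)\<^sup>2 \<partial>M)"
proof -
  have "(\<integral>x. (f x - c * g x)\<^sup>2 \<partial>M) = (\<integral>x. ((f x)\<^sup>2 - 2 * c * (f x * g x)) + c\<^sup>2 * (g x)\<^sup>2 \<partial>M)"
    by (rule Bochner_Integration.integral_cong) (auto simp: power2_eq_square algebra_simps)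
  also have "\<dots> = (\<integral>x. (f x)\<^sup>2 \<partial>M) - 2 * c * (\<integral>x. f x * g x \<partial>M) + c\<^sup>2 * (\<integral>x. (g x)\<^sup>2 \<partial>M)"
    using sq_integrable_times[OF f g] f g by (simp add: sq_integrable_def)
  finally show ?thesis .
qed

text \<open>The mean square distance from \<open>f\<close> to \<open>c g\<close> is a nonnegative quadratic polynomial in \<open>c\<close>;
  its value at the minimising \<open>c\<close> is the inequality.\<close>

lemma integral_Cauchy_Schwarz:
  assumes f: "sq_integrable M f" and g: "sq_integrable M g"
  shows "(\<integral>x. f x * g x \<partial>M)\<^sup>2 \<le> (\<integral>x. (f x)\<^sup>2 \<partial>M) * (\<integral>x. (g x)\<^sup>2 \<partial>M)"
proof -
  let ?F = "\<integral>x. (f x)\<^sup>2 \<partial>M" and ?G = "\<integral>x. (g x)\<^sup>2 \<partial>M" and ?I = "\<integral>x. f x * g x \<partial>M"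
  have q: "0 \<le> ?F - 2 * c * ?I + c\<^sup>2 * ?G" for c
    unfolding integral_square_diff[OF f g, symmetric] by simp
  have G: "0 \<le> ?G" by simp
  show ?thesis
  proof (cases "?G = 0")
    case True
    have "?I = 0"
    proof (rule ccontr)
      assume "?I \<noteq> 0"
      then show False using q[of "(?F + 1) / (2 * ?I)"] True by simp
    qed
    then show ?thesis using True by simp
  next
    case False
    have "0 \<le> ?G * (?F - 2 * (?I / ?G) * ?I + (?I / ?G)\<^sup>2 * ?G)"
      using q[of "?I / ?G"] G by (rule mult_nonneg_nonneg[rotated])
    also have "\<dots> = ?F * ?G - ?I\<^sup>2"
      using False by (simp add: field_simps power2_eq_square)
    finally show ?thesis by simp
  qed
qed

lemma integral_abs_times_le:
  assumes f: "sq_integrable M f" and g: "sq_integrable M g"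
  shows "\<bar>\<integral>x. f x * g x \<partial>M\<bar> \<le> sqrt (\<integral>x. (f x)\<^sup>2 \<partial>M) * sqrt (\<integral>x. (g x)\<^sup>2 \<partial>M)"
  using real_sqrt_le_mono[OF integral_Cauchy_Schwarz[OF f g]] by (simp add: real_sqrt_mult)

lemma integral_square_add_le:
  assumes f: "sq_integrable M f" and g: "sq_integrable M g"
  shows "(\<integral>x. (f x + g x)\<^sup>2 \<partial>M) \<le> 2 * (\<integral>x. (f x)\<^sup>2 \<partial>M) + 2 * (\<integral>x. (g x)\<^sup>2 \<partial>M)"
proof -
  have "(\<integral>x. (f x + g x)\<^sup>2 \<partial>M) \<le> (\<integral>x. 2 * (f x)\<^sup>2 + 2 * (g x)\<^sup>2 \<partial>M)"
  proof (rule integral_mono)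
    fix x show "(f x + g x)\<^sup>2 \<le> 2 * (f x)\<^sup>2 + 2 * (g x)\<^sup>2"
      using zero_le_power2[of "f x - g x"] by (simp add: power2_eq_square algebra_simps)
  qed (use sq_integrable_add[OF f g] f g in \<open>auto simp: sq_integrable_def\<close>)
  then show ?thesis using f g by (simp add: sq_integrable_def)
qed

lemma integral_square_zero_AE:
  assumes f: "sq_integrable M f" and z: "(\<integral>x. (f x)\<^sup>2 \<partial>M) = 0"
  shows "AE x in M. f x = 0"
  using z integral_nonneg_eq_0_iff_AE[OF sq_integrable_square[OF f]] by auto

definition L2_conv :: "'a measure \<Rightarrow> (nat \<Rightarrow> 'a \<Rightarrow> real) \<Rightarrow> ('a \<Rightarrow> real) \<Rightarrow> bool" where
  "L2_conv M f g \<longleftrightarrow> (\<lambda>n. \<integral>x. (g x - f n x)\<^sup>2 \<partial>M) \<longlonglongrightarrow> 0"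

lemma L2_conv_times:
  assumes f: "\<And>n. sq_integrable M (f n)" and g: "sq_integrable M g" and h: "sq_integrable M h"
    and c: "L2_conv M f g"
  shows "(\<lambda>n. \<integral>x. f n x * h x \<partial>M) \<longlonglongrightarrow> (\<integral>x. g x * h x \<partial>M)"
proof (rule LIM_zero_cancel, rule Lim_null_comparison)
  have d: "sq_integrable M (\<lambda>x. g x - f n x)" for n by (intro sq_integrable_diff f g)
  have "(\<integral>x. f n x * h x \<partial>M) - (\<integral>x. g x * h x \<partial>M) = - (\<integral>x. (g x - f n x) * h x \<partial>M)" for n
    using sq_integrable_times[OF f h] sq_integrable_times[OF g h] by (simp add: left_diff_distrib)
  then show "\<forall>\<^sub>F n in sequentially. norm ((\<integral>x. f n x * h x \<partial>M) - (\<integral>x. g x * h x \<partial>M))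
      \<le> sqrt (\<integral>x. (g x - f n x)\<^sup>2 \<partial>M) * sqrt (\<integral>x. (h x)\<^sup>2 \<partial>M)"
    using integral_abs_times_le[OF d h] by simp
  show "(\<lambda>n. sqrt (\<integral>x. (g x - f n x)\<^sup>2 \<partial>M) * sqrt (\<integral>x. (h x)\<^sup>2 \<partial>M)) \<longlonglongrightarrow> 0"
    using tendsto_mult_left_zero[OF tendsto_real_sqrt[OF c[unfolded L2_conv_def], unfolded real_sqrt_zero]] .
qed

lemma L2_conv_square:
  assumes f: "\<And>n. sq_integrable M (f n)" and g: "sq_integrable M g" and c: "L2_conv M f g"
  shows "(\<lambda>n. \<integral>x. (f n x)\<^sup>2 \<partial>M) \<longlonglongrightarrow> (\<integral>x. (g x)\<^sup>2 \<partial>M)"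
proof -
  have eq: "(\<integral>x. (f n x)\<^sup>2 \<partial>M)
      = (\<integral>x. (g x - f n x)\<^sup>2 \<partial>M) - (\<integral>x. (g x)\<^sup>2 \<partial>M) + 2 * (\<integral>x. f n x * g x \<partial>M)" for n
    using integral_square_diff[OF g f, of 1] by (simp add: mult.commute)
  have "(\<lambda>n. \<integral>x. (f n x)\<^sup>2 \<partial>M) \<longlonglongrightarrow> 0 - (\<integral>x. (g x)\<^sup>2 \<partial>M) + 2 * (\<integral>x. g x * g x \<partial>M)"
    unfolding eq by (intro tendsto_intros L2_conv_times assms c[unfolded L2_conv_def])
  then show ?thesis by (simp add: power2_eq_square)
qed

lemma L2_conv_cmult:
  assumes c: "L2_conv M f g"
  shows "L2_conv M (\<lambda>n x. c * f n x) (\<lambda>x. c * g x)"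
proof -
  have "(\<integral>x. (c * g x - c * f n x)\<^sup>2 \<partial>M) = c\<^sup>2 * (\<integral>x. (g x - f n x)\<^sup>2 \<partial>M)" for n
    by (simp add: right_diff_distrib[symmetric] power_mult_distrib del: right_diff_distrib)
  then show ?thesis
    using tendsto_mult_right_zero[OF c[unfolded L2_conv_def]] by (simp add: L2_conv_def)
qed

text \<open>By the Cauchy-Schwarz inequality the mean of \<open>\<bar>d n\<bar>\<close> decays like \<open>(1/2) ^ n\<close>, so the sum of these
  functions has a finite integral.\<close>

lemma AE_summable_of_geometric_mean_squares:
  assumes M: "finite_measure M" and d: "\<And>n. sq_integrable M (d n)"
    and b: "\<And>n. (\<integral>x. (d n x)\<^sup>2 \<partial>M) \<le> (1/4) ^ n"
  shows "AE x in M. summable (\<lambda>n. \<bar>d n x\<bar>)"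
proof -
  interpret finite_measure M by fact
  have one: "sq_integrable M (\<lambda>_. 1)" by (simp add: sq_integrable_def)
  have ab: "sq_integrable M (\<lambda>x. \<bar>d n x\<bar>)" for n using d[of n] by (auto simp: sq_integrable_def)
  have ia: "integrable M (\<lambda>x. \<bar>d n x\<bar>)" for n using sq_integrable_times[OF ab one] by simp
  have le: "(\<integral>x. \<bar>d n x\<bar> \<partial>M) \<le> sqrt (measure M (space M)) * (1/2) ^ n" for n
  proof -
    have "(\<integral>x. \<bar>d n x\<bar> \<partial>M) \<le> sqrt (\<integral>x. (d n x)\<^sup>2 \<partial>M) * sqrt (measure M (space M))"
      using integral_abs_times_le[OF ab one] by simp
    also have "sqrt (\<integral>x. (d n x)\<^sup>2 \<partial>M) \<le> sqrt ((1/4) ^ n)" by (intro real_sqrt_le_mono b)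
    also have "sqrt ((1/4::real) ^ n) = (1/2) ^ n" by (simp add: real_sqrt_power real_sqrt_divide)
    finally show ?thesis by (simp add: mult.commute mult_right_mono)
  qed
  have "(\<integral>\<^sup>+x. (\<Sum>n. ennreal \<bar>d n x\<bar>) \<partial>M) = (\<Sum>n. \<integral>\<^sup>+x. ennreal \<bar>d n x\<bar> \<partial>M)"
    using d by (intro nn_integral_suminf) (auto dest: sq_integrable_measurable)
  also have "\<dots> = (\<Sum>n. ennreal (\<integral>x. \<bar>d n x\<bar> \<partial>M))"
    by (intro suminf_cong nn_integral_eq_integral ia) simp
  also have "\<dots> \<le> (\<Sum>n. ennreal (sqrt (measure M (space M)) * (1/2) ^ n))"
    by (intro suminf_le ennreal_leI le) auto
  also have "\<dots> < \<infinity>"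
    by (subst suminf_ennreal2) (auto intro!: summable_mult)
  finally have fin: "(\<integral>\<^sup>+x. (\<Sum>n. ennreal \<bar>d n x\<bar>) \<partial>M) \<noteq> \<infinity>" by simp
  have "AE x in M. (\<Sum>n. ennreal \<bar>d n x\<bar>) \<noteq> \<infinity>"
    using d by (intro nn_integral_noteq_infinite fin) (auto dest: sq_integrable_measurable)
  then show ?thesis
  proof (rule AE_mp, intro AE_I2 impI)
    fix x assume "(\<Sum>n. ennreal \<bar>d n x\<bar>) \<noteq> \<infinity>"
    then show "summable (\<lambda>n. \<bar>d n x\<bar>)" by (intro summable_suminf_not_top) auto
  qed
qed

lemma AE_tendsto_of_geometric_mean_squares:
  assumes M: "finite_measure M" and f: "\<And>n. sq_integrable M (f n)" and g: "sq_integrable M g"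
    and b: "\<And>n. (\<integral>x. (g x - f n x)\<^sup>2 \<partial>M) \<le> (1/4) ^ n"
  shows "AE x in M. (\<lambda>n. f n x) \<longlonglongrightarrow> g x"
  using AE_summable_of_geometric_mean_squares[OF M sq_integrable_diff[OF g f] b]
proof (rule AE_mp, intro AE_I2 impI)
  fix x assume "summable (\<lambda>n. \<bar>g x - f n x\<bar>)"
  then have "(\<lambda>n. \<bar>g x - f n x\<bar>) \<longlonglongrightarrow> 0" by (rule summable_LIMSEQ_zero)
  then have "(\<lambda>n. f n x - g x) \<longlonglongrightarrow> 0"
    by (subst tendsto_rabs_zero_iff[symmetric]) (simp add: abs_minus_commute)
  then show "(\<lambda>n. f n x) \<longlonglongrightarrow> g x" by (rule LIM_zero_cancel)
qed

text \<open>The increments are summable almost everywhere, so the pointwise limit exists there, and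
  Fatou's lemma turns it into a limit in mean square. Having the limit given by the explicit formula
  \<open>lim\<close>, and not by completeness of an abstract space of classes, keeps it measurable in
  additional parameters.\<close>

lemma lim_of_rapidly_Cauchy:
  assumes M: "finite_measure M" and f: "\<And>n. sq_integrable M (f n)"
    and b: "\<And>n m. n \<le> m \<Longrightarrow> (\<integral>x. (f m x - f n x)\<^sup>2 \<partial>M) \<le> (1/4) ^ n"
  shows "sq_integrable M (\<lambda>x. lim (\<lambda>n. f n x))"
    and "(\<integral>x. (lim (\<lambda>n. f n x) - f n x)\<^sup>2 \<partial>M) \<le> (1/4) ^ n"
proof -
  let ?g = "\<lambda>x. lim (\<lambda>n. f n x)"
  have fm [measurable]: "f n \<in> borel_measurable M" for n using f by (auto dest: sq_integrable_measurable)
  have gm [measurable]: "?g \<in> borel_measurable M" by measurable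
  have "AE x in M. summable (\<lambda>n. \<bar>f (Suc n) x - f n x\<bar>)"
    by (rule AE_summable_of_geometric_mean_squares[OF M sq_integrable_diff[OF f f] b]) simp
  then have conv: "AE x in M. (\<lambda>n. f n x) \<longlonglongrightarrow> ?g x"
  proof (rule AE_mp, intro AE_I2 impI)
    fix x assume "summable (\<lambda>n. \<bar>f (Suc n) x - f n x\<bar>)"
    then have "summable (\<lambda>n. f (Suc n) x - f n x)" by (rule summable_rabs_cancel)
    then have "convergent (\<lambda>n. \<Sum>k<n. f (Suc k) x - f k x)" by (simp add: summable_iff_convergent)
    then have "convergent (\<lambda>n. f n x - f 0 x)" by (simp add: sum_lessThan_telescope[of "\<lambda>k. f k x"])
    then have "convergent (\<lambda>n. (f n x - f 0 x) + f 0 x)" by (intro convergent_add convergent_const)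
    then show "(\<lambda>n. f n x) \<longlonglongrightarrow> ?g x" by (simp add: convergent_LIMSEQ_iff)
  qed
  have nn: "(\<integral>\<^sup>+x. ennreal ((?g x - f n x)\<^sup>2) \<partial>M) \<le> ennreal ((1/4) ^ n)" for n
  proof -
    have "(\<integral>\<^sup>+x. ennreal ((?g x - f n x)\<^sup>2) \<partial>M)
        = (\<integral>\<^sup>+x. liminf (\<lambda>m. ennreal ((f m x - f n x)\<^sup>2)) \<partial>M)"
    proof (rule nn_integral_cong_AE, rule AE_mp[OF conv], intro AE_I2 impI)
      fix x assume "(\<lambda>n. f n x) \<longlonglongrightarrow> ?g x"
      then have "(\<lambda>m. ennreal ((f m x - f n x)\<^sup>2)) \<longlonglongrightarrow> ennreal ((?g x - f n x)\<^sup>2)"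
        by (intro tendsto_intros)
      then show "ennreal ((?g x - f n x)\<^sup>2) = liminf (\<lambda>m. ennreal ((f m x - f n x)\<^sup>2))"
        by (intro lim_imp_Liminf[symmetric]) simp_all
    qed
    also have "\<dots> \<le> liminf (\<lambda>m. \<integral>\<^sup>+x. ennreal ((f m x - f n x)\<^sup>2) \<partial>M)"
      by (rule nn_integral_liminf) measurable
    also have "\<dots> \<le> ennreal ((1/4) ^ n)"
    proof (rule Liminf_le)
      have "(\<integral>\<^sup>+x. ennreal ((f m x - f n x)\<^sup>2) \<partial>M) \<le> ennreal ((1/4) ^ n)" if "n \<le> m" for m
        using b[OF that] sq_integrable_diff[OF f[of m] f[of n]]
        by (subst nn_integral_eq_integral) (auto simp: sq_integrable_def intro: ennreal_leI)
      then show "\<forall>\<^sub>F m in sequentially. (\<integral>\<^sup>+x. ennreal ((f m x - f n x)\<^sup>2) \<partial>M) \<le> ennreal ((1/4) ^ n)"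
        by (auto simp: eventually_sequentially)
    qed simp
    finally show ?thesis .
  qed
  have d: "integrable M (\<lambda>x. (?g x - f n x)\<^sup>2)" for n
    by (rule integrableI_bounded) (use nn[of n] in \<open>auto simp: less_top[symmetric] top_unique\<close>)
  then have "sq_integrable M (\<lambda>x. (?g x - f 0 x) + f 0 x)"
    by (intro sq_integrable_add f) (auto simp: sq_integrable_def)
  then show "sq_integrable M ?g" by simp
  show "(\<integral>x. (?g x - f n x)\<^sup>2 \<partial>M) \<le> (1/4) ^ n"
    using nn[of n] by (subst (asm) nn_integral_eq_integral[OF d]) (auto simp: ennreal_le_iff)
qed

lemma sq_integrable_pair:
  assumes M: "sigma_finite_measure M" and N: "sigma_finite_measure N"
    and G: "(\<lambda>(x, y). G x y) \<in> borel_measurable (M \<Otimes>\<^sub>M N)"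
    and fin: "(\<integral>\<^sup>+y. \<integral>\<^sup>+x. ennreal ((G x y)\<^sup>2) \<partial>M \<partial>N) < \<infinity>"
  shows "sq_integrable (M \<Otimes>\<^sub>M N) (\<lambda>(x, y). G x y)"
proof -
  interpret pair_sigma_finite M N using M N by (simp add: pair_sigma_finite_def)
  note G [measurable]
  have "(\<integral>\<^sup>+p. ennreal (((\<lambda>(x, y). G x y) p)\<^sup>2) \<partial>(M \<Otimes>\<^sub>M N)) = (\<integral>\<^sup>+y. \<integral>\<^sup>+x. ennreal ((G x y)\<^sup>2) \<partial>M \<partial>N)"
    by (subst nn_integral_snd[symmetric]) (auto simp: case_prod_beta)
  then have "integrable (M \<Otimes>\<^sub>M N) (\<lambda>p. ((\<lambda>(x, y). G x y) p)\<^sup>2)"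
    using fin by (intro integrableI_nonneg) auto
  then show ?thesis using G by (simp add: sq_integrable_def)
qed

text \<open>The kernel and the tensor product of the two functions are both square integrable on the product
  space, so their product is integrable there and Fubini's theorem applies.\<close>

lemma sq_integrable_swap:
  assumes M: "sigma_finite_measure M" and N: "sigma_finite_measure N"
    and G: "sq_integrable (M \<Otimes>\<^sub>M N) (\<lambda>(x, y). G x y)"
    and f: "sq_integrable M f" and g: "sq_integrable N g"
  shows "(\<integral>x. f x * (\<integral>y. G x y * g y \<partial>N) \<partial>M) = (\<integral>y. (\<integral>x. G x y * f x \<partial>M) * g y \<partial>N)"
proof -
  interpret pair_sigma_finite M N using M N by (simp add: pair_sigma_finite_def)
  have [measurable]: "f \<in> borel_measurable M" "g \<in> borel_measurable N" using f g by measurable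
  have "(\<integral>\<^sup>+y. \<integral>\<^sup>+x. ennreal ((f x * g y)\<^sup>2) \<partial>M \<partial>N)
      = (\<integral>\<^sup>+y. (\<integral>\<^sup>+x. ennreal ((f x)\<^sup>2) \<partial>M) * ennreal ((g y)\<^sup>2) \<partial>N)"
    by (simp add: power_mult_distrib ennreal_mult nn_integral_multc)
  also have "\<dots> = (\<integral>\<^sup>+x. ennreal ((f x)\<^sup>2) \<partial>M) * (\<integral>\<^sup>+y. ennreal ((g y)\<^sup>2) \<partial>N)"
    by (simp add: nn_integral_cmult)
  also have "\<dots> < \<infinity>"
    using f g by (simp add: sq_integrable_def nn_integral_eq_integral ennreal_mult[symmetric])
  finally have "sq_integrable (M \<Otimes>\<^sub>M N) (\<lambda>(x, y). f x * g y)"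
    by (intro sq_integrable_pair M N) auto
  from sq_integrable_times[OF G this]
  have i: "integrable (M \<Otimes>\<^sub>M N) (\<lambda>(x, y). G x y * (f x * g y))" by (simp add: case_prod_unfold)
  have "(\<integral>x. f x * (\<integral>y. G x y * g y \<partial>N) \<partial>M) = (\<integral>x. (\<integral>y. G x y * (f x * g y) \<partial>N) \<partial>M)"
    by (simp add: mult.left_commute)
  also have "\<dots> = (\<integral>y. (\<integral>x. G x y * (f x * g y) \<partial>M) \<partial>N)"
    using Fubini_integral[OF i] by simp
  also have "\<dots> = (\<integral>y. (\<integral>x. G x y * f x \<partial>M) * g y \<partial>N)"
    by (simp add: mult.assoc[symmetric])
  finally show ?thesis .
qed

section \<open>Eigenvalues of continuous symmetric kernels\<close>

definition kernel_op :: "real set \<Rightarrow> (real \<Rightarrow> real \<Rightarrow> real) \<Rightarrow> (real \<Rightarrow> real) \<Rightarrow> real \<Rightarrow> real" where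
  "kernel_op S K f u = (\<integral>v. K u v * f v \<partial>lebesgue_on S)"

lemma compact_finite_measure_lebesgue_on:
  fixes S :: "real set"
  assumes "compact S" shows "finite_measure (lebesgue_on S)"
proof
  have "S \<in> lmeasurable" using assms by (rule lmeasurable_compact)
  then show "emeasure (lebesgue_on S) (space (lebesgue_on S)) \<noteq> \<infinity>"
    by (auto simp: emeasure_restrict_space fmeasurable_def simp del: emeasure_completion)
qed

lemma continuous_on_sq_integrable:
  fixes S :: "real set"
  assumes S: "compact S" and f: "continuous_on S f"
  shows "sq_integrable (lebesgue_on S) f"
proof -
  interpret finite_measure "lebesgue_on S" by (rule compact_finite_measure_lebesgue_on[OF S])
  have m: "f \<in> borel_measurable (lebesgue_on S)"
    using f S by (intro continuous_imp_measurable_on_sets_lebesgue) (auto simp: lmeasurable_compact fmeasurableD)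
  obtain B where B: "\<And>x. x \<in> S \<Longrightarrow> \<bar>f x\<bar> \<le> B"
    using compact_imp_bounded[OF compact_continuous_image[OF f S]] by (auto simp: bounded_iff)
  have "integrable (lebesgue_on S) (\<lambda>x. (f x)\<^sup>2)"
  proof (rule integrable_const_bound[where B="B\<^sup>2"])
    show "AE x in lebesgue_on S. norm ((f x)\<^sup>2) \<le> B\<^sup>2"
    proof (rule AE_I2)
      fix x assume "x \<in> space (lebesgue_on S)"
      then show "norm ((f x)\<^sup>2) \<le> B\<^sup>2" using power_mono[OF B abs_ge_zero, of x 2] by simp
    qed
  qed (use m in measurable)
  then show ?thesis using m by (simp add: sq_integrable_def)
qed

lemma continuous_kernel_measurable:
  fixes S :: "real set" and K :: "real \<Rightarrow> real \<Rightarrow> real"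
  assumes S: "compact S" and K: "continuous_on (S \<times> S) (\<lambda>(u, v). K u v)"
  shows "(\<lambda>(u, v). K u v) \<in> borel_measurable (lebesgue_on S \<Otimes>\<^sub>M lebesgue_on S)"
proof -
  have [measurable]: "(\<lambda>x. x) \<in> lebesgue_on S \<rightarrow>\<^sub>M borel"
    by (intro measurable_restrict_space1 measurable_completion) simp
  have "(\<lambda>p. indicator (S \<times> S) p *\<^sub>R (\<lambda>(u, v). K u v) p) \<in> borel_measurable borel"
    using K S by (intro borel_measurable_continuous_on_indicator) (auto intro!: borel_closed compact_imp_closed compact_Times)
  then have [measurable]: "(\<lambda>p. indicator (S \<times> S) p *\<^sub>R (\<lambda>(u, v). K u v) p) \<in> borel_measurable (borel \<Otimes>\<^sub>M borel)"
    by (simp add: borel_prod)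
  have "(\<lambda>(u, v). indicator (S \<times> S) (u, v) *\<^sub>R (\<lambda>(u, v). K u v) (u, v)) \<in> borel_measurable (lebesgue_on S \<Otimes>\<^sub>M lebesgue_on S)"
    by measurable
  then show ?thesis
    by (rule measurable_cong[THEN iffD1, rotated]) (auto simp: space_pair_measure)
qed

locale continuous_kernel =
  fixes S :: "real set" and K :: "real \<Rightarrow> real \<Rightarrow> real"
  assumes compact: "compact S" and continuous: "continuous_on (S \<times> S) (\<lambda>(u, v). K u v)"
    and symmetric: "\<And>u v. u \<in> S \<Longrightarrow> v \<in> S \<Longrightarrow> K u v = K v u"
begin

abbreviation "L \<equiv> lebesgue_on S"
abbreviation "T \<equiv> kernel_op S K"
abbreviation "nrm f \<equiv> sqrt (\<integral>x. (f x)\<^sup>2 \<partial>L)"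

lemma fin: "finite_measure L" by (rule compact_finite_measure_lebesgue_on[OF compact])

lemma sigma: "sigma_finite_measure L"
  using fin by (rule finite_measure.axioms)

lemma sq_K: "u \<in> S \<Longrightarrow> sq_integrable L (K u)"
  by (rule continuous_on_sq_integrable[OF compact])
    (rule continuous_on_compose2[OF continuous, of S "\<lambda>v. (u, v)", simplified], auto intro!: continuous_intros)

lemma bound: obtains B where "0 \<le> B" "\<And>u v. u \<in> S \<Longrightarrow> v \<in> S \<Longrightarrow> \<bar>K u v\<bar> \<le> B"
proof -
  obtain B where B: "\<And>p. p \<in> S \<times> S \<Longrightarrow> \<bar>(\<lambda>(u, v). K u v) p\<bar> \<le> B"
    using compact_imp_bounded[OF compact_continuous_image[OF continuous compact_Times[OF compact compact]]]
    by (auto simp: bounded_iff)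
  have "\<bar>K u v\<bar> \<le> max B 0" if "u \<in> S" "v \<in> S" for u v using B[of "(u, v)"] that by simp
  then show thesis using that[of "max B 0"] by simp
qed

lemma op_diff_le:
  assumes f: "sq_integrable L f" and u: "u \<in> S" "u' \<in> S"
    and e: "\<And>v. v \<in> S \<Longrightarrow> \<bar>K u v - K u' v\<bar> \<le> e"
  shows "\<bar>T f u - T f u'\<bar> \<le> e * sqrt (measure L S) * nrm f"
proof (cases "S = {}")
  case False
  interpret finite_measure L by (rule fin)
  have e0: "0 \<le> e" using e False by force
  have "T f u - T f u' = (\<integral>v. (K u v - K u' v) * f v \<partial>L)"
    unfolding kernel_op_def left_diff_distrib
    using u f by (intro Bochner_Integration.integral_diff[symmetric] sq_integrable_times sq_K)
  also have "\<bar>\<dots>\<bar> \<le> nrm (\<lambda>v. K u v - K u' v) * nrm f"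
    by (intro integral_abs_times_le sq_integrable_diff sq_K u f)
  also have "nrm (\<lambda>v. K u v - K u' v) \<le> sqrt (\<integral>v. e\<^sup>2 \<partial>L)"
  proof (intro real_sqrt_le_mono integral_mono)
    show "(K u v - K u' v)\<^sup>2 \<le> e\<^sup>2" if "v \<in> space L" for v
      using power_mono[OF e, of v 2] that by simp
  qed (use sq_integrable_diff[OF sq_K sq_K] u in \<open>auto simp: sq_integrable_def\<close>)
  also have "\<dots> = e * sqrt (measure L S)"
    using e0 by (simp add: real_sqrt_mult)
  finally show ?thesis by (simp add: mult_right_mono)
qed (use u in simp)

lemma op_bound:
  obtains C where "0 \<le> C" "\<And>f u. sq_integrable L f \<Longrightarrow> u \<in> S \<Longrightarrow> \<bar>T f u\<bar> \<le> C * nrm f"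
proof -
  interpret finite_measure L by (rule fin)
  obtain B where B: "0 \<le> B" "\<And>u v. u \<in> S \<Longrightarrow> v \<in> S \<Longrightarrow> \<bar>K u v\<bar> \<le> B" using bound by blast
  have "\<bar>T f u\<bar> \<le> (B * sqrt (measure L S)) * nrm f" if f: "sq_integrable L f" and u: "u \<in> S" for f u
  proof -
    have "\<bar>T f u\<bar> \<le> nrm (K u) * nrm f" unfolding kernel_op_def
      by (intro integral_abs_times_le sq_K u f)
    also have "nrm (K u) \<le> sqrt (\<integral>v. B\<^sup>2 \<partial>L)"
    proof (intro real_sqrt_le_mono integral_mono)
      show "(K u v)\<^sup>2 \<le> B\<^sup>2" if "v \<in> space L" for v
        using power_mono[OF B(2)[OF u], of v 2] that by simp
    qed (use sq_K[OF u] in \<open>auto simp: sq_integrable_def\<close>)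
    also have "\<dots> = B * sqrt (measure L S)" using B(1) by (simp add: real_sqrt_mult)
    finally show ?thesis by (simp add: mult_right_mono)
  qed
  then show thesis using B(1) that[of "B * sqrt (measure L S)"] by simp
qed

lemma modulus:
  assumes "0 < e"
  obtains d where "0 < d" "\<And>u u' v. \<lbrakk>u \<in> S; u' \<in> S; v \<in> S; \<bar>u - u'\<bar> < d\<rbrakk> \<Longrightarrow> \<bar>K u v - K u' v\<bar> \<le> e"
proof -
  have "uniformly_continuous_on (S \<times> S) (\<lambda>(u, v). K u v)"
    by (intro compact_uniformly_continuous continuous compact_Times compact)
  then obtain d where d: "0 < d"
    "\<And>p q. p \<in> S \<times> S \<Longrightarrow> q \<in> S \<times> S \<Longrightarrow> dist q p < d \<Longrightarrow> dist ((\<lambda>(u, v). K u v) q) ((\<lambda>(u, v). K u v) p) < e"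
    using assms unfolding uniformly_continuous_on_def by metis
  show thesis
  proof (rule that[OF d(1)])
    fix u u' v assume "u \<in> S" "u' \<in> S" "v \<in> S" "\<bar>u - u'\<bar> < d"
    then show "\<bar>K u v - K u' v\<bar> \<le> e"
      using d(2)[of "(u', v)" "(u, v)"] by (simp add: dist_Pair_Pair dist_real_def)
  qed
qed

text \<open>The modulus depends on the kernel and on a bound for the norm of \<open>f\<close> only. This is the
  compactness of the operator, in the form in which the Arzela-Ascoli theorem uses it.\<close>

lemma op_equicontinuous:
  assumes "0 < e"
  obtains d where "0 < d" "\<And>f u u'. \<lbrakk>sq_integrable L f; nrm f \<le> R; u \<in> S; u' \<in> S; \<bar>u - u'\<bar> < d\<rbrakk>
    \<Longrightarrow> \<bar>T f u - T f u'\<bar> < e"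
proof -
  define q where "q = sqrt (measure L S) * \<bar>R\<bar> + 1"
  have q: "0 < q" unfolding q_def by (intro add_nonneg_pos mult_nonneg_nonneg) auto
  obtain d where d: "0 < d" "\<And>u u' v. \<lbrakk>u \<in> S; u' \<in> S; v \<in> S; \<bar>u - u'\<bar> < d\<rbrakk> \<Longrightarrow> \<bar>K u v - K u' v\<bar> \<le> e / q"
    using modulus[of "e / q"] assms q by auto
  show thesis
  proof (rule that[OF d(1)])
    fix f u u' assume f: "sq_integrable L f" and R: "nrm f \<le> R" and u: "u \<in> S" "u' \<in> S" "\<bar>u - u'\<bar> < d"
    have "\<bar>T f u - T f u'\<bar> \<le> e / q * sqrt (measure L S) * nrm f"
      by (rule op_diff_le[OF f u(1,2)]) (use d(2) u in auto)
    also have "\<dots> \<le> e / q * sqrt (measure L S) * \<bar>R\<bar>"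
      using R assms q by (intro mult_left_mono) auto
    also have "\<dots> = e / q * (q - 1)" by (simp add: q_def)
    also have "\<dots> < e" using assms q by (simp add: field_simps)
    finally show "\<bar>T f u - T f u'\<bar> < e" .
  qed
qed

lemma op_continuous:
  assumes f: "sq_integrable L f" shows "continuous_on S (T f)"
  unfolding continuous_on_iff
proof (intro ballI allI impI)
  fix u and e :: real assume u: "u \<in> S" and e: "0 < e"
  obtain d where d: "0 < d" "\<And>f' u u'. \<lbrakk>sq_integrable L f'; nrm f' \<le> nrm f; u \<in> S; u' \<in> S; \<bar>u - u'\<bar> < d\<rbrakk>
    \<Longrightarrow> \<bar>T f' u - T f' u'\<bar> < e" using op_equicontinuous[OF e] by blast
  then show "\<exists>d>0. \<forall>u'\<in>S. dist u' u < d \<longrightarrow> dist (T f u') (T f u) < e"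
    using f u by (auto simp: dist_real_def)
qed

lemma sq_op: "sq_integrable L f \<Longrightarrow> sq_integrable L (T f)"
  by (rule continuous_on_sq_integrable[OF compact op_continuous])

lemma op_cong: "(\<And>v. v \<in> S \<Longrightarrow> f v = g v) \<Longrightarrow> T f u = T g u"
  unfolding kernel_op_def by (rule Bochner_Integration.integral_cong) auto

lemma op_diff:
  assumes f: "sq_integrable L f" and g: "sq_integrable L g" and u: "u \<in> S"
  shows "T (\<lambda>x. f x - c * g x) u = T f u - c * T g u"
proof -
  have "(\<integral>v. K u v * (f v - c * g v) \<partial>L) = (\<integral>v. K u v * f v - c * (K u v * g v) \<partial>L)"
    by (simp add: algebra_simps)
  also have "\<dots> = (\<integral>v. K u v * f v \<partial>L) - c * (\<integral>v. K u v * g v \<partial>L)"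
    using sq_integrable_times[OF sq_K[OF u] f] sq_integrable_times[OF sq_K[OF u] g] by simp
  finally show ?thesis by (simp add: kernel_op_def)
qed

lemma op_selfadjoint:
  assumes f: "sq_integrable L f" and g: "sq_integrable L g"
  shows "(\<integral>x. T f x * g x \<partial>L) = (\<integral>x. f x * T g x \<partial>L)"
proof -
  interpret finite_measure L by (rule fin)
  interpret pair_sigma_finite L L using sigma by (simp add: pair_sigma_finite_def)
  obtain B where B: "0 \<le> B" "\<And>u v. u \<in> S \<Longrightarrow> v \<in> S \<Longrightarrow> \<bar>K u v\<bar> \<le> B" using bound by blast
  have B2: "(K u v)\<^sup>2 \<le> B\<^sup>2" if "u \<in> S" "v \<in> S" for u v
    using power_mono[OF B(2)[OF that], of 2] by simp
  have "(\<integral>\<^sup>+y. \<integral>\<^sup>+x. ennreal ((K x y)\<^sup>2) \<partial>L \<partial>L) \<le> (\<integral>\<^sup>+y. \<integral>\<^sup>+x. ennreal (B\<^sup>2) \<partial>L \<partial>L)"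
    using B2 by (intro nn_integral_mono ennreal_leI) auto
  also have "\<dots> < \<infinity>" by (simp add: ennreal_mult_less_top less_top[symmetric] ennreal_mult_eq_top_iff)
  finally have K2: "sq_integrable (L \<Otimes>\<^sub>M L) (\<lambda>(u, v). K u v)"
    by (intro sq_integrable_pair sigma continuous_kernel_measurable compact continuous)
  have "(\<integral>x. f x * T g x \<partial>L) = (\<integral>y. (\<integral>x. K x y * f x \<partial>L) * g y \<partial>L)"
    unfolding kernel_op_def by (rule sq_integrable_swap[OF sigma sigma K2 f g])
  also have "\<dots> = (\<integral>y. T f y * g y \<partial>L)"
    unfolding kernel_op_def
    by (intro Bochner_Integration.integral_cong refl arg_cong2[where f="(*)"]) (auto simp: symmetric)
  finally show ?thesis by simp
qed

text \<open>Almost maximisers \<open>f n\<close> of the norm of \<open>T f\<close> on the unit ball are almost eigenvectors of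
  \<open>T \<circ> T\<close> for the squared operator norm \<open>N\<close>, because the mean square of \<open>T (T f) - N f\<close> is at most
  \<open>N * (N - \<parallel>T f\<parallel>\<^sup>2)\<close>. The functions \<open>T (T (f n))\<close> are equicontinuous, and a uniform limit \<open>g\<close> of
  a subsequence is an eigenvector of \<open>T \<circ> T\<close>. Since \<open>T \<circ> T - N\<close> factors as
  \<open>(T - m) \<circ> (T + m)\<close> with \<open>m = sqrt N\<close>, either \<open>T g + m g\<close> or \<open>g\<close> is an eigenvector of \<open>T\<close>.\<close>

theorem eigenvalue_exists:
  assumes f0: "sq_integrable L f0" and nz: "(\<integral>x. (T f0 x)\<^sup>2 \<partial>L) \<noteq> 0"
  obtains g \<mu> where "\<mu> \<noteq> 0" "sq_integrable L g" "\<not> (AE u in L. g u = 0)" "AE u in L. T g u = \<mu> * g u"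
proof -
  interpret finite_measure L by (rule fin)
  obtain C where C: "0 \<le> C" "\<And>f u. sq_integrable L f \<Longrightarrow> u \<in> S \<Longrightarrow> \<bar>T f u\<bar> \<le> C * nrm f"
    using op_bound by blast
  let ?V = "{\<integral>x. (T f x)\<^sup>2 \<partial>L | f. sq_integrable L f \<and> (\<integral>x. (f x)\<^sup>2 \<partial>L) \<le> 1}"
  have le: "(\<integral>x. (T f x)\<^sup>2 \<partial>L) \<le> C\<^sup>2 * (\<integral>x. (f x)\<^sup>2 \<partial>L) * measure L S" if f: "sq_integrable L f" for f
  proof -
    have "(\<integral>x. (T f x)\<^sup>2 \<partial>L) \<le> (\<integral>x. C\<^sup>2 * (\<integral>x. (f x)\<^sup>2 \<partial>L) \<partial>L)"
    proof (rule integral_mono)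
      show "(T f x)\<^sup>2 \<le> C\<^sup>2 * (\<integral>x. (f x)\<^sup>2 \<partial>L)" if "x \<in> space L" for x
        using power_mono[OF C(2)[OF f, of x] abs_ge_zero, of 2] that by (simp add: power_mult_distrib)
    qed (use sq_op[OF f] in \<open>auto simp: sq_integrable_def\<close>)
    then show ?thesis by (simp add: mult_ac)
  qed
  have bdd: "bdd_above ?V"
  proof (rule bdd_aboveI)
    fix y assume "y \<in> ?V"
    then obtain f where f: "sq_integrable L f" "(\<integral>x. (f x)\<^sup>2 \<partial>L) \<le> 1" "y = (\<integral>x. (T f x)\<^sup>2 \<partial>L)" by auto
    have "y \<le> C\<^sup>2 * (\<integral>x. (f x)\<^sup>2 \<partial>L) * measure L S" using le[OF f(1)] f(3) by simp
    also have "\<dots> \<le> C\<^sup>2 * 1 * measure L S" by (intro mult_right_mono mult_left_mono f(2)) auto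
    finally show "y \<le> C\<^sup>2 * measure L S" by simp
  qed
  define N where "N = Sup ?V"
  \<comment> \<open>Scaling reduces to norm 1; a function of norm 0 is mapped to 0 by the previous bound.\<close>
  have op_N: "(\<integral>x. (T f x)\<^sup>2 \<partial>L) \<le> N * (\<integral>x. (f x)\<^sup>2 \<partial>L)" if f: "sq_integrable L f" for f
  proof (cases "(\<integral>x. (f x)\<^sup>2 \<partial>L) = 0")
    case True then show ?thesis using le[OF f] by simp
  next
    case False
    let ?n = "\<integral>x. (f x)\<^sup>2 \<partial>L"
    have n: "0 < ?n" using False by (simp add: less_le)
    let ?f = "\<lambda>x. (1 / sqrt ?n) * f x"
    have Tf: "T ?f u = (1 / sqrt ?n) * T f u" for u
      unfolding kernel_op_def by (simp add: mult.left_commute)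
    have "(\<integral>x. (?f x)\<^sup>2 \<partial>L) = 1" using n by (simp add: power_mult_distrib power_divide)
    moreover have "sq_integrable L ?f" by (rule sq_integrable_cmult[OF f])
    ultimately have "(\<integral>x. (T ?f x)\<^sup>2 \<partial>L) \<in> ?V" by force
    then have "(\<integral>x. (T ?f x)\<^sup>2 \<partial>L) \<le> N" unfolding N_def by (rule cSup_upper[OF _ bdd])
    moreover have "(\<integral>x. (T ?f x)\<^sup>2 \<partial>L) = (\<integral>x. (T f x)\<^sup>2 \<partial>L) / ?n"
      unfolding Tf using n by (simp add: power_mult_distrib power_divide)
    ultimately have "(\<integral>x. (T f x)\<^sup>2 \<partial>L) / ?n \<le> N" by simp
    then show ?thesis using n by (simp only: pos_divide_le_eq)
  qed
  have N: "0 < N"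
  proof (rule ccontr)
    assume "\<not> 0 < N"
    then have "N * (\<integral>x. (f0 x)\<^sup>2 \<partial>L) \<le> 0" by (simp add: mult_nonpos_nonneg)
    then have "(\<integral>x. (T f0 x)\<^sup>2 \<partial>L) \<le> 0" using op_N[OF f0] by linarith
    moreover have "0 \<le> (\<integral>x. (T f0 x)\<^sup>2 \<partial>L)" by simp
    ultimately show False using nz by linarith
  qed
  have "\<exists>f. sq_integrable L f \<and> (\<integral>x. (f x)\<^sup>2 \<partial>L) \<le> 1 \<and> N - 1 / Suc n < (\<integral>x. (T f x)\<^sup>2 \<partial>L)" for n
  proof -
    have "?V \<noteq> {}" using sq_integrable_zero[of L] by (auto intro!: exI[of _ "\<lambda>_. 0"])
    moreover have "N - 1 / Suc n < Sup ?V" unfolding N_def[symmetric] by simp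
    ultimately obtain y where "y \<in> ?V" "N - 1 / Suc n < y" using less_cSup_iff[OF _ bdd] by auto
    then show ?thesis by auto
  qed
  then obtain f where f: "\<And>n. sq_integrable L (f n)" "\<And>n. (\<integral>x. (f n x)\<^sup>2 \<partial>L) \<le> 1"
    "\<And>n. N - 1 / Suc n < (\<integral>x. (T (f n) x)\<^sup>2 \<partial>L)" by metis
  let ?F = "\<lambda>n. \<integral>x. (T (f n) x)\<^sup>2 \<partial>L"
  let ?g = "\<lambda>n. T (T (f n))"
  have F_le: "?F n \<le> N" for n
    using order_trans[OF op_N[OF f(1)] mult_left_mono[OF f(2)]] N by (simp only: mult_1_right less_imp_le)
  have F_lim: "?F \<longlonglongrightarrow> N"
  proof (rule tendsto_sandwich[of "\<lambda>n. N - 1 / Suc n" _ _ "\<lambda>_. N"])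
    have "(\<lambda>n. N - 1 / Suc n) \<longlonglongrightarrow> N - 0"
      by (intro tendsto_intros LIMSEQ_Suc[OF lim_1_over_n])
    then show "(\<lambda>n. N - 1 / Suc n) \<longlonglongrightarrow> N" by simp
  qed (use f(3) F_le in \<open>auto intro!: always_eventually less_imp_le\<close>)
  have gf: "(\<integral>x. ?g n x * f n x \<partial>L) = ?F n" for n
    using op_selfadjoint[OF sq_op[OF f(1)] f(1), of n n] by (simp add: power2_eq_square)
  have almost: "(\<integral>x. (?g n x - N * f n x)\<^sup>2 \<partial>L) \<le> N * (N - ?F n)" for n
  proof -
    have "(\<integral>x. (?g n x - N * f n x)\<^sup>2 \<partial>L) = (\<integral>x. (?g n x)\<^sup>2 \<partial>L) - 2 * N * ?F n + N\<^sup>2 * (\<integral>x. (f n x)\<^sup>2 \<partial>L)"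
      using integral_square_diff[OF sq_op[OF sq_op[OF f(1)]] f(1), of n N n] gf by simp
    also have "\<dots> \<le> N * ?F n - 2 * N * ?F n + N\<^sup>2 * 1"
      by (intro add_mono diff_mono op_N sq_op f mult_left_mono) (use N in auto)
    also have "\<dots> = N * (N - ?F n)" by (simp add: power2_eq_square algebra_simps)
    finally show ?thesis .
  qed
  have almost_lim: "(\<lambda>n. nrm (\<lambda>x. ?g n x - N * f n x)) \<longlonglongrightarrow> 0"
  proof -
    have "(\<lambda>n. N * (N - ?F n)) \<longlonglongrightarrow> N * (N - N)" by (intro tendsto_intros F_lim)
    then have "(\<lambda>n. N * (N - ?F n)) \<longlonglongrightarrow> 0" by simp
    moreover have "\<forall>\<^sub>F n in sequentially. norm (\<integral>x. (?g n x - N * f n x)\<^sup>2 \<partial>L) \<le> N * (N - ?F n)"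
      by (intro always_eventually allI) (simp add: almost)
    ultimately have "(\<lambda>n. \<integral>x. (?g n x - N * f n x)\<^sup>2 \<partial>L) \<longlonglongrightarrow> 0"
      by (rule Lim_null_comparison[rotated])
    from tendsto_real_sqrt[OF this] show ?thesis by simp
  qed
  have nTf: "nrm (T (f n)) \<le> sqrt N" for n using F_le[of n] by simp
  obtain g k where g: "continuous_on S g" and k: "strict_mono (k :: nat \<Rightarrow> nat)"
    and unif: "\<And>e. 0 < e \<Longrightarrow> \<exists>n0. \<forall>n x. n \<ge> n0 \<and> x \<in> S \<longrightarrow> norm (?g (k n) x - g x) < e"
  proof (rule Arzela_Ascoli[OF compact, of ?g "C * sqrt N"])
    show "norm (?g n x) \<le> C * sqrt N" if "x \<in> S" for n x
    proof -
      have "norm (?g n x) \<le> C * nrm (T (f n))" using C(2)[OF sq_op[OF f(1)] that] by simp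
      also have "\<dots> \<le> C * sqrt N" by (intro mult_left_mono nTf C(1))
      finally show ?thesis .
    qed
    fix x e :: real assume x: "x \<in> S" and e: "0 < e"
    obtain d where d: "0 < d" "\<And>f' u u'. \<lbrakk>sq_integrable L f'; nrm f' \<le> sqrt N; u \<in> S; u' \<in> S; \<bar>u - u'\<bar> < d\<rbrakk>
      \<Longrightarrow> \<bar>T f' u - T f' u'\<bar> < e" using op_equicontinuous[OF e] by blast
    then show "\<exists>d. 0 < d \<and> (\<forall>n y. y \<in> S \<and> norm (x - y) < d \<longrightarrow> norm (?g n x - ?g n y) < e)"
      using x nTf sq_op[OF f(1)] by (intro exI[of _ d]) auto
  qed blast
  have sg: "sq_integrable L g" by (rule continuous_on_sq_integrable[OF compact g])
  have sgn: "sq_integrable L (?g n)" for n by (intro sq_op f)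
  have conv: "L2_conv L (\<lambda>n. ?g (k n)) g"
    unfolding L2_conv_def
  proof (rule LIMSEQ_I)
    fix e :: real assume e: "0 < e"
    define q where "q = e / (measure L S + 1)"
    have q: "0 < q" using e by (simp add: q_def add_nonneg_pos)
    obtain n0 where n0: "\<And>n x. n \<ge> n0 \<Longrightarrow> x \<in> S \<Longrightarrow> \<bar>?g (k n) x - g x\<bar> < sqrt q"
      using unif[of "sqrt q"] q by auto
    have "norm ((\<integral>x. (g x - ?g (k n) x)\<^sup>2 \<partial>L) - 0) < e" if "n \<ge> n0" for n
    proof -
      have "(\<integral>x. (g x - ?g (k n) x)\<^sup>2 \<partial>L) \<le> (\<integral>x. q \<partial>L)"
      proof (rule integral_mono)
        show "(g x - ?g (k n) x)\<^sup>2 \<le> q" if "x \<in> space L" for x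
          using power_mono[OF less_imp_le[OF n0[OF \<open>n \<ge> n0\<close>, of x]], of 2] that q
          by (simp add: power2_commute)
      qed (use sq_integrable_diff[OF sg sgn] in \<open>auto simp: sq_integrable_def\<close>)
      also have "\<dots> = e / (measure L S + 1) * measure L S" by (simp add: q_def)
      also have "\<dots> < e"
      proof -
        have "e * measure L S < e * (measure L S + 1)" using e by (simp add: distrib_left)
        moreover have "0 < measure L S + 1" by (simp add: add_nonneg_pos)
        ultimately show ?thesis by (simp add: pos_divide_less_eq)
      qed
      finally show ?thesis by simp
    qed
    then show "\<exists>n0. \<forall>n\<ge>n0. norm ((\<integral>x. (g x - ?g (k n) x)\<^sup>2 \<partial>L) - 0) < e" by blast
  qed
  have T_lim: "(\<lambda>n. T (h n) u) \<longlonglongrightarrow> T h' u"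
    if h: "\<And>n. sq_integrable L (h n)" and h': "sq_integrable L h'" and c: "L2_conv L h h'" and u: "u \<in> S" for h h' u
    using L2_conv_times[OF h h' sq_K[OF u] c] by (simp add: kernel_op_def mult.commute)
  have T_conv: "L2_conv L (\<lambda>n. T (h n)) (T h')"
    if h: "\<And>n. sq_integrable L (h n)" and h': "sq_integrable L h'" and c: "L2_conv L h h'" for h h'
    unfolding L2_conv_def
  proof (rule Lim_null_comparison)
    have "(\<integral>x. (T h' x - T (h n) x)\<^sup>2 \<partial>L) = (\<integral>x. (T (\<lambda>x. h' x - h n x) x)\<^sup>2 \<partial>L)" for n
      using op_diff[OF h' h, of _ 1] by (intro Bochner_Integration.integral_cong) auto
    then show "\<forall>\<^sub>F n in sequentially. norm (\<integral>x. (T h' x - T (h n) x)\<^sup>2 \<partial>L) \<le> N * (\<integral>x. (h' x - h n x)\<^sup>2 \<partial>L)"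
      using op_N[OF sq_integrable_diff[OF h' h]] by simp
    show "(\<lambda>n. N * (\<integral>x. (h' x - h n x)\<^sup>2 \<partial>L)) \<longlonglongrightarrow> 0"
      using tendsto_mult_right_zero[OF c[unfolded L2_conv_def]] .
  qed
  have TTg: "T (T g) u = N * g u" if u: "u \<in> S" for u
  proof -
    have 1: "(\<lambda>n. T (T (?g (k n))) u) \<longlonglongrightarrow> T (T g) u"
      by (intro T_lim T_conv conv sgn sg sq_op u)
    have sd: "sq_integrable L (\<lambda>x. ?g n x - N * f n x)" for n
      by (intro sq_integrable_diff sgn sq_integrable_cmult f)
    have "(\<lambda>n. T (T (\<lambda>x. ?g n x - N * f n x)) u) \<longlonglongrightarrow> 0"
    proof (rule Lim_null_comparison)
      show "\<forall>\<^sub>F n in sequentially. norm (T (T (\<lambda>x. ?g n x - N * f n x)) u)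
          \<le> C * (sqrt N * nrm (\<lambda>x. ?g n x - N * f n x))"
      proof (intro always_eventually allI)
        fix n
        have "\<bar>T (T (\<lambda>x. ?g n x - N * f n x)) u\<bar> \<le> C * nrm (T (\<lambda>x. ?g n x - N * f n x))"
          by (intro C(2) sq_op sd u)
        also have "nrm (T (\<lambda>x. ?g n x - N * f n x)) \<le> sqrt (N * (\<integral>x. (?g n x - N * f n x)\<^sup>2 \<partial>L))"
          by (intro real_sqrt_le_mono op_N sd)
        finally show "norm (T (T (\<lambda>x. ?g n x - N * f n x)) u) \<le> C * (sqrt N * nrm (\<lambda>x. ?g n x - N * f n x))"
          using C(1) by (simp add: real_sqrt_mult mult_left_mono)
      qed
      have "(\<lambda>n. C * (sqrt N * nrm (\<lambda>x. ?g n x - N * f n x))) \<longlonglongrightarrow> C * (sqrt N * 0)"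
        by (intro tendsto_intros almost_lim)
      then show "(\<lambda>n. C * (sqrt N * nrm (\<lambda>x. ?g n x - N * f n x))) \<longlonglongrightarrow> 0" by simp
    qed
    moreover have "T (T (\<lambda>x. ?g n x - N * f n x)) u = T (T (?g n)) u - N * ?g n u" for n
    proof -
      have "T (T (\<lambda>x. ?g n x - N * f n x)) u = T (\<lambda>x. T (?g n) x - N * T (f n) x) u"
        by (rule op_cong) (rule op_diff[OF sgn f(1)])
      also have "\<dots> = T (T (?g n)) u - N * ?g n u" by (intro op_diff sq_op sgn f u)
      finally show ?thesis .
    qed
    ultimately have "(\<lambda>n. T (T (?g n)) u - N * ?g n u) \<longlonglongrightarrow> 0" by simp
    from LIMSEQ_subseq_LIMSEQ[OF this k]
    have 2: "(\<lambda>n. T (T (?g (k n))) u - N * ?g (k n) u) \<longlonglongrightarrow> 0" by (simp add: comp_def)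
    have "(\<lambda>n. ?g (k n) u) \<longlonglongrightarrow> g u"
      using unif u by (intro LIMSEQ_I) blast
    then have "(\<lambda>n. T (T (?g (k n))) u - N * ?g (k n) u) \<longlonglongrightarrow> T (T g) u - N * g u"
      by (intro tendsto_intros 1)
    from LIMSEQ_unique[OF 2 this] show ?thesis by simp
  qed
  \<comment> \<open>The inner product of \<open>T (T (f n))\<close> with \<open>f n\<close> is \<open>?F n\<close> and stays away from 0.\<close>
  have g_nz: "0 < (\<integral>x. (g x)\<^sup>2 \<partial>L)"
  proof -
    have "(?F n)\<^sup>2 \<le> (\<integral>x. (?g n x)\<^sup>2 \<partial>L)" for n
    proof -
      have "(?F n)\<^sup>2 \<le> (\<integral>x. (?g n x)\<^sup>2 \<partial>L) * (\<integral>x. (f n x)\<^sup>2 \<partial>L)"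
        unfolding gf[symmetric] by (rule integral_Cauchy_Schwarz[OF sgn f(1)])
      also have "\<dots> \<le> (\<integral>x. (?g n x)\<^sup>2 \<partial>L) * 1" by (intro mult_left_mono f(2)) simp
      finally show ?thesis by simp
    qed
    moreover have "(\<lambda>n. (?F (k n))\<^sup>2) \<longlonglongrightarrow> N\<^sup>2"
      using LIMSEQ_subseq_LIMSEQ[OF F_lim k] by (intro tendsto_intros) (simp add: comp_def)
    ultimately have "N\<^sup>2 \<le> (\<integral>x. (g x)\<^sup>2 \<partial>L)"
      by (intro LIMSEQ_le[OF _ L2_conv_square[OF sgn sg conv]]) auto
    then show ?thesis using N by (smt (verit) zero_less_power)
  qed
  let ?m = "sqrt N"
  let ?h = "\<lambda>x. T g x - (- ?m) * g x"
  have sh: "sq_integrable L ?h" by (intro sq_integrable_diff sq_op sg sq_integrable_cmult)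
  show thesis
  proof (cases "AE u in L. ?h u = 0")
    case True
    then have "AE u in L. T g u = (- ?m) * g u" by eventually_elim simp
    moreover have "\<not> (AE u in L. g u = 0)"
    proof
      assume "AE u in L. g u = 0"
      then have "(\<integral>x. (g x)\<^sup>2 \<partial>L) = 0" by (intro integral_eq_zero_AE) auto
      then show False using g_nz by simp
    qed
    ultimately show thesis using that[of "- ?m" g] sg N by simp
  next
    case False
    have "T ?h u = ?m * ?h u" if u: "u \<in> S" for u
    proof -
      have "T ?h u = T (T g) u - (- ?m) * T g u" by (intro op_diff sq_op sg u)
      also have "\<dots> = ?m * ?m * g u + ?m * T g u" using TTg[OF u] N by simp
      also have "\<dots> = ?m * ?h u" by (simp add: algebra_simps)
      finally show ?thesis .
    qed
    then have "AE u in L. T ?h u = ?m * ?h u" by (intro AE_I2) simp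
    then show thesis using that[of ?m ?h] sh N False by simp
  qed
qed

end

section \<open>Orthogonal systems\<close>

text \<open>Not normalised: \<open>l k\<close> is the mean square of \<open>\<xi> k\<close>. The scores of a process form such a
  system, and the eigenvalues are their variances.\<close>

locale orthogonal_system =
  fixes M :: "'a measure" and \<xi> :: "nat \<Rightarrow> 'a \<Rightarrow> real" and l :: "nat \<Rightarrow> real"
  assumes pos: "\<And>k. 0 < l k" and sq: "\<And>k. sq_integrable M (\<xi> k)"
    and orth: "\<And>j k. (\<integral>x. \<xi> j x * \<xi> k x \<partial>M) = (if j = k then l k else 0)"
begin

definition coef :: "('a \<Rightarrow> real) \<Rightarrow> nat \<Rightarrow> real" where
  "coef W k = (\<integral>x. W x * \<xi> k x \<partial>M) / l k"

definition proj :: "('a \<Rightarrow> real) \<Rightarrow> nat \<Rightarrow> 'a \<Rightarrow> real" where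
  "proj W n x = (\<Sum>k<n. \<xi> k x * coef W k)"

definition resid :: "('a \<Rightarrow> real) \<Rightarrow> nat \<Rightarrow> 'a \<Rightarrow> real" where
  "resid W n x = W x - proj W n x"

lemma sq_combination: "sq_integrable M (\<lambda>x. \<Sum>k\<in>I. \<xi> k x * c k)"
  using sq_integrable_cmult[OF sq] by (intro sq_integrable_sum) (simp add: mult.commute)

lemma sq_proj: "sq_integrable M (proj W n)"
  using sq_combination[where I="{..<n}" and c="coef W"] by (simp add: proj_def[abs_def])

lemma sq_resid: "sq_integrable M W \<Longrightarrow> sq_integrable M (resid W n)"
  unfolding resid_def[abs_def] by (intro sq_integrable_diff sq_proj)

lemma inner_combination:
  assumes W: "sq_integrable M W" and I: "finite I"
  shows "(\<integral>x. W x * (\<Sum>k\<in>I. \<xi> k x * c k) \<partial>M) = (\<Sum>k\<in>I. c k * (\<integral>x. W x * \<xi> k x \<partial>M))"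
proof -
  have "(\<integral>x. W x * (\<Sum>k\<in>I. \<xi> k x * c k) \<partial>M) = (\<integral>x. (\<Sum>k\<in>I. c k * (W x * \<xi> k x)) \<partial>M)"
    by (simp add: sum_distrib_left mult_ac)
  then show ?thesis using sq_integrable_times[OF W sq] by simp
qed

lemma inner_eq_coef: "(\<integral>x. W x * \<xi> k x \<partial>M) = l k * coef W k"
  using pos[of k] by (simp add: coef_def)

lemma combination_square:
  assumes I: "finite I"
  shows "(\<integral>x. (\<Sum>k\<in>I. \<xi> k x * c k)\<^sup>2 \<partial>M) = (\<Sum>k\<in>I. l k * (c k)\<^sup>2)"
proof -
  have *: "(\<integral>x. (\<Sum>j\<in>I. \<xi> j x * c j) * \<xi> k x \<partial>M) = l k * c k" if "k \<in> I" for k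
    using inner_combination[OF sq I, where c=c] that I
    by (simp add: orth mult.commute if_distrib[of "\<lambda>x. _ * x"] sum.delta cong: if_cong)
  have "(\<integral>x. (\<Sum>k\<in>I. \<xi> k x * c k)\<^sup>2 \<partial>M) = (\<Sum>k\<in>I. c k * (\<integral>x. (\<Sum>j\<in>I. \<xi> j x * c j) * \<xi> k x \<partial>M))"
    unfolding power2_eq_square by (rule inner_combination[OF sq_combination I])
  also have "\<dots> = (\<Sum>k\<in>I. c k * (l k * c k))"
    by (intro sum.cong refl arg_cong2[where f="(*)"] *)
  finally show ?thesis by (simp add: power2_eq_square mult_ac)
qed

lemma inner_proj:
  assumes W: "sq_integrable M W"
  shows "(\<integral>x. W x * proj V n x \<partial>M) = (\<Sum>k<n. l k * coef W k * coef V k)"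
  using inner_combination[OF W, where I="{..<n}" and c="coef V"]
  by (simp add: proj_def inner_eq_coef mult_ac)

lemma coef_proj: "coef (proj W n) k = (if k < n then coef W k else 0)"
proof -
  have "(\<integral>x. \<xi> k x * proj W n x \<partial>M) = (\<Sum>j<n. coef W j * (\<integral>x. \<xi> k x * \<xi> j x \<partial>M))"
    using inner_combination[OF sq, where I="{..<n}" and c="coef W"] by (simp add: proj_def)
  also have "\<dots> = (\<Sum>j<n. if k = j then coef W j * l j else 0)"
    by (intro sum.cong) (auto simp: orth)
  also have "\<dots> = (if k < n then l k * coef W k else 0)" by (simp add: sum.delta)
  finally show ?thesis using pos[of k] by (simp add: coef_def[of "proj W n"] mult.commute)
qed

lemma inner_resid:
  assumes U: "sq_integrable M U" and V: "sq_integrable M V"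
  shows "(\<integral>x. resid U n x * resid V n x \<partial>M) = (\<integral>x. U x * V x \<partial>M) - (\<Sum>k<n. l k * coef U k * coef V k)"
proof -
  have i: "integrable M (\<lambda>x. A x * B x)" if "sq_integrable M A" "sq_integrable M B" for A B
    using that by (rule sq_integrable_times)
  have "(\<integral>x. resid U n x * resid V n x \<partial>M)
     = (\<integral>x. (U x * V x - U x * proj V n x) - (V x * proj U n x - proj U n x * proj V n x) \<partial>M)"
    by (simp add: resid_def algebra_simps)
  also have "\<dots> = ((\<integral>x. U x * V x \<partial>M) - (\<integral>x. U x * proj V n x \<partial>M))
      - ((\<integral>x. V x * proj U n x \<partial>M) - (\<integral>x. proj U n x * proj V n x \<partial>M))"
    using U V sq_proj by (simp add: i)
  also have "(\<integral>x. proj U n x * proj V n x \<partial>M) = (\<Sum>k<n. l k * coef U k * coef V k)"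
    by (simp add: inner_proj[OF sq_proj] coef_proj)
  also have "(\<integral>x. V x * proj U n x \<partial>M) = (\<Sum>k<n. l k * coef U k * coef V k)"
    by (simp add: inner_proj[OF V] mult_ac)
  finally show ?thesis by (simp add: inner_proj[OF U])
qed

lemma resid_square:
  assumes W: "sq_integrable M W"
  shows "(\<integral>x. (resid W n x)\<^sup>2 \<partial>M) = (\<integral>x. (W x)\<^sup>2 \<partial>M) - (\<Sum>k<n. l k * (coef W k)\<^sup>2)"
  using inner_resid[OF W W, of n] by (simp add: power2_eq_square mult.assoc)

lemma Bessel:
  assumes W: "sq_integrable M W"
  shows "(\<Sum>k<n. l k * (coef W k)\<^sup>2) \<le> (\<integral>x. (W x)\<^sup>2 \<partial>M)"
proof -
  have "0 \<le> (\<integral>x. (resid W n x)\<^sup>2 \<partial>M)" by simp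
  then show ?thesis unfolding resid_square[OF W] by simp
qed

lemma Bessel_summable:
  assumes W: "sq_integrable M W"
  shows "summable (\<lambda>k. l k * (coef W k)\<^sup>2)"
proof (rule summableI_nonneg_bounded)
  show "0 \<le> l k * (coef W k)\<^sup>2" for k using pos[of k] by simp
  show "(\<Sum>k<n. l k * (coef W k)\<^sup>2) \<le> (\<integral>x. (W x)\<^sup>2 \<partial>M)" for n by (rule Bessel[OF W])
qed

lemma coef_diff:
  assumes U: "sq_integrable M U" and V: "sq_integrable M V"
  shows "coef (\<lambda>x. U x - V x) k = coef U k - coef V k"
  unfolding coef_def left_diff_distrib
  using sq_integrable_times[OF U sq] sq_integrable_times[OF V sq] by (simp add: diff_divide_distrib)

lemma resid_diff:
  assumes U: "sq_integrable M U" and V: "sq_integrable M V"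
  shows "resid (\<lambda>x. U x - V x) n x = resid U n x - resid V n x"
  by (simp add: resid_def proj_def coef_diff[OF U V] right_diff_distrib sum_subtractf)

lemma proj_diff_square:
  assumes "n \<le> m"
  shows "(\<integral>x. (proj W m x - proj W n x)\<^sup>2 \<partial>M) = (\<Sum>k\<in>{n..<m}. l k * (coef W k)\<^sup>2)"
proof -
  have "proj W m x - proj W n x = (\<Sum>k\<in>{n..<m}. \<xi> k x * coef W k)" for x
    unfolding proj_def using sum_diff_nat_ivl[of 0 n m "\<lambda>k. \<xi> k x * coef W k"] assms
    by (simp add: lessThan_atLeast0)
  then show ?thesis by (simp add: combination_square)
qed

lemma orthogonal_to_limit:
  assumes Z: "sq_integrable M Z" and o: "\<And>k. (\<integral>x. Z x * \<xi> k x \<partial>M) = 0"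
    and R: "sq_integrable M R" and c: "L2_conv M (\<lambda>n x. \<Sum>k<n. \<xi> k x * c k) R"
  shows "(\<integral>x. R x * Z x \<partial>M) = 0"
proof -
  have "(\<integral>x. (\<Sum>k<n. \<xi> k x * c k) * Z x \<partial>M) = 0" for n
    using inner_combination[OF Z, where I="{..<n}" and c=c] o by (simp add: mult.commute)
  then show ?thesis
    using L2_conv_times[OF sq_combination R Z c] LIMSEQ_unique[OF tendsto_const] by force
qed

lemma limit_orthogonal:
  assumes W: "sq_integrable M W" and R: "sq_integrable M R" and c: "L2_conv M (proj W) R"
  shows "(\<integral>x. (W x - R x) * \<xi> k x \<partial>M) = 0"
proof -
  have "(\<lambda>n. \<integral>x. proj W n x * \<xi> k x \<partial>M) \<longlonglongrightarrow> (\<integral>x. R x * \<xi> k x \<partial>M)"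
    by (rule L2_conv_times[OF sq_proj R sq c])
  moreover have "(\<lambda>n. \<integral>x. proj W n x * \<xi> k x \<partial>M) \<longlonglongrightarrow> (\<integral>x. W x * \<xi> k x \<partial>M)"
    by (rule tendsto_eventually, rule eventually_sequentiallyI[of "Suc k"])
       (simp add: inner_eq_coef coef_proj)
  ultimately have "(\<integral>x. R x * \<xi> k x \<partial>M) = (\<integral>x. W x * \<xi> k x \<partial>M)" by (rule LIMSEQ_unique)
  then show ?thesis
    using sq_integrable_times[OF W sq] sq_integrable_times[OF R sq] by (simp add: left_diff_distrib)
qed

lemma limit_resid_square:
  assumes W: "sq_integrable M W" and R: "sq_integrable M R" and c: "L2_conv M (proj W) R"
  shows "(\<integral>x. (W x - R x)\<^sup>2 \<partial>M) = (\<integral>x. (W x)\<^sup>2 \<partial>M) - (\<Sum>k. l k * (coef W k)\<^sup>2)"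
proof -
  have "L2_conv M (resid W) (\<lambda>x. W x - R x)"
    using c unfolding L2_conv_def resid_def by (simp add: power2_commute)
  then have "(\<lambda>n. \<integral>x. (resid W n x)\<^sup>2 \<partial>M) \<longlonglongrightarrow> (\<integral>x. (W x - R x)\<^sup>2 \<partial>M)"
    by (intro L2_conv_square sq_resid sq_integrable_diff W R)
  moreover have "(\<lambda>n. \<integral>x. (resid W n x)\<^sup>2 \<partial>M) \<longlonglongrightarrow> (\<integral>x. (W x)\<^sup>2 \<partial>M) - (\<Sum>k. l k * (coef W k)\<^sup>2)"
    unfolding resid_square[OF W] by (intro tendsto_intros summable_LIMSEQ Bessel_summable[OF W])
  ultimately show ?thesis by (rule LIMSEQ_unique)
qed

end

section \<open>Continuous random functions\<close>

text \<open>Rounding without leaving \<open>S\<close>: a point of \<open>S\<close> is replaced by a chosen point of \<open>S\<close> in the same cell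
  of the grid of width \<open>1 / (n + 1)\<close>. The result depends on the cell only, so it has finitely many
  values on a bounded set, and it is measurable whatever the choice was.\<close>

definition round_in :: "real set \<Rightarrow> nat \<Rightarrow> int \<Rightarrow> real" where
  "round_in S n i = (SOME t. t \<in> S \<and> \<lfloor>real (Suc n) * t\<rfloor> = i)"

abbreviation round_to :: "real set \<Rightarrow> nat \<Rightarrow> real \<Rightarrow> real" where
  "round_to S n v \<equiv> round_in S n \<lfloor>real (Suc n) * v\<rfloor>"

lemma round_to:
  assumes "v \<in> S"
  shows "round_to S n v \<in> S" "\<bar>round_to S n v - v\<bar> \<le> 1 / Suc n"
proof -
  let ?t = "round_to S n v"
  have t: "?t \<in> S \<and> \<lfloor>real (Suc n) * ?t\<rfloor> = \<lfloor>real (Suc n) * v\<rfloor>"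
    unfolding round_in_def by (rule someI[of _ v]) (use assms in simp)
  then show "?t \<in> S" by simp
  have "\<bar>real (Suc n) * ?t - real (Suc n) * v\<bar> \<le> 1" using t by linarith
  then have "real (Suc n) * \<bar>?t - v\<bar> \<le> 1"
    by (simp add: abs_mult right_diff_distrib[symmetric] del: of_nat_Suc)
  then show "\<bar>?t - v\<bar> \<le> 1 / Suc n" by (simp add: field_simps)
qed

lemma round_to_tendsto:
  assumes "v \<in> S" shows "(\<lambda>n. round_to S n v) \<longlonglongrightarrow> v"
proof (rule LIM_zero_cancel, rule Lim_null_comparison)
  show "\<forall>\<^sub>F n in sequentially. norm (round_to S n v - v) \<le> 1 / Suc n"
    using round_to(2)[OF assms] by simp
  show "(\<lambda>n. 1 / Suc n) \<longlonglongrightarrow> (0::real)" using LIMSEQ_Suc[OF lim_1_over_n] .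
qed

lemma finite_floor_image:
  fixes S :: "real set"
  assumes "bounded S" shows "finite ((\<lambda>v. \<lfloor>real (Suc n) * v\<rfloor>) ` S)"
proof -
  obtain B where B: "\<And>v. v \<in> S \<Longrightarrow> \<bar>v\<bar> \<le> B" using assms by (auto simp: bounded_iff)
  have "(\<lambda>v. \<lfloor>real (Suc n) * v\<rfloor>) ` S \<subseteq> {\<lfloor>real (Suc n) * - B\<rfloor>..\<lfloor>real (Suc n) * B\<rfloor>}"
  proof (rule image_subsetI)
    fix v assume "v \<in> S"
    then have "- B \<le> v" "v \<le> B" using B[of v] by auto
    then show "\<lfloor>real (Suc n) * v\<rfloor> \<in> {\<lfloor>real (Suc n) * - B\<rfloor>..\<lfloor>real (Suc n) * B\<rfloor>}"
      unfolding atLeastAtMost_iff by (intro conjI floor_mono mult_left_mono) auto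
  qed
  then show ?thesis by (rule finite_subset) simp
qed

lemma finite_measure_lebesgue_on_interval:
  assumes "T \<in> sets lebesgue" "T \<subseteq> {a..b::real}"
  shows "finite_measure (lebesgue_on T)"
proof
  have "emeasure lebesgue T \<le> emeasure lebesgue {a..b}" by (rule emeasure_mono) (use assms in auto)
  also have "\<dots> < \<infinity>" by (cases "a \<le> b") simp_all
  finally show "emeasure (lebesgue_on T) (space (lebesgue_on T)) \<noteq> \<infinity>"
    using assms by (simp add: emeasure_restrict_space del: emeasure_completion)
qed

text \<open>A path is the limit of its values at rounded arguments, and these involve only countably many of
  the random variables \<open>X t\<close>. The value 0 stands in for cells that do not meet the interval.\<close>

lemma continuous_random_function_measurable_pair:
  assumes X: "continuous_random_function P a b X" and T: "T \<subseteq> {a..b}"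
  shows "(\<lambda>(\<omega>, u). X \<omega> u) \<in> borel_measurable (P \<Otimes>\<^sub>M lebesgue_on T)"
proof (rule borel_measurable_LIMSEQ_metric)
  let ?S = "{a..b}"
  define Y where "Y n i \<omega> = (if round_in ?S n i \<in> ?S then X \<omega> (round_in ?S n i) else 0)" for n i \<omega>
  have [measurable]: "Y n i \<in> borel_measurable P" for n i
    using X by (cases "round_in ?S n i \<in> ?S") (auto simp: Y_def[abs_def] continuous_random_function_def)
  have [measurable]: "(\<lambda>u. u) \<in> lebesgue_on T \<rightarrow>\<^sub>M borel"
    by (intro measurable_restrict_space1 measurable_completion) simp
  show "(\<lambda>(\<omega>, u). Y n \<lfloor>real (Suc n) * u\<rfloor> \<omega>) \<in> borel_measurable (P \<Otimes>\<^sub>M lebesgue_on T)" for n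
    unfolding case_prod_unfold
    by (rule measurable_compose_countable[where f="\<lambda>i p. Y n i (fst p)"]) measurable
  fix p assume p: "p \<in> space (P \<Otimes>\<^sub>M lebesgue_on T)"
  obtain \<omega> u where pu: "p = (\<omega>, u)" by force
  with p T have \<omega>: "\<omega> \<in> space P" and u: "u \<in> ?S" by (auto simp: space_pair_measure)
  have "continuous_on ?S (X \<omega>)" using X \<omega> by (auto simp: continuous_random_function_def)
  then have "(\<lambda>n. X \<omega> (round_to ?S n u)) \<longlonglongrightarrow> X \<omega> u"
    by (rule continuous_on_tendsto_compose[OF _ round_to_tendsto[OF u] u]) (use round_to(1)[OF u] in simp)
  moreover have "Y n \<lfloor>real (Suc n) * u\<rfloor> \<omega> = X \<omega> (round_to ?S n u)" for n
    using round_to(1)[OF u] by (simp add: Y_def)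
  ultimately show "(\<lambda>n. case p of (\<omega>, u) \<Rightarrow> Y n \<lfloor>real (Suc n) * u\<rfloor> \<omega>) \<longlonglongrightarrow> (case p of (\<omega>, u) \<Rightarrow> X \<omega> u)"
    by (simp add: pu)
qed

section \<open>Processes with an observed part\<close>

text \<open>A continuous function that does not vanish at a point of \<open>S\<close> does not vanish on a whole interval
  inside \<open>S\<close>, and intervals have positive measure.\<close>

lemma AE_lebesgue_on_zero_imp_zero:
  fixes h :: "real \<Rightarrow> real"
  assumes S: "compact S" and support: "\<And>u e. u \<in> S \<Longrightarrow> 0 < e \<Longrightarrow> \<exists>c d. c < d \<and> {c..d} \<subseteq> S \<inter> ball u e"
    and h: "continuous_on S h" and z: "AE v in lebesgue_on S. h v = 0" and u: "u \<in> S"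
  shows "h u = 0"
proof (rule ccontr)
  assume nz: "h u \<noteq> 0"
  have Sm: "S \<in> sets lebesgue" using S by (simp add: lmeasurable_compact fmeasurableD)
  obtain e where e: "0 < e" "\<And>v. v \<in> S \<Longrightarrow> dist v u < e \<Longrightarrow> dist (h v) (h u) < \<bar>h u\<bar>"
    using h u nz unfolding continuous_on_iff by (metis zero_less_abs_iff)
  obtain c d where cd: "c < d" "{c..d} \<subseteq> S \<inter> ball u e" using support[OF u e(1)] by blast
  have "AE v in lebesgue. v \<in> S \<longrightarrow> h v = 0"
    using z Sm by (simp add: AE_restrict_space_iff)
  then have "AE v in lebesgue. v \<notin> {c..d}"
  proof (rule AE_mp, intro AE_I2 impI)
    fix v assume v: "v \<in> S \<longrightarrow> h v = 0"
    show "v \<notin> {c..d}"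
    proof
      assume "v \<in> {c..d}"
      then have "v \<in> S" "dist v u < e" using cd by (auto simp: dist_commute)
      then show False using e(2)[of v] v by (simp add: dist_real_def)
    qed
  qed
  then have "{c..d} \<in> null_sets lebesgue" by (subst (asm) AE_iff_null_sets[symmetric]) auto
  then have "emeasure lborel {c..d} = 0" by (simp add: null_sets_def)
  then show False using cd(1) by simp
qed

text \<open>The set \<open>S\<close> is the observed part. Its last property says that Lebesgue measure has full support
  on \<open>S\<close>: it transfers identities between continuous functions from almost every point, where the
  eigenvalue equations hold, to every point.\<close>

locale observed_process = prob_space P
  for P :: "'w measure" +
  fixes a b :: real and X :: "'w \<Rightarrow> real \<Rightarrow> real" and S :: "real set"
    and \<phi> :: "nat \<Rightarrow> real \<Rightarrow> real" and l :: "nat \<Rightarrow> real"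
  assumes process: "centered_process P a b X"
    and S_compact: "compact S" and S_subset: "S \<subseteq> {a..b}"
    and S_support: "\<And>u e. u \<in> S \<Longrightarrow> 0 < e \<Longrightarrow> \<exists>c d. c < d \<and> {c..d} \<subseteq> S \<inter> ball u e"
    and eigen: "eigen_system P X S \<phi> l"
begin

abbreviation "LS \<equiv> lebesgue_on S"
abbreviation "\<gamma> \<equiv> cov P X"

lemma X_continuous: "\<omega> \<in> space P \<Longrightarrow> continuous_on {a..b} (X \<omega>)"
  using process by (auto simp: centered_process_def continuous_random_function_def)

lemma sq_X: "t \<in> {a..b} \<Longrightarrow> sq_integrable P (\<lambda>\<omega>. X \<omega> t)"
  using process by (auto simp: centered_process_def continuous_random_function_def sq_integrable_def)

lemma mean_X: "t \<in> {a..b} \<Longrightarrow> (\<integral>\<omega>. X \<omega> t \<partial>P) = 0"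
  using process by (auto simp: centered_process_def)

lemma cov_continuous: "continuous_on ({a..b} \<times> {a..b}) (\<lambda>(u, v). \<gamma> u v)"
  using process by (simp add: centered_process_def)

lemma cov_commute: "\<gamma> u v = \<gamma> v u"
  by (simp add: cov_def mult.commute)

lemma cov_diag: "\<gamma> u u = (\<integral>\<omega>. (X \<omega> u)\<^sup>2 \<partial>P)"
  by (simp add: cov_def power2_eq_square)

lemma cov_diag_bound: obtains B where "0 \<le> B" "\<And>u. u \<in> {a..b} \<Longrightarrow> \<gamma> u u \<le> B"
proof -
  have "continuous_on {a..b} (\<lambda>u. (\<lambda>(u, v). \<gamma> u v) (u, u))"
    by (rule continuous_on_compose2[OF cov_continuous]) (auto intro!: continuous_intros)
  then have "bounded ((\<lambda>u. \<gamma> u u) ` {a..b})"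
    by (intro compact_imp_bounded compact_continuous_image) auto
  then obtain B where B: "\<forall>x\<in>(\<lambda>u. \<gamma> u u) ` {a..b}. norm x \<le> B" unfolding bounded_iff by blast
  have "\<gamma> u u \<le> max B 0" if "u \<in> {a..b}" for u
    using bspec[OF B imageI[OF that]] by simp
  then show thesis using that[of "max B 0"] by simp
qed

lemma const_sq: "sq_integrable P (\<lambda>_. c)"
  by (simp add: sq_integrable_def)

lemma S_sets: "S \<in> sets lebesgue"
  using S_compact by (simp add: lmeasurable_compact fmeasurableD)

lemma finite_LS: "finite_measure LS"
  by (rule compact_finite_measure_lebesgue_on[OF S_compact])

lemma kernel_cov: "continuous_kernel S \<gamma>"
proof
  show "continuous_on (S \<times> S) (\<lambda>(u, v). \<gamma> u v)"
    using S_subset by (intro continuous_on_subset[OF cov_continuous]) auto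
qed (auto simp: S_compact intro: cov_commute)

lemma sigma_finite_lebesgue_on:
  assumes "T \<in> sets lebesgue" "T \<subseteq> {a..b}" shows "sigma_finite_measure (lebesgue_on T)"
  using finite_measure_lebesgue_on_interval[OF assms] by (rule finite_measure.axioms)

lemma X_pair_measurable: "T \<subseteq> {a..b} \<Longrightarrow> (\<lambda>(\<omega>, u). X \<omega> u) \<in> borel_measurable (P \<Otimes>\<^sub>M lebesgue_on T)"
  using process by (intro continuous_random_function_measurable_pair[of P a b]) (auto simp: centered_process_def)

lemma sq_X_pair:
  assumes T: "T \<in> sets lebesgue" "T \<subseteq> {a..b}"
  shows "sq_integrable (P \<Otimes>\<^sub>M lebesgue_on T) (\<lambda>(\<omega>, u). X \<omega> u)"
proof (rule sq_integrable_pair)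
  interpret T: finite_measure "lebesgue_on T" by (rule finite_measure_lebesgue_on_interval[OF T])
  obtain B where B: "0 \<le> B" "\<And>u. u \<in> {a..b} \<Longrightarrow> \<gamma> u u \<le> B" using cov_diag_bound by blast
  have "(\<integral>\<^sup>+u. \<integral>\<^sup>+\<omega>. ennreal ((X \<omega> u)\<^sup>2) \<partial>P \<partial>lebesgue_on T) \<le> (\<integral>\<^sup>+u. ennreal B \<partial>lebesgue_on T)"
  proof (rule nn_integral_mono)
    fix u assume "u \<in> space (lebesgue_on T)"
    then have u: "u \<in> {a..b}" using T by auto
    have "(\<integral>\<^sup>+\<omega>. ennreal ((X \<omega> u)\<^sup>2) \<partial>P) = ennreal (\<gamma> u u)"
      unfolding cov_diag using sq_X[OF u] by (intro nn_integral_eq_integral) (auto simp: sq_integrable_def)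
    then show "(\<integral>\<^sup>+\<omega>. ennreal ((X \<omega> u)\<^sup>2) \<partial>P) \<le> ennreal B" using B(2)[OF u] by (simp add: ennreal_leI)
  qed
  also have "\<dots> < \<infinity>"
    by (simp add: ennreal_mult_less_top less_top T.emeasure_eq_measure del: emeasure_completion)
  finally show "(\<integral>\<^sup>+u. \<integral>\<^sup>+\<omega>. ennreal ((X \<omega> u)\<^sup>2) \<partial>P \<partial>lebesgue_on T) < \<infinity>" .
qed (use sigma_finite_lebesgue_on[OF T] X_pair_measurable[OF T(2)] in \<open>auto intro: sigma_finite_measure_axioms\<close>)

lemma sq_X_path: "\<omega> \<in> space P \<Longrightarrow> sq_integrable LS (X \<omega>)"
  by (intro continuous_on_sq_integrable S_compact continuous_on_subset[OF X_continuous S_subset])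

lemma mean_square_X_path: "integrable P (\<lambda>\<omega>. \<integral>u. (X \<omega> u)\<^sup>2 \<partial>LS)"
proof -
  interpret pair_sigma_finite P LS
    using sigma_finite_lebesgue_on[OF S_sets S_subset] sigma_finite_measure_axioms by (simp add: pair_sigma_finite_def)
  show ?thesis
    using integrable_fst'[OF sq_integrable_square[OF sq_X_pair[OF S_sets S_subset]]] by simp
qed

section \<open>Scores\<close>

lemma sq_linear_functional:
  assumes f: "sq_integrable LS f"
  shows "sq_integrable P (\<lambda>\<omega>. l2_inner S (X \<omega>) f)"
proof -
  interpret S: sigma_finite_measure LS by (rule sigma_finite_lebesgue_on[OF S_sets S_subset])
  have [measurable]: "(\<lambda>(\<omega>, u). X \<omega> u) \<in> borel_measurable (P \<Otimes>\<^sub>M LS)" by (rule X_pair_measurable[OF S_subset])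
  have [measurable]: "f \<in> borel_measurable LS" using f by measurable
  have m [measurable]: "(\<lambda>\<omega>. l2_inner S (X \<omega>) f) \<in> borel_measurable P"
    unfolding l2_inner_def by measurable
  have "integrable P (\<lambda>\<omega>. (l2_inner S (X \<omega>) f)\<^sup>2)"
  proof (rule Bochner_Integration.integrable_bound)
    show "integrable P (\<lambda>\<omega>. (\<integral>u. (X \<omega> u)\<^sup>2 \<partial>LS) * (\<integral>u. (f u)\<^sup>2 \<partial>LS))"
      using mean_square_X_path by simp
    show "AE \<omega> in P. norm ((l2_inner S (X \<omega>) f)\<^sup>2) \<le> norm ((\<integral>u. (X \<omega> u)\<^sup>2 \<partial>LS) * (\<integral>u. (f u)\<^sup>2 \<partial>LS))"
      using integral_Cauchy_Schwarz[OF sq_X_path f] by (intro AE_I2) (simp add: l2_inner_def abs_mult)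
  qed measurable
  then show ?thesis using m by (simp add: sq_integrable_def)
qed

text \<open>The expectation passes under the integral over the observed part. All moments of the scores
  come from this with different choices of \<open>W\<close>.\<close>

lemma expectation_linear_functional:
  assumes W: "sq_integrable P W" and f: "sq_integrable LS f"
  shows "(\<integral>\<omega>. W \<omega> * l2_inner S (X \<omega>) f \<partial>P) = (\<integral>v. (\<integral>\<omega>. X \<omega> v * W \<omega> \<partial>P) * f v \<partial>LS)"
  unfolding l2_inner_def
  by (intro sq_integrable_swap sigma_finite_lebesgue_on sq_X_pair S_sets S_subset W f sigma_finite_measure_axioms)

lemma l_pos: "0 < l k" using eigen by (simp add: eigen_system_def)

lemma sq_phi: "sq_integrable LS (\<phi> k)"
  using eigen by (auto simp: eigen_system_def L2_iff_sq_integrable)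

lemma orth_phi: "l2_inner S (\<phi> j) (\<phi> k) = (if j = k then 1 else 0)"
  using eigen by (simp add: eigen_system_def)

lemma eigen_complete:
  assumes f: "sq_integrable LS f" and \<mu>: "\<mu> \<noteq> 0" and nz: "\<not> (AE u in LS. f u = 0)"
    and e: "AE u in LS. cov_operator P X S f u = \<mu> * f u"
  shows "\<exists>k c. AE u in LS. f u = c * \<phi> k u"
proof -
  have "\<forall>f\<in>L2 S. \<forall>\<mu>. \<mu> \<noteq> 0 \<longrightarrow> \<not> (AE u in LS. f u = 0) \<longrightarrow>
      (AE u in LS. cov_operator P X S f u = \<mu> * f u) \<longrightarrow>
      (\<exists>k c. \<mu> = l k \<and> (AE u in LS. f u = c * \<phi> k u))"
    using eigen unfolding eigen_system_def by (elim conjE)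
  moreover have "f \<in> L2 S" using f by (simp add: L2_iff_sq_integrable)
  ultimately show ?thesis using \<mu> nz e by blast
qed

abbreviation "\<xi> \<equiv> score X S \<phi>"
abbreviation "\<psi> \<equiv> phi_tilde P X S \<phi> l"

lemma sq_score: "sq_integrable P (\<xi> k)"
  unfolding score_def[abs_def] by (rule sq_linear_functional[OF sq_phi])

lemma psi_eq_kernel_op: "l k * \<psi> k u = kernel_op S \<gamma> (\<phi> k) u"
  using l_pos[of k] by (simp add: phi_tilde_def kernel_op_def l2_inner_def mult.commute)

lemma expectation_X_linear_functional:
  assumes u: "u \<in> {a..b}" and f: "sq_integrable LS f"
  shows "(\<integral>\<omega>. X \<omega> u * l2_inner S (X \<omega>) f \<partial>P) = kernel_op S \<gamma> f u"
  unfolding expectation_linear_functional[OF sq_X[OF u] f] kernel_op_def cov_def by (simp add: mult.commute)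

lemma expectation_X_score: "u \<in> {a..b} \<Longrightarrow> (\<integral>\<omega>. X \<omega> u * \<xi> k \<omega> \<partial>P) = l k * \<psi> k u"
  unfolding score_def psi_eq_kernel_op by (rule expectation_X_linear_functional[OF _ sq_phi])

text \<open>On the observed part \<open>\<psi> k\<close> is one side of the eigenvalue equation divided by the eigenvalue: the
  continuous version of the eigenfunction.\<close>

lemma psi_eq_phi: "AE u in LS. \<psi> k u = \<phi> k u"
proof -
  have "AE u in LS. cov_operator P X S (\<phi> k) u = l k * \<phi> k u" using eigen by (simp add: eigen_system_def)
  then show ?thesis
  proof eventually_elim
    case (elim u)
    then have "l k * \<psi> k u = l k * \<phi> k u"
      by (simp add: psi_eq_kernel_op kernel_op_def cov_operator_def)
    then show ?case using l_pos[of k] by simp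
  qed
qed

lemma sq_psi: "sq_integrable LS (\<psi> k)"
proof -
  interpret K: continuous_kernel S \<gamma> by (rule kernel_cov)
  have "sq_integrable LS (\<lambda>v. 1 / l k * kernel_op S \<gamma> (\<phi> k) v)"
    by (rule sq_integrable_cmult[OF K.sq_op[OF sq_phi]])
  then show ?thesis using l_pos[of k] by (simp add: psi_eq_kernel_op[symmetric])
qed

lemma orth_score: "(\<integral>\<omega>. \<xi> j \<omega> * \<xi> k \<omega> \<partial>P) = (if j = k then l k else 0)"
proof -
  have "(\<integral>\<omega>. \<xi> j \<omega> * \<xi> k \<omega> \<partial>P) = (\<integral>v. (\<integral>\<omega>. X \<omega> v * \<xi> j \<omega> \<partial>P) * \<phi> k v \<partial>LS)"
    unfolding score_def[of X S \<phi> k] by (rule expectation_linear_functional[OF sq_score sq_phi])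
  also have "\<dots> = (\<integral>v. (l j * \<psi> j v) * \<phi> k v \<partial>LS)"
    using S_subset by (intro Bochner_Integration.integral_cong refl) (simp, subst expectation_X_score, auto)
  also have "\<dots> = (\<integral>v. l j * (\<phi> j v * \<phi> k v) \<partial>LS)"
  proof (rule integral_cong_AE)
    show "AE v in LS. (l j * \<psi> j v) * \<phi> k v = l j * (\<phi> j v * \<phi> k v)"
      using psi_eq_phi[of j] by eventually_elim simp
    have [measurable]: "\<phi> i \<in> borel_measurable LS" for i using sq_phi by measurable
    have [measurable]: "\<psi> j \<in> borel_measurable LS" using sq_psi by measurable
    show "(\<lambda>v. (l j * \<psi> j v) * \<phi> k v) \<in> borel_measurable LS" by measurable
    show "(\<lambda>v. l j * (\<phi> j v * \<phi> k v)) \<in> borel_measurable LS" by measurable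
  qed
  also have "\<dots> = l j * l2_inner S (\<phi> j) (\<phi> k)" by (simp add: l2_inner_def)
  finally show ?thesis by (simp add: orth_phi)
qed

lemma mean_score: "(\<integral>\<omega>. \<xi> k \<omega> \<partial>P) = 0"
proof -
  have "(\<integral>\<omega>. 1 * \<xi> k \<omega> \<partial>P) = (\<integral>v. (\<integral>\<omega>. X \<omega> v * 1 \<partial>P) * \<phi> k v \<partial>LS)"
    unfolding score_def by (rule expectation_linear_functional[OF const_sq sq_phi])
  also have "\<dots> = (\<integral>v. 0 \<partial>LS)"
    using S_subset by (intro Bochner_Integration.integral_cong refl) (auto simp: mean_X subset_eq)
  finally show ?thesis by simp
qed

sublocale scores: orthogonal_system P \<xi> l
  by unfold_locales (auto simp: l_pos sq_score orth_score)

lemma coef_X: "u \<in> {a..b} \<Longrightarrow> scores.coef (\<lambda>\<omega>. X \<omega> u) k = \<psi> k u"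
  using l_pos[of k] by (simp add: scores.coef_def expectation_X_score)

lemma proj_X: "u \<in> {a..b} \<Longrightarrow> scores.proj (\<lambda>\<omega>. X \<omega> u) n \<omega> = (\<Sum>k<n. \<xi> k \<omega> * \<psi> k u)"
  by (simp add: scores.proj_def coef_X)

section \<open>The Karhunen-Loeve expansion on the observed part\<close>

text \<open>The part of the covariance that the expansion leaves out. The Karhunen-Loeve theorem for the
  observed part is that it vanishes on \<open>S\<close>.\<close>

definition rho :: "real \<Rightarrow> real \<Rightarrow> real" where
  "rho u v = \<gamma> u v - (\<Sum>k. l k * \<psi> k u * \<psi> k v)"

definition rho_n :: "nat \<Rightarrow> real \<Rightarrow> real \<Rightarrow> real" where
  "rho_n n u v = \<gamma> u v - (\<Sum>k<n. l k * \<psi> k u * \<psi> k v)"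

lemma rho_n_eq:
  assumes "u \<in> {a..b}" "v \<in> {a..b}"
  shows "rho_n n u v = (\<integral>\<omega>. scores.resid (\<lambda>\<omega>. X \<omega> u) n \<omega> * scores.resid (\<lambda>\<omega>. X \<omega> v) n \<omega> \<partial>P)"
  using assms by (simp add: rho_n_def scores.inner_resid sq_X coef_X cov_def)

lemma rho_n_tendsto:
  assumes u: "u \<in> {a..b}" and v: "v \<in> {a..b}"
  shows "(\<lambda>n. rho_n n u v) \<longlonglongrightarrow> rho u v"
proof -
  have s: "summable (\<lambda>k. l k * (\<psi> k t)\<^sup>2)" if "t \<in> {a..b}" for t
    using scores.Bessel_summable[OF sq_X[OF that]] by (simp add: coef_X[OF that])
  have "summable (\<lambda>k. l k * \<psi> k u * \<psi> k v)"
  proof (rule summable_comparison_test', rule summable_add[OF s[OF u] s[OF v]])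
    fix k :: nat
    have "2 * (\<bar>\<psi> k u\<bar> * \<bar>\<psi> k v\<bar>) \<le> (\<psi> k u)\<^sup>2 + (\<psi> k v)\<^sup>2"
      using sum_squares_bound[of "\<bar>\<psi> k u\<bar>" "\<bar>\<psi> k v\<bar>"] by simp
    moreover have "0 \<le> \<bar>\<psi> k u\<bar> * \<bar>\<psi> k v\<bar>" by simp
    ultimately have "\<bar>\<psi> k u\<bar> * \<bar>\<psi> k v\<bar> \<le> (\<psi> k u)\<^sup>2 + (\<psi> k v)\<^sup>2" by linarith
    then have "l k * (\<bar>\<psi> k u\<bar> * \<bar>\<psi> k v\<bar>) \<le> l k * ((\<psi> k u)\<^sup>2 + (\<psi> k v)\<^sup>2)"
      using l_pos[of k] by (intro mult_left_mono) auto
    then show "norm (l k * \<psi> k u * \<psi> k v) \<le> l k * (\<psi> k u)\<^sup>2 + l k * (\<psi> k v)\<^sup>2"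
      using l_pos[of k] by (simp add: abs_mult distrib_left mult.assoc)
  qed
  then show ?thesis unfolding rho_n_def rho_def by (intro tendsto_intros summable_LIMSEQ)
qed

lemma rho_commute: "rho u v = rho v u"
  by (simp add: rho_def cov_commute[of u v] mult_ac)

definition increment :: "real \<Rightarrow> real \<Rightarrow> real" where
  "increment u v = (\<integral>\<omega>. (X \<omega> u - X \<omega> v)\<^sup>2 \<partial>P)"

lemma increment_eq: "u \<in> {a..b} \<Longrightarrow> v \<in> {a..b} \<Longrightarrow> increment u v = \<gamma> u u - 2 * \<gamma> u v + \<gamma> v v"
  using integral_square_diff[OF sq_X sq_X, of u v 1] by (simp add: increment_def cov_def power2_eq_square)

lemma increment_tendsto:
  assumes u: "u \<in> {a..b}" and v: "\<And>n. v n \<in> {a..b}" and lim: "v \<longlonglongrightarrow> u"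
  shows "(\<lambda>n. increment u (v n)) \<longlonglongrightarrow> 0"
proof -
  have c: "(\<lambda>n. (\<lambda>(u, v). \<gamma> u v) (s n, t n)) \<longlonglongrightarrow> (\<lambda>(u, v). \<gamma> u v) (u, u)"
    if "\<And>n. s n \<in> {a..b}" "\<And>n. t n \<in> {a..b}" "s \<longlonglongrightarrow> u" "t \<longlonglongrightarrow> u" for s t :: "nat \<Rightarrow> real"
    by (rule continuous_on_tendsto_compose[OF cov_continuous tendsto_Pair[OF that(3,4)]]) (use that u in auto)
  have "(\<lambda>n. \<gamma> u u - 2 * \<gamma> u (v n) + \<gamma> (v n) (v n)) \<longlonglongrightarrow> \<gamma> u u - 2 * \<gamma> u u + \<gamma> u u"
    using c[of "\<lambda>_. u" v] c[of v v] u v lim by (intro tendsto_intros) auto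
  then show ?thesis using u v by (simp add: increment_eq)
qed

text \<open>Removing the projection onto the first scores is itself an orthogonal projection and shrinks
  increments. The bound is uniform in \<open>n\<close>, so it passes to the limit and makes the remainder
  kernel continuous without any uniform convergence of its series.\<close>

lemma rho_n_diff_le:
  assumes u: "u \<in> {a..b}" "u' \<in> {a..b}" and v: "v \<in> {a..b}"
  shows "\<bar>rho_n n u v - rho_n n u' v\<bar> \<le> sqrt (increment u u') * sqrt (\<gamma> v v)"
proof -
  let ?D = "\<lambda>\<omega>. X \<omega> u - X \<omega> u'" and ?V = "\<lambda>\<omega>. X \<omega> v"
  have D: "sq_integrable P ?D" by (intro sq_integrable_diff sq_X u)
  have le: "(\<integral>\<omega>. (scores.resid W n \<omega>)\<^sup>2 \<partial>P) \<le> (\<integral>\<omega>. (W \<omega>)\<^sup>2 \<partial>P)" if W: "sq_integrable P W" for W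
    unfolding scores.resid_square[OF W] using l_pos by (simp add: sum_nonneg less_imp_le)
  have eq: "rho_n n u v - rho_n n u' v = (\<integral>\<omega>. scores.resid ?D n \<omega> * scores.resid ?V n \<omega> \<partial>P)"
    using sq_integrable_times[OF scores.sq_resid scores.sq_resid, OF sq_X sq_X] u v
    by (simp add: rho_n_eq scores.resid_diff sq_X left_diff_distrib)
  have "\<bar>rho_n n u v - rho_n n u' v\<bar>
      \<le> sqrt (\<integral>\<omega>. (scores.resid ?D n \<omega>)\<^sup>2 \<partial>P) * sqrt (\<integral>\<omega>. (scores.resid ?V n \<omega>)\<^sup>2 \<partial>P)"
    unfolding eq by (rule integral_abs_times_le[OF scores.sq_resid[OF D] scores.sq_resid[OF sq_X[OF v]]])
  also have "\<dots> \<le> sqrt (increment u u') * sqrt (\<gamma> v v)"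
    unfolding increment_def cov_diag
    by (rule mult_mono[OF real_sqrt_le_mono[OF le[OF D]] real_sqrt_le_mono[OF le[OF sq_X[OF v]]]]) simp_all
  finally show ?thesis .
qed

lemma rho_diff_le:
  assumes u: "u \<in> {a..b}" "u' \<in> {a..b}" and v: "v \<in> {a..b}"
  shows "\<bar>rho u v - rho u' v\<bar> \<le> sqrt (increment u u') * sqrt (\<gamma> v v)"
proof (rule LIMSEQ_le_const2)
  show "(\<lambda>n. \<bar>rho_n n u v - rho_n n u' v\<bar>) \<longlonglongrightarrow> \<bar>rho u v - rho u' v\<bar>"
    by (intro tendsto_intros rho_n_tendsto u v)
qed (use rho_n_diff_le[OF u v] in blast)

lemma rho_n_bound:
  assumes u: "u \<in> {a..b}" and v: "v \<in> {a..b}"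
  shows "\<bar>rho_n n u v\<bar> \<le> sqrt (\<gamma> u u) * sqrt (\<gamma> v v)"
proof -
  have le: "(\<integral>\<omega>. (scores.resid W n \<omega>)\<^sup>2 \<partial>P) \<le> (\<integral>\<omega>. (W \<omega>)\<^sup>2 \<partial>P)" if W: "sq_integrable P W" for W
    unfolding scores.resid_square[OF W] using l_pos by (simp add: sum_nonneg less_imp_le)
  have "\<bar>rho_n n u v\<bar> \<le> sqrt (\<integral>\<omega>. (scores.resid (\<lambda>\<omega>. X \<omega> u) n \<omega>)\<^sup>2 \<partial>P) * sqrt (\<integral>\<omega>. (scores.resid (\<lambda>\<omega>. X \<omega> v) n \<omega>)\<^sup>2 \<partial>P)"
    unfolding rho_n_eq[OF u v]
    by (rule integral_abs_times_le[OF scores.sq_resid[OF sq_X[OF u]] scores.sq_resid[OF sq_X[OF v]]])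
  also have "\<dots> \<le> sqrt (\<gamma> u u) * sqrt (\<gamma> v v)"
    unfolding cov_diag
    by (rule mult_mono[OF real_sqrt_le_mono[OF le[OF sq_X[OF u]]] real_sqrt_le_mono[OF le[OF sq_X[OF v]]]]) simp_all
  finally show ?thesis .
qed

lemma rho_continuous: "continuous_on ({a..b} \<times> {a..b}) (\<lambda>(u, v). rho u v)"
  unfolding continuous_on_sequentially
proof (intro allI ballI impI, elim conjE)
  fix x and p :: "real \<times> real"
  assume p: "p \<in> {a..b} \<times> {a..b}" and x: "\<forall>n. x n \<in> {a..b} \<times> {a..b}" and lim: "x \<longlonglongrightarrow> p"
  obtain u v where uv: "p = (u, v)" by force
  have u: "u \<in> {a..b}" and v: "v \<in> {a..b}" using p uv by auto
  let ?s = "\<lambda>n. fst (x n)" and ?t = "\<lambda>n. snd (x n)"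
  have s: "?s n \<in> {a..b}" and t: "?t n \<in> {a..b}" for n
    using x[rule_format, of n] by (auto simp: mem_Times_iff)
  have sl: "?s \<longlonglongrightarrow> u" and tl: "?t \<longlonglongrightarrow> v"
    using tendsto_fst[OF lim] tendsto_snd[OF lim] uv by auto
  obtain B where B: "0 \<le> B" "\<And>u. u \<in> {a..b} \<Longrightarrow> \<gamma> u u \<le> B" using cov_diag_bound by blast
  have "(\<lambda>n. rho (?s n) (?t n) - rho u v) \<longlonglongrightarrow> 0"
  proof (rule Lim_null_comparison)
    show "\<forall>\<^sub>F n in sequentially. norm (rho (?s n) (?t n) - rho u v)
        \<le> sqrt (increment u (?s n)) * sqrt B + sqrt (increment v (?t n)) * sqrt B"
    proof (intro always_eventually allI)
      fix n
      have "\<bar>rho u (?t n) - rho (?s n) (?t n)\<bar> \<le> sqrt (increment u (?s n)) * sqrt (\<gamma> (?t n) (?t n))"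
        by (rule rho_diff_le[OF u s t])
      also have "\<dots> \<le> sqrt (increment u (?s n)) * sqrt B"
        by (intro mult_left_mono real_sqrt_le_mono B t) (simp add: increment_def)
      finally have 1: "\<bar>rho u (?t n) - rho (?s n) (?t n)\<bar> \<le> sqrt (increment u (?s n)) * sqrt B" .
      have "\<bar>rho v u - rho (?t n) u\<bar> \<le> sqrt (increment v (?t n)) * sqrt (\<gamma> u u)"
        by (rule rho_diff_le[OF v t u])
      also have "\<dots> \<le> sqrt (increment v (?t n)) * sqrt B"
        by (intro mult_left_mono real_sqrt_le_mono B u) (simp add: increment_def)
      finally have 2: "\<bar>rho u v - rho u (?t n)\<bar> \<le> sqrt (increment v (?t n)) * sqrt B"
        by (simp add: rho_commute)
      show "norm (rho (?s n) (?t n) - rho u v)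
        \<le> sqrt (increment u (?s n)) * sqrt B + sqrt (increment v (?t n)) * sqrt B"
        using 1 2 unfolding real_norm_def by arith
    qed
    have "(\<lambda>n. sqrt (increment u (?s n)) * sqrt B + sqrt (increment v (?t n)) * sqrt B) \<longlonglongrightarrow> sqrt 0 * sqrt B + sqrt 0 * sqrt B"
      by (intro tendsto_intros increment_tendsto u v s t sl tl)
    then show "(\<lambda>n. sqrt (increment u (?s n)) * sqrt B + sqrt (increment v (?t n)) * sqrt B) \<longlonglongrightarrow> 0" by simp
  qed
  then show "((\<lambda>(u, v). rho u v) \<circ> x) \<longlonglongrightarrow> (\<lambda>(u, v). rho u v) p"
    unfolding uv comp_def case_prod_unfold fst_conv snd_conv by (rule LIM_zero_cancel)
qed

lemma kernel_rho: "continuous_kernel S rho"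
proof
  show "continuous_on (S \<times> S) (\<lambda>(u, v). rho u v)"
    using S_subset by (intro continuous_on_subset[OF rho_continuous]) auto
qed (auto simp: S_compact intro: rho_commute)

lemma inner_psi:
  assumes f: "sq_integrable LS f"
  shows "(\<integral>v. \<psi> k v * f v \<partial>LS) = l2_inner S (\<phi> k) f"
  unfolding l2_inner_def
proof (rule integral_cong_AE)
  show "AE v in LS. \<psi> k v * f v = \<phi> k v * f v" using psi_eq_phi[of k] by eventually_elim simp
qed (use sq_psi[of k] sq_phi[of k] f in measurable)

text \<open>Dominated convergence lets the remainder operator be computed from the partial sums: on a function
  orthogonal to all \<open>\<phi> k\<close> it agrees with the covariance operator, and it annihilates each \<open>\<phi> k\<close>.\<close>

lemma kernel_op_rho_limit:
  assumes f: "sq_integrable LS f" and u: "u \<in> S"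
  shows "(\<lambda>n. kernel_op S \<gamma> f u - (\<Sum>k<n. l k * \<psi> k u * l2_inner S (\<phi> k) f)) \<longlonglongrightarrow> kernel_op S rho f u"
proof -
  interpret K: continuous_kernel S \<gamma> by (rule kernel_cov)
  interpret R: continuous_kernel S rho by (rule kernel_rho)
  interpret finite_measure LS by (rule finite_LS)
  obtain B where B: "0 \<le> B" "\<And>u. u \<in> {a..b} \<Longrightarrow> \<gamma> u u \<le> B" using cov_diag_bound by blast
  have u': "u \<in> {a..b}" using u S_subset by auto
  have s: "sq_integrable LS (\<lambda>v. \<Sum>k<n. (l k * \<psi> k u) * \<psi> k v)" for n
    by (intro sq_integrable_sum sq_integrable_cmult sq_psi)
  have sn: "sq_integrable LS (rho_n n u)" for n
    unfolding rho_n_def[abs_def] by (intro sq_integrable_diff K.sq_K u s)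
  have "(\<integral>v. rho_n n u v * f v \<partial>LS) = kernel_op S \<gamma> f u - (\<Sum>k<n. l k * \<psi> k u * l2_inner S (\<phi> k) f)" for n
  proof -
    have "(\<integral>v. rho_n n u v * f v \<partial>LS) = (\<integral>v. \<gamma> u v * f v - (\<Sum>k<n. (l k * \<psi> k u) * (\<psi> k v * f v)) \<partial>LS)"
      by (simp add: rho_n_def left_diff_distrib sum_distrib_right mult.assoc)
    also have "\<dots> = (\<integral>v. \<gamma> u v * f v \<partial>LS) - (\<Sum>k<n. (l k * \<psi> k u) * (\<integral>v. \<psi> k v * f v \<partial>LS))"
      using sq_integrable_times[OF K.sq_K[OF u] f] sq_integrable_times[OF sq_psi f] by simp
    finally show ?thesis by (simp add: kernel_op_def inner_psi[OF f])
  qed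
  moreover have "(\<lambda>n. \<integral>v. rho_n n u v * f v \<partial>LS) \<longlonglongrightarrow> (\<integral>v. rho u v * f v \<partial>LS)"
  proof (rule integral_dominated_convergence)
    show "integrable LS (\<lambda>v. B * \<bar>f v\<bar>)"
      using sq_integrable_times[OF f, of "\<lambda>_. 1"] by (auto simp: sq_integrable_def)
    show "AE v in LS. (\<lambda>n. rho_n n u v * f v) \<longlonglongrightarrow> rho u v * f v"
      using S_subset u' by (intro AE_I2 tendsto_intros rho_n_tendsto) auto
    show "AE v in LS. norm (rho_n n u v * f v) \<le> B * \<bar>f v\<bar>" for n
    proof (rule AE_I2)
      fix v assume "v \<in> space LS"
      then have v: "v \<in> {a..b}" using S_subset by auto
      have "\<bar>rho_n n u v\<bar> \<le> sqrt (\<gamma> u u) * sqrt (\<gamma> v v)" by (rule rho_n_bound[OF u' v])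
      also have "\<dots> \<le> sqrt B * sqrt B" by (intro mult_mono real_sqrt_le_mono B u' v) (auto simp: B(1) cov_diag)
      finally show "norm (rho_n n u v * f v) \<le> B * \<bar>f v\<bar>" using B(1) by (simp add: abs_mult mult_right_mono)
    qed
    show "(\<lambda>v. rho u v * f v) \<in> borel_measurable LS"
      using sq_integrable_times[OF R.sq_K[OF u] f] by (rule borel_measurable_integrable)
    show "(\<lambda>v. rho_n n u v * f v) \<in> borel_measurable LS" for n
      using sq_integrable_times[OF sn f] by (rule borel_measurable_integrable)
  qed
  ultimately show ?thesis by (simp add: kernel_op_def)
qed

lemma rho_op_phi:
  assumes u: "u \<in> S" shows "kernel_op S rho (\<phi> j) u = 0"
proof -
  have "kernel_op S \<gamma> (\<phi> j) u - (\<Sum>k<n. l k * \<psi> k u * l2_inner S (\<phi> k) (\<phi> j)) = 0" if "Suc j \<le> n" for n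
    using that by (simp add: orth_phi psi_eq_kernel_op[symmetric] if_distrib[of "\<lambda>x. _ * x"] sum.delta cong: if_cong)
  then have "(\<lambda>n. kernel_op S \<gamma> (\<phi> j) u - (\<Sum>k<n. l k * \<psi> k u * l2_inner S (\<phi> k) (\<phi> j))) \<longlonglongrightarrow> 0"
    by (intro tendsto_eventually eventually_sequentiallyI[of "Suc j"])
  then show ?thesis using LIMSEQ_unique[OF kernel_op_rho_limit[OF sq_phi u]] by blast
qed

text \<open>An eigenfunction of the remainder kernel with nonzero eigenvalue would be orthogonal to all
  \<open>\<phi> k\<close> and hence an eigenfunction of the covariance operator missing in the list. A symmetric
  continuous kernel without nonzero eigenvalues induces the zero operator; applied to the sections of
  the kernel itself, this makes the kernel vanish.\<close>

lemma rho_zero: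
  assumes u: "u \<in> S" and v: "v \<in> S" shows "rho u v = 0"
proof -
  interpret R: continuous_kernel S rho by (rule kernel_rho)
  let ?T = "kernel_op S rho"
  have T0: "(\<integral>x. (?T f x)\<^sup>2 \<partial>LS) = 0" if f: "sq_integrable LS f" for f
  proof (rule ccontr)
    assume "(\<integral>x. (?T f x)\<^sup>2 \<partial>LS) \<noteq> 0"
    then obtain g \<mu> where g: "\<mu> \<noteq> 0" "sq_integrable LS g" "\<not> (AE u in LS. g u = 0)"
      and eg: "AE u in LS. ?T g u = \<mu> * g u"
      using R.eigenvalue_exists[OF f] by metis
    have orth: "l2_inner S (\<phi> k) g = 0" for k
    proof -
      have "\<mu> * l2_inner S (\<phi> k) g = (\<integral>x. \<phi> k x * (\<mu> * g x) \<partial>LS)"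
        by (simp add: l2_inner_def mult.left_commute)
      also have "\<dots> = (\<integral>x. \<phi> k x * ?T g x \<partial>LS)"
      proof (rule integral_cong_AE)
        show "AE x in LS. \<phi> k x * (\<mu> * g x) = \<phi> k x * ?T g x" using eg by eventually_elim simp
      qed (use sq_phi[of k] g(2) R.sq_op[OF g(2)] in measurable)
      also have "\<dots> = (\<integral>x. ?T (\<phi> k) x * g x \<partial>LS)" by (rule R.op_selfadjoint[OF sq_phi g(2), symmetric])
      also have "\<dots> = (\<integral>x. 0 \<partial>LS)"
        by (intro Bochner_Integration.integral_cong) (auto simp: rho_op_phi)
      finally show ?thesis using g(1) by simp
    qed
    have eq: "?T g u = cov_operator P X S g u" if "u \<in> S" for u
      using LIMSEQ_unique[OF kernel_op_rho_limit[OF g(2) that]] orth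
      by (simp add: cov_operator_def kernel_op_def)
    have "AE u in LS. cov_operator P X S g u = \<mu> * g u"
      using eg AE_space[of LS] by eventually_elim (simp add: eq)
    then obtain k c where gc: "AE u in LS. g u = c * \<phi> k u"
      using eigen_complete[OF g(2,1,3)] by blast
    have "l2_inner S (\<phi> k) g = (\<integral>x. c * (\<phi> k x * \<phi> k x) \<partial>LS)"
      unfolding l2_inner_def
    proof (rule integral_cong_AE)
      show "AE x in LS. \<phi> k x * g x = c * (\<phi> k x * \<phi> k x)" using gc by eventually_elim simp
    qed (use sq_phi[of k] g(2) in measurable)
    also have "\<dots> = c * l2_inner S (\<phi> k) (\<phi> k)" by (simp add: l2_inner_def)
    finally have "c = 0" using orth by (simp add: orth_phi)
    with gc g(3) show False by simp
  qed
  have z: "?T f x = 0" if f: "sq_integrable LS f" and x: "x \<in> S" for f x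
    using AE_lebesgue_on_zero_imp_zero[OF S_compact S_support R.op_continuous[OF f] _ x]
      integral_square_zero_AE[OF R.sq_op[OF f] T0[OF f]] by blast
  have "(\<integral>y. (rho u y)\<^sup>2 \<partial>LS) = 0"
    using z[OF R.sq_K[OF u] u] by (simp add: kernel_op_def power2_eq_square)
  then have "AE y in LS. rho u y = 0" by (rule integral_square_zero_AE[OF R.sq_K[OF u]])
  moreover have "continuous_on S (rho u)"
    by (rule continuous_on_compose2[OF R.continuous, of S "\<lambda>y. (u, y)", simplified])
      (use u in \<open>auto intro!: continuous_intros\<close>)
  ultimately show ?thesis using AE_lebesgue_on_zero_imp_zero[OF S_compact S_support _ _ v] by blast
qed

text \<open>The mean square of the remainder after \<open>n\<close> terms is the diagonal value of the partial remainder
  kernel.\<close>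

theorem Karhunen_Loeve:
  assumes v: "v \<in> S"
  shows "L2_conv P (scores.proj (\<lambda>\<omega>. X \<omega> v)) (\<lambda>\<omega>. X \<omega> v)"
proof -
  have v': "v \<in> {a..b}" using v S_subset by auto
  have "(\<lambda>n. rho_n n v v) \<longlonglongrightarrow> 0" using rho_n_tendsto[OF v' v'] rho_zero[OF v v] by simp
  then show ?thesis
    unfolding L2_conv_def rho_n_eq[OF v' v'] by (simp add: scores.resid_def power2_eq_square)
qed

end

context observed_process
begin

section \<open>The optimal reconstruction\<close>

lemma psi_measurable:
  assumes T: "T \<in> sets lebesgue" "T \<subseteq> {a..b}"
  shows "\<psi> k \<in> borel_measurable (lebesgue_on T)"
proof -
  have [measurable]: "\<xi> k \<in> borel_measurable P" using sq_score by measurable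
  have [measurable]: "(\<lambda>(\<omega>, u). X \<omega> u) \<in> borel_measurable (P \<Otimes>\<^sub>M lebesgue_on T)" by (rule X_pair_measurable[OF T(2)])
  have "(\<lambda>u. (\<integral>\<omega>. X \<omega> u * \<xi> k \<omega> \<partial>P) / l k) \<in> borel_measurable (lebesgue_on T)" by measurable
  then show ?thesis
  proof (rule measurable_cong[THEN iffD1, rotated])
    fix u assume "u \<in> space (lebesgue_on T)"
    then have "u \<in> {a..b}" using T by auto
    then show "(\<integral>\<omega>. X \<omega> u * \<xi> k \<omega> \<partial>P) / l k = \<psi> k u"
      using l_pos[of k] by (simp add: expectation_X_score)
  qed
qed

lemma psi_Bessel:
  assumes u: "u \<in> {a..b}"
  shows "summable (\<lambda>k. l k * (\<psi> k u)\<^sup>2)" "(\<Sum>k. l k * (\<psi> k u)\<^sup>2) \<le> \<gamma> u u"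
proof -
  show s: "summable (\<lambda>k. l k * (\<psi> k u)\<^sup>2)"
    using scores.Bessel_summable[OF sq_X[OF u]] by (simp add: coef_X[OF u])
  show "(\<Sum>k. l k * (\<psi> k u)\<^sup>2) \<le> \<gamma> u u"
    using scores.Bessel[OF sq_X[OF u]] by (intro suminf_le_const[OF s]) (simp add: coef_X[OF u] cov_diag)
qed

text \<open>The speed of convergence may depend on the point, so the summation is stopped at a
  measurable index \<open>N j u\<close> that makes the tail at \<open>u\<close> at most \<open>(1/4) ^ j\<close>. At every point the stopped
  sums converge almost surely, and the formula for their limit is jointly measurable.\<close>

theorem reconstruction_exists:
  assumes T: "T \<in> sets lebesgue" "T \<subseteq> {a..b}"
  shows "\<exists>R. is_reconstruction P X S T \<phi> l R"
proof -
  define tail where "tail u m = (\<Sum>k. l k * (\<psi> k u)\<^sup>2) - (\<Sum>k<m. l k * (\<psi> k u)\<^sup>2)" for u m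
  define N where "N j u = (LEAST m. tail u m \<le> (1/4) ^ j)" for j :: nat and u
  define f where "f j \<omega> u = (\<Sum>k<N j u. \<xi> k \<omega> * \<psi> k u)" for j \<omega> u
  define R where "R \<omega> u = lim (\<lambda>j. f j \<omega> u)" for \<omega> u
  have [measurable]: "\<psi> k \<in> borel_measurable (lebesgue_on T)" for k by (rule psi_measurable[OF T])
  have [measurable]: "\<xi> k \<in> borel_measurable P" for k using sq_score[of k] by measurable
  have [measurable]: "(\<lambda>u. tail u m) \<in> borel_measurable (lebesgue_on T)" for m
    unfolding tail_def by measurable
  have [measurable]: "N j \<in> lebesgue_on T \<rightarrow>\<^sub>M count_space UNIV" for j
    unfolding N_def by measurable
  have "(\<lambda>p. f j (fst p) (snd p)) \<in> borel_measurable (P \<Otimes>\<^sub>M lebesgue_on T)" for j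
    unfolding f_def
    by (rule measurable_compose_countable[where f="\<lambda>i p. \<Sum>k<i. \<xi> k (fst p) * \<psi> k (snd p)"]) measurable
  then have mR: "(\<lambda>(\<omega>, u). R \<omega> u) \<in> borel_measurable (P \<Otimes>\<^sub>M lebesgue_on T)"
    unfolding R_def case_prod_unfold by (rule borel_measurable_lim_metric)
  have pt: "integrable P (\<lambda>\<omega>. (R \<omega> u)\<^sup>2) \<and>
      (\<lambda>n. \<integral>\<omega>. (R \<omega> u - (\<Sum>k<n. \<xi> k \<omega> * \<psi> k u))\<^sup>2 \<partial>P) \<longlonglongrightarrow> 0" if "u \<in> T" for u
  proof -
    have u: "u \<in> {a..b}" using that T by auto
    let ?X = "\<lambda>\<omega>. X \<omega> u"
    let ?p = "scores.proj ?X"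
    note s = psi_Bessel(1)[OF u]
    have t0: "tail u \<longlonglongrightarrow> 0"
    proof -
      have "(\<lambda>m. (\<Sum>k. l k * (\<psi> k u)\<^sup>2) - (\<Sum>k<m. l k * (\<psi> k u)\<^sup>2))
          \<longlonglongrightarrow> (\<Sum>k. l k * (\<psi> k u)\<^sup>2) - (\<Sum>k. l k * (\<psi> k u)\<^sup>2)"
        by (intro tendsto_intros summable_LIMSEQ s)
      then show ?thesis by (simp add: tail_def[abs_def])
    qed
    have tail_nonneg: "0 \<le> tail u m" for m
      unfolding tail_def using sum_le_suminf[OF s] l_pos by (simp add: less_imp_le)
    have tail_diff: "(\<integral>\<omega>. (?p m \<omega> - ?p n \<omega>)\<^sup>2 \<partial>P) = tail u n - tail u m" if "n \<le> m" for n m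
      using sum_diff_nat_ivl[of 0 n m "\<lambda>k. l k * (\<psi> k u)\<^sup>2"] that
      by (simp add: scores.proj_diff_square coef_X[OF u] tail_def lessThan_atLeast0)
    have "\<exists>m. tail u m \<le> (1/4) ^ j" for j :: nat
    proof -
      have "\<forall>\<^sub>F m in sequentially. tail u m < (1/4) ^ j" by (rule order_tendstoD(2)[OF t0]) simp
      then obtain m where "tail u m < (1/4) ^ j" by (auto simp: eventually_sequentially)
      then show ?thesis by (auto intro: less_imp_le)
    qed
    then have N: "tail u (N j u) \<le> (1/4) ^ j" for j unfolding N_def by (rule LeastI_ex)
    have N_mono: "N i u \<le> N j u" if "i \<le> j" for i j
    proof -
      have "(1/4::real) ^ j \<le> (1/4) ^ i" using that by (intro power_decreasing) auto
      then have "tail u (N j u) \<le> (1/4) ^ i" using N[of j] by linarith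
      then show ?thesis unfolding N_def[of i] by (rule Least_le)
    qed
    have fp: "f j \<omega> u = ?p (N j u) \<omega>" for j \<omega> by (simp add: f_def proj_X[OF u])
    have near: "(\<integral>\<omega>. (?p m \<omega> - f j \<omega> u)\<^sup>2 \<partial>P) \<le> (1/4) ^ j" if "N j u \<le> m" for m j
      unfolding fp using tail_diff[OF that] N[of j] tail_nonneg[of m] by simp
    have sqf: "sq_integrable P (\<lambda>\<omega>. f j \<omega> u)" for j unfolding fp by (rule scores.sq_proj)
    have cauchy: "(\<integral>\<omega>. (f m \<omega> u - f n \<omega> u)\<^sup>2 \<partial>P) \<le> (1/4) ^ n" if "n \<le> m" for n m
      using near[OF N_mono[OF that]] by (simp add: fp)
    have sqR: "sq_integrable P (\<lambda>\<omega>. R \<omega> u)"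
      unfolding R_def by (rule lim_of_rapidly_Cauchy(1)[OF finite_measure_axioms sqf cauchy])
    have Rf: "(\<integral>\<omega>. (R \<omega> u - f n \<omega> u)\<^sup>2 \<partial>P) \<le> (1/4) ^ n" for n
      unfolding R_def by (rule lim_of_rapidly_Cauchy(2)[OF finite_measure_axioms sqf cauchy])
    have Rp: "(\<integral>\<omega>. (R \<omega> u - ?p m \<omega>)\<^sup>2 \<partial>P) \<le> 4 * (1/4) ^ j" if m: "N j u \<le> m" for m j
    proof -
      have "(\<integral>\<omega>. (R \<omega> u - ?p m \<omega>)\<^sup>2 \<partial>P) = (\<integral>\<omega>. ((R \<omega> u - f j \<omega> u) + (f j \<omega> u - ?p m \<omega>))\<^sup>2 \<partial>P)" by simp
      also have "\<dots> \<le> 2 * (\<integral>\<omega>. (R \<omega> u - f j \<omega> u)\<^sup>2 \<partial>P) + 2 * (\<integral>\<omega>. (f j \<omega> u - ?p m \<omega>)\<^sup>2 \<partial>P)"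
        by (intro integral_square_add_le sq_integrable_diff sqR sqf scores.sq_proj)
      also have "\<dots> \<le> 2 * (1/4) ^ j + 2 * (1/4) ^ j"
        using Rf[of j] near[OF m] by (simp add: power2_commute)
      finally show ?thesis by simp
    qed
    have "(\<lambda>n. \<integral>\<omega>. (R \<omega> u - ?p n \<omega>)\<^sup>2 \<partial>P) \<longlonglongrightarrow> 0"
    proof (rule LIMSEQ_I)
      fix e :: real assume e: "0 < e"
      obtain j where j: "(1/4::real) ^ j < e / 4" using real_arch_pow_inv[of "e / 4" "1/4"] e by auto
      have "norm ((\<integral>\<omega>. (R \<omega> u - ?p n \<omega>)\<^sup>2 \<partial>P) - 0) < e" if "N j u \<le> n" for n
        using Rp[OF that] j by simp
      then show "\<exists>n0. \<forall>n\<ge>n0. norm ((\<integral>\<omega>. (R \<omega> u - ?p n \<omega>)\<^sup>2 \<partial>P) - 0) < e" by blast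
    qed
    then show ?thesis using sqR by (simp add: proj_X[OF u] sq_integrable_def)
  qed
  show ?thesis
    unfolding is_reconstruction_def using mR pt by blast
qed

end

locale reconstructed_process = observed_process +
  fixes T :: "real set" and R :: "'a \<Rightarrow> real \<Rightarrow> real"
  assumes T: "T \<in> sets lebesgue" "T \<subseteq> {a..b}"
    and reconstruction: "is_reconstruction P X S T \<phi> l R"
begin

definition Z :: "'a \<Rightarrow> real \<Rightarrow> real" where "Z \<omega> u = X \<omega> u - R \<omega> u"

lemma T_interval: "u \<in> T \<Longrightarrow> u \<in> {a..b}" using T by auto

lemma R_pair_measurable: "(\<lambda>(\<omega>, u). R \<omega> u) \<in> borel_measurable (P \<Otimes>\<^sub>M lebesgue_on T)"
  using reconstruction by (simp add: is_reconstruction_def)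

lemma sq_R:
  assumes u: "u \<in> T" shows "sq_integrable P (\<lambda>\<omega>. R \<omega> u)"
proof -
  have "(\<lambda>\<omega>. (\<lambda>(\<omega>, u). R \<omega> u) (\<omega>, u)) \<in> borel_measurable P"
    by (rule measurable_compose[OF measurable_Pair2' R_pair_measurable]) (use u T in simp)
  then show ?thesis using reconstruction u by (simp add: is_reconstruction_def sq_integrable_def)
qed

lemma sq_Z: "u \<in> T \<Longrightarrow> sq_integrable P (\<lambda>\<omega>. Z \<omega> u)"
  unfolding Z_def by (intro sq_integrable_diff sq_X sq_R T_interval)

lemma R_limit:
  assumes u: "u \<in> T" shows "L2_conv P (scores.proj (\<lambda>\<omega>. X \<omega> u)) (\<lambda>\<omega>. R \<omega> u)"
  using reconstruction u by (simp add: is_reconstruction_def L2_conv_def proj_X[OF T_interval[OF u]])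

lemma Z_orthogonal_score: "u \<in> T \<Longrightarrow> (\<integral>\<omega>. Z \<omega> u * \<xi> k \<omega> \<partial>P) = 0"
  unfolding Z_def by (intro scores.limit_orthogonal sq_X sq_R R_limit T_interval)

lemma Z_orthogonal_limit:
  assumes u: "u \<in> T" and W: "sq_integrable P W" and c: "L2_conv P (\<lambda>n \<omega>. \<Sum>k<n. \<xi> k \<omega> * c k) W"
  shows "(\<integral>\<omega>. W \<omega> * Z \<omega> u \<partial>P) = 0"
  by (rule scores.orthogonal_to_limit[OF sq_Z[OF u] Z_orthogonal_score[OF u] W c])

lemma Z_orthogonal_R:
  assumes u: "u \<in> T" shows "(\<integral>\<omega>. R \<omega> u * Z \<omega> u \<partial>P) = 0"
  by (rule Z_orthogonal_limit[OF u sq_R[OF u] R_limit[OF u, unfolded scores.proj_def[abs_def]]])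

lemma Z_orthogonal_observed:
  assumes u: "u \<in> T" and v: "v \<in> S" shows "(\<integral>\<omega>. X \<omega> v * Z \<omega> u \<partial>P) = 0"
  using Z_orthogonal_limit[OF u sq_X Karhunen_Loeve[OF v, unfolded scores.proj_def[abs_def]]] v S_subset by blast

lemma X_Z_integrable:
  assumes u: "u \<in> T" and v: "v \<in> {a..b}" shows "integrable P (\<lambda>\<omega>. X \<omega> v * Z \<omega> u)"
  by (rule sq_integrable_times[OF sq_X[OF v] sq_Z[OF u]])

lemma mean_square_Z:
  assumes u: "u \<in> T" shows "(\<integral>\<omega>. (Z \<omega> u)\<^sup>2 \<partial>P) = \<gamma> u u - (\<Sum>k. l k * (\<psi> k u)\<^sup>2)"
  using scores.limit_resid_square[OF sq_X sq_R R_limit, OF T_interval[OF u] u u]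
  by (simp add: Z_def coef_X[OF T_interval[OF u]] cov_diag)

lemma mean_R:
  assumes u: "u \<in> T" shows "(\<integral>\<omega>. R \<omega> u \<partial>P) = 0"
proof -
  have i: "integrable P (\<xi> k)" for k using sq_integrable_times[OF sq_score const_sq, of k 1] by simp
  have "(\<lambda>n. \<integral>\<omega>. scores.proj (\<lambda>\<omega>. X \<omega> u) n \<omega> * 1 \<partial>P) \<longlonglongrightarrow> (\<integral>\<omega>. R \<omega> u * 1 \<partial>P)"
    by (rule L2_conv_times[OF scores.sq_proj sq_R[OF u] const_sq R_limit[OF u]])
  moreover have "(\<integral>\<omega>. scores.proj (\<lambda>\<omega>. X \<omega> u) n \<omega> * 1 \<partial>P) = 0" for n
    using i by (simp add: scores.proj_def mean_score)
  ultimately show ?thesis using LIMSEQ_unique[OF tendsto_const] by force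
qed

lemma mean_Z:
  assumes u: "u \<in> T" shows "(\<integral>\<omega>. Z \<omega> u \<partial>P) = 0"
proof -
  have "integrable P (\<lambda>\<omega>. X \<omega> u)" "integrable P (\<lambda>\<omega>. R \<omega> u)"
    using sq_integrable_times[OF sq_X const_sq, of u 1] sq_integrable_times[OF sq_R const_sq, of u 1] T_interval[OF u] u by auto
  then show ?thesis by (simp add: Z_def mean_X[OF T_interval[OF u]] mean_R[OF u])
qed

lemma variance_Z: "u \<in> T \<Longrightarrow> Defs.variance P (\<lambda>\<omega>. Z \<omega> u) = (\<integral>\<omega>. (Z \<omega> u)\<^sup>2 \<partial>P)"
  by (simp add: Defs.variance_def mean_Z)

lemma Z_path_L2: "AE \<omega> in P. Z \<omega> \<in> L2 T"
proof -
  interpret T: finite_measure "lebesgue_on T" by (rule finite_measure_lebesgue_on_interval[OF T])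
  interpret pair_sigma_finite P "lebesgue_on T"
    using sigma_finite_lebesgue_on[OF T] sigma_finite_measure_axioms by (simp add: pair_sigma_finite_def)
  have [measurable]: "(\<lambda>(\<omega>, u). R \<omega> u) \<in> borel_measurable (P \<Otimes>\<^sub>M lebesgue_on T)" by (rule R_pair_measurable)
  have [measurable]: "(\<lambda>(\<omega>, u). X \<omega> u) \<in> borel_measurable (P \<Otimes>\<^sub>M lebesgue_on T)" by (rule X_pair_measurable[OF T(2)])
  have m [measurable]: "(\<lambda>(\<omega>, u). Z \<omega> u) \<in> borel_measurable (P \<Otimes>\<^sub>M lebesgue_on T)"
    unfolding Z_def by measurable
  obtain B where B: "0 \<le> B" "\<And>u. u \<in> {a..b} \<Longrightarrow> \<gamma> u u \<le> B" using cov_diag_bound by blast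
  have "(\<integral>\<^sup>+u. \<integral>\<^sup>+\<omega>. ennreal ((Z \<omega> u)\<^sup>2) \<partial>P \<partial>lebesgue_on T) \<le> (\<integral>\<^sup>+u. ennreal B \<partial>lebesgue_on T)"
  proof (rule nn_integral_mono)
    fix u assume "u \<in> space (lebesgue_on T)"
    then have u: "u \<in> T" by auto
    have "0 \<le> (\<Sum>k. l k * (\<psi> k u)\<^sup>2)"
      using l_pos by (intro suminf_nonneg psi_Bessel(1) T_interval u) (simp add: less_imp_le)
    then have "(\<integral>\<omega>. (Z \<omega> u)\<^sup>2 \<partial>P) \<le> B" using mean_square_Z[OF u] B(2)[OF T_interval[OF u]] by simp
    moreover have "(\<integral>\<^sup>+\<omega>. ennreal ((Z \<omega> u)\<^sup>2) \<partial>P) = ennreal (\<integral>\<omega>. (Z \<omega> u)\<^sup>2 \<partial>P)"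
      using sq_Z[OF u] by (intro nn_integral_eq_integral) (auto simp: sq_integrable_def)
    ultimately show "(\<integral>\<^sup>+\<omega>. ennreal ((Z \<omega> u)\<^sup>2) \<partial>P) \<le> ennreal B" by (simp add: ennreal_leI)
  qed
  also have "\<dots> < \<infinity>"
    by (simp add: ennreal_mult_less_top less_top T.emeasure_eq_measure del: emeasure_completion)
  finally have "sq_integrable (P \<Otimes>\<^sub>M lebesgue_on T) (\<lambda>(\<omega>, u). Z \<omega> u)"
    by (rule sq_integrable_pair[OF prob_space_imp_sigma_finite[OF prob_space_axioms] sigma_finite_lebesgue_on[OF T] m])
  then have "AE \<omega> in P. integrable (lebesgue_on T) (\<lambda>u. (Z \<omega> u)\<^sup>2)"
    using AE_integrable_fst'[of "\<lambda>p. ((\<lambda>(\<omega>, u). Z \<omega> u) p)\<^sup>2"] by (simp add: sq_integrable_def)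
  then show ?thesis
    using AE_space
  proof eventually_elim
    case (elim \<omega>)
    have "(\<lambda>u. (\<lambda>(\<omega>, u). Z \<omega> u) (\<omega>, u)) \<in> borel_measurable (lebesgue_on T)"
      by (rule measurable_compose[OF measurable_Pair1' m]) (use elim in simp)
    then show ?case using elim by (simp add: L2_def)
  qed
qed

text \<open>A reconstruction that is continuous along the Karhunen-Loeve expansion is itself a limit of
  combinations of the scores, so by Pythagoras it cannot beat the orthogonal projection.\<close>

theorem reconstruction_optimal:
  assumes L: "reconstruction_operator P X S T L" and kl: "kl_continuous P X S T \<phi> L" and u: "u \<in> T"
  shows "(\<integral>\<omega>. (Z \<omega> u)\<^sup>2 \<partial>P) \<le> (\<integral>\<omega>. (X \<omega> u - L (X \<omega>) u)\<^sup>2 \<partial>P)"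
proof -
  let ?W = "\<lambda>\<omega>. L (X \<omega>) u"
  have W: "sq_integrable P ?W"
    using L u by (auto simp: reconstruction_operator_def sq_integrable_def)
  have lin: "L (\<lambda>x. c * f x + d * g x) u = c * L f u + d * L g u" if "f \<in> L2 S" "g \<in> L2 S" for f g c d
    using L u that unfolding reconstruction_operator_def linear_L2_operator_def by blast
  have rem: "kl_remainder X S \<phi> n \<omega> \<in> L2 S \<and> L (kl_remainder X S \<phi> n \<omega>) u = ?W \<omega> - (\<Sum>k<n. \<xi> k \<omega> * L (\<phi> k) u)"
    if \<omega>: "\<omega> \<in> space P" for n \<omega>
  proof (induction n)
    case 0
    then show ?case using sq_X_path[OF \<omega>] by (simp add: kl_remainder_def[abs_def] L2_iff_sq_integrable)
  next
    case (Suc n)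
    have e: "kl_remainder X S \<phi> (Suc n) \<omega> = (\<lambda>x. 1 * kl_remainder X S \<phi> n \<omega> x + (- \<xi> n \<omega>) * \<phi> n x)"
      by (simp add: kl_remainder_def fun_eq_iff)
    have p: "\<phi> n \<in> L2 S" using sq_phi by (simp add: L2_iff_sq_integrable)
    have "kl_remainder X S \<phi> (Suc n) \<omega> \<in> L2 S"
      unfolding e L2_iff_sq_integrable
      using Suc p by (intro sq_integrable_add sq_integrable_cmult) (auto simp: L2_iff_sq_integrable)
    moreover have "L (kl_remainder X S \<phi> (Suc n) \<omega>) u = ?W \<omega> - (\<Sum>k<Suc n. \<xi> k \<omega> * L (\<phi> k) u)"
      unfolding e using Suc p by (subst lin) auto
    ultimately show ?case ..
  qed
  have "L2_conv P (\<lambda>n \<omega>. \<Sum>k<n. \<xi> k \<omega> * L (\<phi> k) u) ?W"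
  proof -
    have eq: "(\<integral>\<omega>. (L (kl_remainder X S \<phi> n \<omega>) u)\<^sup>2 \<partial>P) = (\<integral>\<omega>. (?W \<omega> - (\<Sum>k<n. \<xi> k \<omega> * L (\<phi> k) u))\<^sup>2 \<partial>P)" for n
      using rem by (intro Bochner_Integration.integral_cong) auto
    have "(\<lambda>n. \<integral>\<omega>. (L (kl_remainder X S \<phi> n \<omega>) u)\<^sup>2 \<partial>P) \<longlonglongrightarrow> 0"
      using kl u by (simp add: kl_continuous_def)
    then show ?thesis unfolding L2_conv_def eq .
  qed
  from Z_orthogonal_limit[OF u W this] have o: "(\<integral>\<omega>. ?W \<omega> * Z \<omega> u \<partial>P) = 0" .
  let ?D = "\<lambda>\<omega>. ?W \<omega> - R \<omega> u"
  have D: "sq_integrable P ?D" by (intro sq_integrable_diff W sq_R u)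
  have "(\<integral>\<omega>. Z \<omega> u * ?D \<omega> \<partial>P) = (\<integral>\<omega>. ?W \<omega> * Z \<omega> u - R \<omega> u * Z \<omega> u \<partial>P)"
    by (simp add: algebra_simps)
  also have "\<dots> = 0"
    using sq_integrable_times[OF W sq_Z[OF u]] sq_integrable_times[OF sq_R[OF u] sq_Z[OF u]]
    by (simp add: o Z_orthogonal_R[OF u])
  finally have ZD: "(\<integral>\<omega>. Z \<omega> u * ?D \<omega> \<partial>P) = 0" .
  have "(\<integral>\<omega>. (X \<omega> u - ?W \<omega>)\<^sup>2 \<partial>P) = (\<integral>\<omega>. (Z \<omega> u - 1 * ?D \<omega>)\<^sup>2 \<partial>P)"
    by (simp add: Z_def)
  also have "\<dots> = (\<integral>\<omega>. (Z \<omega> u)\<^sup>2 \<partial>P) + (\<integral>\<omega>. (?D \<omega>)\<^sup>2 \<partial>P)"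
    unfolding integral_square_diff[OF sq_Z[OF u] D] by (simp add: ZD)
  finally show ?thesis by simp
qed

end

section \<open>Measures determined by characteristic functions\<close>

text \<open>The case \<open>t = 0\<close> says that the total masses agree. After division by them, the uniqueness theorem
  for probability distributions applies.\<close>

lemma finite_measure_char_unique:
  fixes f :: "'a \<Rightarrow> real" and g :: "'b \<Rightarrow> real"
  assumes "finite_measure M" "finite_measure N"
    and [measurable]: "f \<in> borel_measurable M" "g \<in> borel_measurable N"
    and eq: "\<And>t. (\<integral>x. cis (t * f x) \<partial>M) = (\<integral>x. cis (t * g x) \<partial>N)"
    and B [measurable]: "B \<in> sets borel"
  shows "measure M {x \<in> space M. f x \<in> B} = measure N {x \<in> space N. g x \<in> B}"
proof -
  interpret M: finite_measure M by fact
  interpret N: finite_measure N by fact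
  have mass: "measure M (space M) = measure N (space N)"
    using eq[of 0] by (simp add: complex_eq_iff)
  show ?thesis
  proof (cases "measure M (space M) = 0")
    case True
    have "measure M {x \<in> space M. f x \<in> B} \<le> measure M (space M)" by (intro M.finite_measure_mono) auto
    moreover have "measure N {x \<in> space N. g x \<in> B} \<le> measure N (space N)" by (intro N.finite_measure_mono) auto
    ultimately show ?thesis using True mass by (metis antisym measure_nonneg)
  next
    case False
    define m where "m = measure M (space M)"
    have m: "0 < m" using False by (simp add: m_def less_le measure_nonneg)
    have scale: "real_distribution (scale_measure (ennreal (1 / m)) (distr M' borel h)) \<and>
       char (scale_measure (ennreal (1 / m)) (distr M' borel h)) t = (1 / m) *\<^sub>R (\<integral>x. cis (t * h x) \<partial>M') \<and>
       measure (scale_measure (ennreal (1 / m)) (distr M' borel h)) B = measure M' {x \<in> space M'. h x \<in> B} / m"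
      if M': "finite_measure M'" and [measurable]: "h \<in> borel_measurable M'" and mm: "measure M' (space M') = m"
      for M' :: "'c measure" and h :: "'c \<Rightarrow> real" and t
    proof (intro conjI)
      interpret finite_measure M' by fact
      have e: "emeasure M' (space M') = ennreal m" by (simp add: emeasure_eq_measure mm)
      show "real_distribution (scale_measure (ennreal (1 / m)) (distr M' borel h))"
      proof (intro real_distribution.intro prob_spaceI)
        show "emeasure (scale_measure (ennreal (1 / m)) (distr M' borel h))
            (space (scale_measure (ennreal (1 / m)) (distr M' borel h))) = 1"
          using m by (simp add: space_scale_measure emeasure_distr e ennreal_mult[symmetric])
      qed (auto simp: real_distribution_axioms_def space_scale_measure)
      have "scale_measure (ennreal (1 / m)) (distr M' borel h) = density (distr M' borel h) (\<lambda>_. ennreal (1 / m))"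
        by (rule measure_eqI) (auto simp: emeasure_density nn_integral_cmult_indicator)
      then show "char (scale_measure (ennreal (1 / m)) (distr M' borel h)) t = (1 / m) *\<^sub>R (\<integral>x. cis (t * h x) \<partial>M')"
        using m by (simp add: char_def integral_density integral_distr cis_conv_exp mult.commute)
      show "measure (scale_measure (ennreal (1 / m)) (distr M' borel h)) B = measure M' {x \<in> space M'. h x \<in> B} / m"
        using m by (simp add: measure_scale_measure measure_distr vimage_def Int_def conj_commute)
    qed
    have "scale_measure (ennreal (1 / m)) (distr M borel f) = scale_measure (ennreal (1 / m)) (distr N borel g)"
      using scale[of M f] scale[of N g] assms mass eq
      by (intro Levy_uniqueness) (auto simp: m_def)
    then show ?thesis using scale[of M f] scale[of N g] assms mass m by (auto simp: m_def)
  qed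
qed

text \<open>A weight \<open>u\<close> of absolute value at most 1 need not be positive, but \<open>1 + u\<close> is nonnegative and so
  is the density of a finite measure whose characteristic function is given by the two
  hypotheses. Subtracting the unweighted identity leaves the claim.\<close>

lemma integral_indicator_times_unique:
  fixes f u :: "'a \<Rightarrow> real" and g v :: "'b \<Rightarrow> real"
  assumes M: "finite_measure M" and N: "finite_measure N"
    and [measurable]: "f \<in> borel_measurable M" "u \<in> borel_measurable M"
      "g \<in> borel_measurable N" "v \<in> borel_measurable N"
    and u: "\<And>x. \<bar>u x\<bar> \<le> 1" and v: "\<And>x. \<bar>v x\<bar> \<le> 1"
    and eq: "\<And>t. (\<integral>x. cis (t * f x) \<partial>M) = (\<integral>x. cis (t * g x) \<partial>N)"
    and equ: "\<And>t. (\<integral>x. u x *\<^sub>R cis (t * f x) \<partial>M) = (\<integral>x. v x *\<^sub>R cis (t * g x) \<partial>N)"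
    and B [measurable]: "B \<in> sets borel"
  shows "(\<integral>x. indicator B (f x) * u x \<partial>M) = (\<integral>x. indicator B (g x) * v x \<partial>N)"
proof -
  have weight: "finite_measure (density M' (\<lambda>x. ennreal (1 + w x))) \<and>
      (\<integral>x. cis (t * h x) \<partial>density M' (\<lambda>x. ennreal (1 + w x))) = (\<integral>x. cis (t * h x) \<partial>M') + (\<integral>x. w x *\<^sub>R cis (t * h x) \<partial>M') \<and>
      measure (density M' (\<lambda>x. ennreal (1 + w x))) {x \<in> space M'. h x \<in> B} = measure M' {x \<in> space M'. h x \<in> B} + (\<integral>x. indicator B (h x) * w x \<partial>M')"
    if M': "finite_measure M'" and [measurable]: "h \<in> borel_measurable M'" "w \<in> borel_measurable M'" and w: "\<And>x. \<bar>w x\<bar> \<le> 1"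
    for M' :: "'c measure" and h w :: "'c \<Rightarrow> real" and t
  proof (intro conjI)
    interpret finite_measure M' by fact
    have w0: "0 \<le> 1 + w x" for x using w[of x] by linarith
    have i1: "integrable M' (\<lambda>x. cis (t * h x))"
      by (rule integrable_const_bound[where B=1]) (auto simp: cis_conv_exp)
    have iw: "integrable M' (\<lambda>x. w x *\<^sub>R cis (t * h x))"
      by (rule integrable_const_bound[where B=1]) (auto simp: w cis_conv_exp[symmetric], simp add: cis_conv_exp)
    have ib: "integrable M' (\<lambda>x. indicator B (h x) * w x)"
      by (rule integrable_const_bound[where B=1]) (auto simp: w indicator_def)
    have ib1: "integrable M' (\<lambda>x. indicator B (h x) :: real)"
      by (rule integrable_const_bound[where B=1]) (auto simp: indicator_def)
    have wi: "integrable M' w" by (rule integrable_const_bound[where B=1]) (auto simp: w)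
    show "finite_measure (density M' (\<lambda>x. ennreal (1 + w x)))"
    proof
      have "emeasure (density M' (\<lambda>x. ennreal (1 + w x))) (space M') = (\<integral>\<^sup>+x. ennreal (1 + w x) \<partial>M')"
        by (simp add: emeasure_density cong: nn_integral_cong)
      also have "\<dots> = ennreal (\<integral>x. 1 + w x \<partial>M')"
        using wi by (intro nn_integral_eq_integral) (auto simp: w0)
      finally show "emeasure (density M' (\<lambda>x. ennreal (1 + w x))) (space (density M' (\<lambda>x. ennreal (1 + w x)))) \<noteq> \<infinity>" by simp
    qed
    have "(\<integral>x. cis (t * h x) \<partial>density M' (\<lambda>x. ennreal (1 + w x))) = (\<integral>x. (1 + w x) *\<^sub>R cis (t * h x) \<partial>M')"
      by (rule integral_density) (auto simp: w0 cis_conv_exp)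
    also have "\<dots> = (\<integral>x. cis (t * h x) + w x *\<^sub>R cis (t * h x) \<partial>M')" by (simp add: scaleR_add_left)
    also have "\<dots> = (\<integral>x. cis (t * h x) \<partial>M') + (\<integral>x. w x *\<^sub>R cis (t * h x) \<partial>M')"
      by (rule Bochner_Integration.integral_add[OF i1 iw])
    finally show "(\<integral>x. cis (t * h x) \<partial>density M' (\<lambda>x. ennreal (1 + w x))) = (\<integral>x. cis (t * h x) \<partial>M') + (\<integral>x. w x *\<^sub>R cis (t * h x) \<partial>M')" .
    have "emeasure (density M' (\<lambda>x. ennreal (1 + w x))) {x \<in> space M'. h x \<in> B}
        = (\<integral>\<^sup>+x. ennreal (indicator B (h x) + indicator B (h x) * w x) \<partial>M')"
      by (subst emeasure_density) (auto simp: indicator_def intro!: nn_integral_cong)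
    also have "\<dots> = ennreal (\<integral>x. indicator B (h x) + indicator B (h x) * w x \<partial>M')"
      using ib ib1 by (intro nn_integral_eq_integral) (auto simp: w0 indicator_def)
    finally have "measure (density M' (\<lambda>x. ennreal (1 + w x))) {x \<in> space M'. h x \<in> B} = (\<integral>x. indicator B (h x) + indicator B (h x) * w x \<partial>M')"
      unfolding measure_def by (simp add: w0 indicator_def)
    also have "\<dots> = (\<integral>x. indicator B (h x) \<partial>M') + (\<integral>x. indicator B (h x) * w x \<partial>M')"
      by (rule Bochner_Integration.integral_add[OF ib1 ib])
    also have "(\<integral>x. indicator B (h x) \<partial>M') = (\<integral>x. indicator {x \<in> space M'. h x \<in> B} x \<partial>M')"
      by (intro Bochner_Integration.integral_cong) (auto simp: indicator_def)
    finally show "measure (density M' (\<lambda>x. ennreal (1 + w x))) {x \<in> space M'. h x \<in> B} = measure M' {x \<in> space M'. h x \<in> B} + (\<integral>x. indicator B (h x) * w x \<partial>M')"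
      by simp
  qed
  let ?Mu = "density M (\<lambda>x. ennreal (1 + u x))" and ?Nv = "density N (\<lambda>x. ennreal (1 + v x))"
  have "measure ?Mu {x \<in> space ?Mu. f x \<in> B} = measure ?Nv {x \<in> space ?Nv. g x \<in> B}"
  proof (rule finite_measure_char_unique)
    show "(\<integral>x. cis (t * f x) \<partial>?Mu) = (\<integral>x. cis (t * g x) \<partial>?Nv)" for t
      using weight[OF M, of f u t] weight[OF N, of g v t] u v eq[of t] equ[of t] by simp
  qed (use weight[OF M, of f u] weight[OF N, of g v] u v in auto)
  moreover have "measure M {x \<in> space M. f x \<in> B} = measure N {x \<in> space N. g x \<in> B}"
    by (rule finite_measure_char_unique[OF M N _ _ eq]) auto
  ultimately show ?thesis
    using weight[OF M, of f u] weight[OF N, of g v] u v by simp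
qed

text \<open>Induction on the number of coordinates. For a bounded weight depending on the other coordinates
  through \<open>cos V\<close> or \<open>sin V\<close>, the one-dimensional uniqueness theorem applies to the last coordinate,
  so that restricting both measures to an event of that coordinate preserves the hypothesis.\<close>

lemma Cramer_Wold_finite:
  fixes f :: "'i \<Rightarrow> 'a \<Rightarrow> real" and g :: "'i \<Rightarrow> 'b \<Rightarrow> real"
  assumes F: "finite F" and "finite_measure M" "finite_measure N"
    and "\<And>i. i \<in> F \<Longrightarrow> f i \<in> borel_measurable M" "\<And>i. i \<in> F \<Longrightarrow> g i \<in> borel_measurable N"
    and "\<And>c. (\<integral>x. cis (\<Sum>i\<in>F. c i * f i x) \<partial>M) = (\<integral>x. cis (\<Sum>i\<in>F. c i * g i x) \<partial>N)"
    and "\<And>i. i \<in> F \<Longrightarrow> B i \<in> sets borel"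
  shows "measure M {x \<in> space M. \<forall>i\<in>F. f i x \<in> B i} = measure N {x \<in> space N. \<forall>i\<in>F. g i x \<in> B i}"
  using assms
proof (induction F arbitrary: M N)
  case empty
  from empty(5)[of undefined] show ?case by (simp add: complex_eq_iff)
next
  case (insert j F M N)
  note M = insert.prems(1) and N = insert.prems(2)
  note [measurable] = insert.prems(3,4)[OF insertI1] insert.prems(3,4)[OF insertI2] insert.prems(6)[OF insertI1]
  interpret M: finite_measure M by fact
  interpret N: finite_measure N by fact
  let ?V = "\<lambda>c x. \<Sum>i\<in>F. c i * f i x" and ?W = "\<lambda>c x. \<Sum>i\<in>F. c i * g i x"
  have [measurable]: "?V c \<in> borel_measurable M" "?W c \<in> borel_measurable N" for c
    by (intro borel_measurable_sum borel_measurable_times borel_measurable_const insert.prems insertI2; assumption)+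
  have eq: "(\<integral>x. cis (t * f j x + ?V c x) \<partial>M) = (\<integral>x. cis (t * g j x + ?W c x) \<partial>N)" for t c
  proof -
    have upd: "(\<Sum>i\<in>insert j F. (c(j := t)) i * h i x) = t * h j x + (\<Sum>i\<in>F. c i * h i x)" for h :: "'i \<Rightarrow> 'c \<Rightarrow> real" and x
      using insert.hyps by (subst sum.insert) (auto intro!: sum.cong)
    show ?thesis using insert.prems(5)[of "c(j := t)"] unfolding upd .
  qed
  have neg: "?V (\<lambda>i. - c i) x = - ?V c x" "?W (\<lambda>i. - c i) y = - ?W c y" for c x y
    by (simp_all add: sum_negf)
  have eq': "(\<integral>x. cis (t * f j x - ?V c x) \<partial>M) = (\<integral>x. cis (t * g j x - ?W c x) \<partial>N)" for t c
    using eq[of t "\<lambda>i. - c i"] unfolding neg by simp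
  have eq0: "(\<integral>x. cis (t * f j x) \<partial>M) = (\<integral>x. cis (t * g j x) \<partial>N)" for t
    using eq[of t "\<lambda>_. 0"] by simp
  have iM: "integrable M (\<lambda>x. cis (h x))" if [measurable]: "h \<in> borel_measurable M" for h
    by (rule M.integrable_const_bound[where B=1]) (auto simp: cis_conv_exp)
  have iN: "integrable N (\<lambda>x. cis (h x))" if [measurable]: "h \<in> borel_measurable N" for h
    by (rule N.integrable_const_bound[where B=1]) (auto simp: cis_conv_exp)
  have cos_cis: "cos V *\<^sub>R cis p = (cis (p + V) + cis (p - V)) / 2" for V p
    by (simp add: complex_eq_iff cos_add sin_add cos_diff sin_diff)
  have sin_cis: "sin V *\<^sub>R cis p = (- \<i> / 2) * (cis (p + V) - cis (p - V))" for V p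
    by (simp add: complex_eq_iff cos_add sin_add cos_diff sin_diff)
  have c: "(\<integral>x. indicator (B j) (f j x) * cos (?V c x) \<partial>M) = (\<integral>x. indicator (B j) (g j x) * cos (?W c x) \<partial>N)" for c
  proof (rule integral_indicator_times_unique[OF M N _ _ _ _ _ _ eq0])
    show "(\<integral>x. cos (?V c x) *\<^sub>R cis (t * f j x) \<partial>M) = (\<integral>x. cos (?W c x) *\<^sub>R cis (t * g j x) \<partial>N)" for t
    proof -
      have "(\<integral>x. cos (?V c x) *\<^sub>R cis (t * f j x) \<partial>M)
          = ((\<integral>x. cis (t * f j x + ?V c x) \<partial>M) + (\<integral>x. cis (t * f j x - ?V c x) \<partial>M)) / 2"
        unfolding cos_cis integral_divide_zero
        by (subst Bochner_Integration.integral_add) (auto intro!: iM)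
      moreover have "(\<integral>x. cos (?W c x) *\<^sub>R cis (t * g j x) \<partial>N)
          = ((\<integral>x. cis (t * g j x + ?W c x) \<partial>N) + (\<integral>x. cis (t * g j x - ?W c x) \<partial>N)) / 2"
        unfolding cos_cis integral_divide_zero
        by (subst Bochner_Integration.integral_add) (auto intro!: iN)
      ultimately show ?thesis by (simp only: eq eq')
    qed
  qed auto
  have s: "(\<integral>x. indicator (B j) (f j x) * sin (?V c x) \<partial>M) = (\<integral>x. indicator (B j) (g j x) * sin (?W c x) \<partial>N)" for c
  proof (rule integral_indicator_times_unique[OF M N _ _ _ _ _ _ eq0])
    show "(\<integral>x. sin (?V c x) *\<^sub>R cis (t * f j x) \<partial>M) = (\<integral>x. sin (?W c x) *\<^sub>R cis (t * g j x) \<partial>N)" for t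
    proof -
      have "(\<integral>x. sin (?V c x) *\<^sub>R cis (t * f j x) \<partial>M)
          = (- \<i> / 2) * ((\<integral>x. cis (t * f j x + ?V c x) \<partial>M) - (\<integral>x. cis (t * f j x - ?V c x) \<partial>M))"
        unfolding sin_cis integral_mult_right_zero
        by (subst Bochner_Integration.integral_diff) (auto intro!: iM)
      moreover have "(\<integral>x. sin (?W c x) *\<^sub>R cis (t * g j x) \<partial>N)
          = (- \<i> / 2) * ((\<integral>x. cis (t * g j x + ?W c x) \<partial>N) - (\<integral>x. cis (t * g j x - ?W c x) \<partial>N))"
        unfolding sin_cis integral_mult_right_zero
        by (subst Bochner_Integration.integral_diff) (auto intro!: iN)
      ultimately show ?thesis by (simp only: eq eq')
    qed
  qed auto
  let ?M = "density M (\<lambda>x. ennreal (indicator (B j) (f j x)))" and ?N = "density N (\<lambda>x. ennreal (indicator (B j) (g j x)))"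
  have fin: "finite_measure (density M' (\<lambda>x. ennreal (indicator (B j) (h x))))"
    if "finite_measure M'" and [measurable]: "h \<in> borel_measurable M'" for M' :: "'c measure" and h :: "'c \<Rightarrow> real"
  proof
    interpret finite_measure M' by fact
    have "emeasure (density M' (\<lambda>x. ennreal (indicator (B j) (h x)))) (space M')
        = (\<integral>\<^sup>+x. ennreal (indicator (B j) (h x)) * indicator (space M') x \<partial>M')"
      by (rule emeasure_density) auto
    also have "\<dots> \<le> (\<integral>\<^sup>+x. 1 \<partial>M')"
      by (rule nn_integral_mono) (simp add: indicator_def)
    finally show "emeasure (density M' (\<lambda>x. ennreal (indicator (B j) (h x)))) (space (density M' (\<lambda>x. ennreal (indicator (B j) (h x))))) \<noteq> \<infinity>"
      by (auto simp: top_unique)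
  qed
  have split: "(\<integral>x. cis (h x) \<partial>density M' (\<lambda>x. ennreal (indicator (B j) (k x))))
      = Complex (\<integral>x. indicator (B j) (k x) * cos (h x) \<partial>M') (\<integral>x. indicator (B j) (k x) * sin (h x) \<partial>M')"
    if "finite_measure M'" and [measurable]: "h \<in> borel_measurable M'" "k \<in> borel_measurable M'" for M' :: "'c measure" and h k :: "'c \<Rightarrow> real"
  proof -
    interpret finite_measure M' by fact
    have "(\<integral>x. cis (h x) \<partial>density M' (\<lambda>x. ennreal (indicator (B j) (k x)))) = (\<integral>x. indicator (B j) (k x) *\<^sub>R cis (h x) \<partial>M')"
      by (rule integral_density) (auto simp: cis_conv_exp)
    moreover have "integrable M' (\<lambda>x. indicator (B j) (k x) *\<^sub>R cis (h x))"
      by (rule integrable_const_bound[where B=1]) (auto simp: cis_conv_exp indicator_def)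
    ultimately show ?thesis
      by (simp add: complex_eq_iff integral_Re[symmetric] integral_Im[symmetric] del: integral_Re integral_Im)
  qed
  have eqm: "measure ?M {x \<in> space ?M. \<forall>i\<in>F. f i x \<in> B i} = measure ?N {x \<in> space ?N. \<forall>i\<in>F. g i x \<in> B i}"
  proof (rule insert.IH)
    show "finite_measure ?M" "finite_measure ?N" by (auto intro!: fin M N)
    show "f i \<in> borel_measurable ?M" "g i \<in> borel_measurable ?N" "B i \<in> sets borel" if "i \<in> F" for i
      using insert.prems(3,4,6)[of i] that by auto
    show "(\<integral>x. cis (?V c x) \<partial>?M) = (\<integral>x. cis (?W c x) \<partial>?N)" for c
      by (simp add: split[OF M] split[OF N] c s)
  qed
  have restr: "measure (density M' (\<lambda>x. ennreal (indicator (B j) (h j x)))) {x \<in> space M'. \<forall>i\<in>F. h i x \<in> B i}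
      = measure M' {x \<in> space M'. \<forall>i\<in>insert j F. h i x \<in> B i}"
    if h: "\<And>i. i \<in> insert j F \<Longrightarrow> h i \<in> borel_measurable M'" for M' :: "'c measure" and h :: "'i \<Rightarrow> 'c \<Rightarrow> real"
  proof -
    note [measurable] = h[OF insertI1]
    have [measurable]: "{x \<in> space M'. \<forall>i\<in>F. h i x \<in> B i} \<in> sets M'"
      using h insert.prems(6) insert.hyps(1)
      by (intro sets.sets_Collect_finite_All) (auto intro: measurable_sets_Collect)
    have "emeasure (density M' (\<lambda>x. ennreal (indicator (B j) (h j x)))) {x \<in> space M'. \<forall>i\<in>F. h i x \<in> B i}
        = (\<integral>\<^sup>+x. ennreal (indicator (B j) (h j x)) * indicator {x \<in> space M'. \<forall>i\<in>F. h i x \<in> B i} x \<partial>M')"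
      by (rule emeasure_density) auto
    also have "\<dots> = (\<integral>\<^sup>+x. indicator {x \<in> space M'. \<forall>i\<in>insert j F. h i x \<in> B i} x \<partial>M')"
      by (rule nn_integral_cong) (simp add: indicator_def)
    also have "\<dots> = emeasure M' {x \<in> space M'. \<forall>i\<in>insert j F. h i x \<in> B i}"
    proof (rule nn_integral_indicator)
      have "{x \<in> space M'. \<forall>i\<in>insert j F. h i x \<in> B i} = {x \<in> space M'. h j x \<in> B j} \<inter> {x \<in> space M'. \<forall>i\<in>F. h i x \<in> B i}" by auto
      also have "\<dots> \<in> sets M'" by measurable
      finally show "{x \<in> space M'. \<forall>i\<in>insert j F. h i x \<in> B i} \<in> sets M'" .
    qed
    finally show ?thesis by (simp add: measure_def)
  qed
  show ?case using eqm restr[of f M] restr[of g N] insert.prems(3,4) by simp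
qed

text \<open>A measure on a product of real lines, with any number of factors, is determined by its
  finite-dimensional rectangles.\<close>

lemma Cramer_Wold:
  assumes M: "finite_measure M" "sets M = sets (Pi\<^sub>M I (\<lambda>_. borel :: real measure))"
    and N: "finite_measure N" "sets N = sets (Pi\<^sub>M I (\<lambda>_. borel))"
    and eq: "\<And>F c. finite F \<Longrightarrow> F \<subseteq> I \<Longrightarrow>
      (\<integral>x. cis (\<Sum>i\<in>F. c i * x i) \<partial>M) = (\<integral>x. cis (\<Sum>i\<in>F. c i * x i) \<partial>N)"
  shows "M = N"
proof (rule measure_eqI_PiM_infinite[OF M(2) N(2) _ M(1)])
  fix A F assume F: "finite F" "F \<subseteq> I" and A: "\<And>i. i \<in> F \<Longrightarrow> A i \<in> sets (borel :: real measure)"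
  interpret M: finite_measure M by fact
  interpret N: finite_measure N by fact
  have sp: "space M = space (Pi\<^sub>M I (\<lambda>_. borel :: real measure))" "space N = space (Pi\<^sub>M I (\<lambda>_. borel :: real measure))"
    using M(2) N(2) by (auto dest: sets_eq_imp_space_eq)
  have e: "prod_emb I (\<lambda>_. borel) F (Pi\<^sub>E F A) = {x \<in> space (Pi\<^sub>M I (\<lambda>_. borel)). \<forall>i\<in>F. x i \<in> A i}"
    using F(2) by (auto simp: prod_emb_def space_PiM PiE_def restrict_def extensional_def Pi_iff)
  have mM: "(\<lambda>x. x i) \<in> borel_measurable M" "(\<lambda>x. x i) \<in> borel_measurable N" if "i \<in> F" for i
    using that F(2) by (auto simp: measurable_cong_sets[OF M(2) refl] measurable_cong_sets[OF N(2) refl] intro!: measurable_component_singleton)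
  have "measure M {x \<in> space M. \<forall>i\<in>F. x i \<in> A i} = measure N {x \<in> space N. \<forall>i\<in>F. x i \<in> A i}"
    by (rule Cramer_Wold_finite[OF F(1) M(1) N(1)]) (use mM A eq[OF F] in auto)
  then show "emeasure M (prod_emb I (\<lambda>_. borel) F (Pi\<^sub>E F A)) = emeasure N (prod_emb I (\<lambda>_. borel) F (Pi\<^sub>E F A))"
    unfolding e by (simp add: sp M.emeasure_eq_measure N.emeasure_eq_measure)
qed

section \<open>Disintegration of a prediction with independent error\<close>

text \<open>Every open half-line is the increasing union of half-lines with rational end points; taking minima
  makes an approximating sequence of end points decreasing.\<close>

lemma borel_measure_eqI_rational:
  fixes M N :: "real measure"
  assumes M: "finite_measure M" "sets M = sets borel" and N: "finite_measure N" "sets N = sets borel"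
    and eq: "\<And>q. q \<in> \<rat> \<Longrightarrow> emeasure M {q<..} = emeasure N {q<..}"
  shows "M = N"
proof (rule measure_eqI_lessThan[OF M(2) N(2)])
  interpret M: finite_measure M by fact
  interpret N: finite_measure N by fact
  show "emeasure M {x<..} < \<infinity>" for x by (simp add: M.emeasure_eq_measure)
  fix x :: real
  have "\<exists>q. \<forall>n::nat. q n \<in> \<rat> \<and> x < q n \<and> q n < x + 1 / Suc n"
    by (intro choice allI) (use Rats_dense_in_real[of x] in \<open>simp add: Bex_def\<close>)
  then obtain q where q: "\<And>n. q n \<in> \<rat>" "\<And>n. x < q n" "\<And>n. q n < x + 1 / Suc n" by blast
  have q_lim: "q \<longlonglongrightarrow> x"
  proof (rule tendsto_sandwich[of "\<lambda>_. x" _ _ "\<lambda>n. x + 1 / Suc n"])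
    have "(\<lambda>n. x + 1 / Suc n) \<longlonglongrightarrow> x + 0" by (intro tendsto_intros LIMSEQ_Suc[OF lim_1_over_n])
    then show "(\<lambda>n. x + 1 / Suc n) \<longlonglongrightarrow> x" by simp
  qed (use q in \<open>auto intro!: always_eventually less_imp_le\<close>)
  define m where "m n = Min (q ` {..n})" for n
  have m_in: "m n \<in> q ` {..n}" for n unfolding m_def by (rule Min_in) auto
  have m: "m n \<in> \<rat>" "x < m n" "m n \<le> q n" for n
  proof -
    obtain k where "m n = q k" using m_in[of n] by blast
    then show "m n \<in> \<rat>" "x < m n" using q by simp_all
    show "m n \<le> q n" unfolding m_def by (rule Min_le) auto
  qed
  have "m (Suc n) \<le> m n" for n
    unfolding m_def by (rule Min_antimono) auto
  then have inc: "incseq (\<lambda>n. {m n<..})" by (intro incseq_SucI) force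
  have un: "(\<Union>n. {m n<..}) = {x<..}"
  proof (intro equalityI subsetI)
    fix y assume "y \<in> (\<Union>n. {m n<..})"
    then obtain n where "m n < y" by blast
    then show "y \<in> {x<..}" using m(2)[of n] by simp
  next
    fix y assume "y \<in> {x<..}"
    then have "\<forall>\<^sub>F n in sequentially. q n < y" using order_tendstoD(2)[OF q_lim] by auto
    then obtain n where "q n < y" by (auto simp: eventually_sequentially)
    then show "y \<in> (\<Union>n. {m n<..})" using m(3)[of n] by (intro UN_I[of n]) auto
  qed
  have sets: "range (\<lambda>n. {m n<..}) \<subseteq> sets M" "range (\<lambda>n. {m n<..}) \<subseteq> sets N"
    by (auto simp: M(2) N(2))
  have "emeasure M {x<..} = (SUP n. emeasure M {m n<..})"
    unfolding un[symmetric] by (rule SUP_emeasure_incseq[OF sets(1) inc, symmetric])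
  also have "\<dots> = (SUP n. emeasure N {m n<..})" by (intro SUP_cong refl eq m(1))
  also have "\<dots> = emeasure N {x<..}"
    unfolding un[symmetric] by (rule SUP_emeasure_incseq[OF sets(2) inc])
  finally show "emeasure M {x<..} = emeasure N {x<..}" .
qed

text \<open>Here \<open>\<mu>\<close> is the law of an observation \<open>x\<close>, \<open>r x\<close> a prediction, and \<open>\<nu>\<close> the law of an error \<open>z\<close>
  independent of the observation. Given \<open>x\<close>, the target \<open>r x + z\<close> has the law \<open>\<kappa> x\<close>, and \<open>\<tau>\<close> is the
  joint law of observation and target.\<close>

locale shift_kernel = mu: prob_space \<mu> + nu: prob_space \<nu>
  for \<mu> :: "'x measure" and \<nu> :: "real measure" +
  fixes N :: "'x measure" and r :: "'x \<Rightarrow> real"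
  assumes sets_mu [measurable_cong]: "sets \<mu> = sets N" and sets_nu [measurable_cong]: "sets \<nu> = sets borel"
    and r [measurable]: "r \<in> borel_measurable N"
begin

definition \<kappa> :: "'x \<Rightarrow> real measure" where
  "\<kappa> x = distr \<nu> borel (\<lambda>z. r x + z)"

definition \<tau> :: "('x \<times> real) measure" where
  "\<tau> = distr (\<mu> \<Otimes>\<^sub>M \<nu>) (N \<Otimes>\<^sub>M borel) (\<lambda>(x, z). (x, r x + z))"

lemma sets_tau [measurable_cong]: "sets \<tau> = sets (N \<Otimes>\<^sub>M borel)"
  by (simp add: \<tau>_def)

lemma kernel_measurable: "\<kappa> \<in> N \<rightarrow>\<^sub>M prob_algebra borel"
  unfolding \<kappa>_def
proof (rule measurable_distr_prob_space2)
  show "(\<lambda>x. \<nu>) \<in> N \<rightarrow>\<^sub>M prob_algebra borel"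
    by (intro measurable_const) (simp add: space_prob_algebra sets_nu nu.prob_space_axioms)
qed measurable

lemma prob_kernel: "prob_space (\<kappa> x)"
  unfolding \<kappa>_def by (rule nu.prob_space_distr) measurable

lemma sets_kernel [measurable_cong]: "sets (\<kappa> x) = sets borel"
  by (simp add: \<kappa>_def)

lemma nn_integral_kernel:
  assumes [measurable]: "f \<in> borel_measurable borel"
  shows "(\<integral>\<^sup>+y. f y \<partial>\<kappa> x) = (\<integral>\<^sup>+z. f (r x + z) \<partial>\<nu>)"
  unfolding \<kappa>_def by (rule nn_integral_distr) measurable

lemma prob_tau: "prob_space \<tau>"
proof -
  interpret pair_prob_space \<mu> \<nu> ..
  show ?thesis unfolding \<tau>_def by (rule prob_space_distr) measurable
qed

lemma nn_integral_tau:
  assumes [measurable]: "f \<in> borel_measurable (N \<Otimes>\<^sub>M borel)"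
  shows "(\<integral>\<^sup>+p. f p \<partial>\<tau>) = (\<integral>\<^sup>+x. \<integral>\<^sup>+z. f (x, r x + z) \<partial>\<nu> \<partial>\<mu>)"
proof -
  interpret pair_prob_space \<mu> \<nu> ..
  have "(\<integral>\<^sup>+p. f p \<partial>\<tau>) = (\<integral>\<^sup>+p. f ((\<lambda>(x, z). (x, r x + z)) p) \<partial>(\<mu> \<Otimes>\<^sub>M \<nu>))"
    unfolding \<tau>_def by (rule nn_integral_distr) measurable
  also have "\<dots> = (\<integral>\<^sup>+x. \<integral>\<^sup>+z. f (x, r x + z) \<partial>\<nu> \<partial>\<mu>)"
    by (subst nu.nn_integral_fst[symmetric]) (auto simp: case_prod_unfold)
  finally show ?thesis .
qed

lemma tau_Times:
  assumes A: "A \<in> sets N" and B: "B \<in> sets borel"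
  shows "emeasure \<tau> (A \<times> B) = (\<integral>\<^sup>+x. emeasure (\<kappa> x) B * indicator A x \<partial>\<mu>)"
proof -
  note [measurable] = A B
  have "emeasure \<tau> (A \<times> B) = (\<integral>\<^sup>+p. indicator (A \<times> B) p \<partial>\<tau>)"
    by (simp add: sets_tau)
  also have "\<dots> = (\<integral>\<^sup>+x. \<integral>\<^sup>+z. indicator (A \<times> B) (x, r x + z) \<partial>\<nu> \<partial>\<mu>)"
    by (rule nn_integral_tau) measurable
  also have "\<dots> = (\<integral>\<^sup>+x. (\<integral>\<^sup>+y. indicator B y \<partial>\<kappa> x) * indicator A x \<partial>\<mu>)"
  proof (rule nn_integral_cong)
    fix x
    have "(\<integral>\<^sup>+z. indicator (A \<times> B) (x, r x + z) \<partial>\<nu>) = (\<integral>\<^sup>+z. indicator B (r x + z) * indicator A x \<partial>\<nu>)"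
      by (rule nn_integral_cong) (auto simp: indicator_def)
    also have "\<dots> = (\<integral>\<^sup>+z. indicator B (r x + z) \<partial>\<nu>) * indicator A x"
      by (rule nn_integral_multc) measurable
    finally show "(\<integral>\<^sup>+z. indicator (A \<times> B) (x, r x + z) \<partial>\<nu>) = (\<integral>\<^sup>+y. indicator B y \<partial>\<kappa> x) * indicator A x"
      unfolding nn_integral_kernel[OF borel_measurable_indicator[OF B]] .
  qed
  finally show ?thesis by (simp add: sets_kernel)
qed

text \<open>For each half-line with rational end point the two kernels have the same integrals over all sets of
  observations. There are countably many such half-lines, so outside one null set the kernels agree
  on all of them.\<close>

lemma kernel_unique:
  assumes K: "K \<in> N \<rightarrow>\<^sub>M prob_algebra borel"
    and dis: "\<And>A B. A \<in> sets N \<Longrightarrow> B \<in> sets borel \<Longrightarrow>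
      emeasure \<tau> (A \<times> B) = (\<integral>\<^sup>+x. emeasure (K x) B * indicator A x \<partial>\<mu>)"
  shows "AE x in \<mu>. K x = \<kappa> x"
proof -
  have meas: "(\<lambda>x. emeasure (K' x) B) \<in> borel_measurable \<mu>"
    if K': "K' \<in> N \<rightarrow>\<^sub>M prob_algebra borel" and B: "B \<in> sets borel" for K' and B :: "real set"
    using measurable_emeasure_kernel[OF measurable_prob_algebraD[OF K'] B]
    by (simp add: measurable_cong_sets[OF sets_mu refl])
  have "AE x in \<mu>. emeasure (K x) {q<..} = emeasure (\<kappa> x) {q<..}" for q
  proof (rule mu.density_unique_finite_measure)
    fix A assume "A \<in> sets \<mu>"
    then have A: "A \<in> sets N" by (simp add: sets_mu)
    show "(\<integral>\<^sup>+x. emeasure (K x) {q<..} * indicator A x \<partial>\<mu>) = (\<integral>\<^sup>+x. emeasure (\<kappa> x) {q<..} * indicator A x \<partial>\<mu>)"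
      using dis[OF A, of "{q<..}"] tau_Times[OF A, of "{q<..}"] by simp
  qed (use meas[OF K] meas[OF kernel_measurable] in auto)
  then have "AE x in \<mu>. \<forall>q\<in>\<rat>. emeasure (K x) {q<..} = emeasure (\<kappa> x) {q<..}"
    by (simp add: AE_ball_countable countable_rat)
  then show ?thesis
    using AE_space
  proof eventually_elim
    case (elim x)
    then have "K x \<in> space (prob_algebra borel)"
      using measurable_space[OF K] sets_eq_imp_space_eq[OF sets_mu] by blast
    then have K: "prob_space (K x)" "sets (K x) = sets borel" by (auto simp: space_prob_algebra)
    show "K x = \<kappa> x"
      by (rule borel_measure_eqI_rational)
        (use K elim prob_kernel[of x] sets_kernel[of x] in \<open>auto intro: prob_space.finite_measure\<close>)
  qed
qed

lemma pair_kernel_measurable: "(\<lambda>(x1, x2). \<kappa> x1 \<Otimes>\<^sub>M \<kappa> x2) \<in> N \<Otimes>\<^sub>M N \<rightarrow>\<^sub>M prob_algebra (borel \<Otimes>\<^sub>M borel)"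
proof -
  note kernel_measurable[measurable]
  show ?thesis by measurable
qed

lemma emeasure_pair_kernel:
  assumes [measurable]: "B \<in> sets (borel \<Otimes>\<^sub>M borel)"
  shows "emeasure (\<kappa> x1 \<Otimes>\<^sub>M \<kappa> x2) B = (\<integral>\<^sup>+z1. \<integral>\<^sup>+z2. indicator B (r x1 + z1, r x2 + z2) \<partial>\<nu> \<partial>\<nu>)"
proof -
  interpret k2: prob_space "\<kappa> x2" by (rule prob_kernel)
  have B: "B \<in> sets (\<kappa> x1 \<Otimes>\<^sub>M \<kappa> x2)"
    using assms by (simp add: sets_pair_measure_cong[OF sets_kernel sets_kernel])
  have "emeasure (\<kappa> x1 \<Otimes>\<^sub>M \<kappa> x2) B = (\<integral>\<^sup>+y1. \<integral>\<^sup>+y2. indicator B (y1, y2) \<partial>\<kappa> x2 \<partial>\<kappa> x1)"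
    by (rule k2.emeasure_pair_measure[OF B])
  also have "\<dots> = (\<integral>\<^sup>+y1. \<integral>\<^sup>+z2. indicator B (y1, r x2 + z2) \<partial>\<nu> \<partial>\<kappa> x1)"
    by (intro nn_integral_cong nn_integral_kernel) measurable
  also have "\<dots> = (\<integral>\<^sup>+z1. \<integral>\<^sup>+z2. indicator B (r x1 + z1, r x2 + z2) \<partial>\<nu> \<partial>\<nu>)"
    by (rule nn_integral_kernel) measurable
  finally show ?thesis .
qed

text \<open>The law of two independent pairs disintegrates into the product of the two kernels; the only
  step that is not a change of variables exchanges the second observed part with the first error.\<close>

lemma pair_disintegration:
  assumes [measurable]: "A \<in> sets (N \<Otimes>\<^sub>M N)" "B \<in> sets (borel \<Otimes>\<^sub>M borel)"
  shows "emeasure (\<tau> \<Otimes>\<^sub>M \<tau>) {p \<in> space (\<tau> \<Otimes>\<^sub>M \<tau>). (fst (fst p), fst (snd p)) \<in> A \<and> (snd (fst p), snd (snd p)) \<in> B}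
    = (\<integral>\<^sup>+p. emeasure (\<kappa> (fst p) \<Otimes>\<^sub>M \<kappa> (snd p)) B * indicator A p \<partial>(\<mu> \<Otimes>\<^sub>M \<mu>))"
proof -
  interpret tau: prob_space \<tau> by (rule prob_tau)
  interpret mn: pair_prob_space \<mu> \<nu> ..
  let ?I = "\<lambda>x1 x2 y1 y2. indicator A (x1, x2) * indicator B (y1, y2) :: ennreal"
  let ?E = "{p \<in> space (\<tau> \<Otimes>\<^sub>M \<tau>). (fst (fst p), fst (snd p)) \<in> A \<and> (snd (fst p), snd (snd p)) \<in> B}"
  have E: "?E \<in> sets (\<tau> \<Otimes>\<^sub>M \<tau>)" by measurable
  have "emeasure (\<tau> \<Otimes>\<^sub>M \<tau>) ?E = (\<integral>\<^sup>+p. \<integral>\<^sup>+q. indicator ?E (p, q) \<partial>\<tau> \<partial>\<tau>)"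
    by (rule tau.emeasure_pair_measure[OF E])
  also have "\<dots> = (\<integral>\<^sup>+p. \<integral>\<^sup>+q. ?I (fst p) (fst q) (snd p) (snd q) \<partial>\<tau> \<partial>\<tau>)"
    by (intro nn_integral_cong) (auto simp: indicator_def space_pair_measure)
  also have "\<dots> = (\<integral>\<^sup>+p. \<integral>\<^sup>+x2. \<integral>\<^sup>+z2. ?I (fst p) x2 (snd p) (r x2 + z2) \<partial>\<nu> \<partial>\<mu> \<partial>\<tau>)"
    by (intro nn_integral_cong, subst nn_integral_tau) (auto simp: sets_eq_imp_space_eq[OF sets_tau] space_pair_measure)
  also have "\<dots> = (\<integral>\<^sup>+x1. \<integral>\<^sup>+z1. \<integral>\<^sup>+x2. \<integral>\<^sup>+z2. ?I x1 x2 (r x1 + z1) (r x2 + z2) \<partial>\<nu> \<partial>\<mu> \<partial>\<nu> \<partial>\<mu>)"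
    by (subst nn_integral_tau) auto
  also have "\<dots> = (\<integral>\<^sup>+x1. \<integral>\<^sup>+x2. \<integral>\<^sup>+z1. \<integral>\<^sup>+z2. ?I x1 x2 (r x1 + z1) (r x2 + z2) \<partial>\<nu> \<partial>\<nu> \<partial>\<mu> \<partial>\<mu>)"
  proof (rule nn_integral_cong)
    fix x1 assume "x1 \<in> space \<mu>"
    then have [measurable]: "x1 \<in> space N" by (simp add: sets_eq_imp_space_eq[OF sets_mu])
    show "(\<integral>\<^sup>+z1. \<integral>\<^sup>+x2. \<integral>\<^sup>+z2. ?I x1 x2 (r x1 + z1) (r x2 + z2) \<partial>\<nu> \<partial>\<mu> \<partial>\<nu>)
        = (\<integral>\<^sup>+x2. \<integral>\<^sup>+z1. \<integral>\<^sup>+z2. ?I x1 x2 (r x1 + z1) (r x2 + z2) \<partial>\<nu> \<partial>\<nu> \<partial>\<mu>)"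
      by (rule mn.Fubini') measurable
  qed
  also have "\<dots> = (\<integral>\<^sup>+x1. \<integral>\<^sup>+x2. emeasure (\<kappa> x1 \<Otimes>\<^sub>M \<kappa> x2) B * indicator A (x1, x2) \<partial>\<mu> \<partial>\<mu>)"
  proof (intro nn_integral_cong)
    fix x1 x2
    have "(\<integral>\<^sup>+z1. \<integral>\<^sup>+z2. ?I x1 x2 (r x1 + z1) (r x2 + z2) \<partial>\<nu> \<partial>\<nu>)
        = (\<integral>\<^sup>+z1. indicator A (x1, x2) * (\<integral>\<^sup>+z2. indicator B (r x1 + z1, r x2 + z2) \<partial>\<nu>) \<partial>\<nu>)"
      by (intro nn_integral_cong nn_integral_cmult) measurable
    also have "\<dots> = indicator A (x1, x2) * (\<integral>\<^sup>+z1. \<integral>\<^sup>+z2. indicator B (r x1 + z1, r x2 + z2) \<partial>\<nu> \<partial>\<nu>)"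
      by (intro nn_integral_cmult) measurable
    finally show "(\<integral>\<^sup>+z1. \<integral>\<^sup>+z2. ?I x1 x2 (r x1 + z1) (r x2 + z2) \<partial>\<nu> \<partial>\<nu>) = emeasure (\<kappa> x1 \<Otimes>\<^sub>M \<kappa> x2) B * indicator A (x1, x2)"
      by (simp add: emeasure_pair_kernel mult.commute)
  qed
  also have "\<dots> = (\<integral>\<^sup>+p. emeasure (\<kappa> (fst p) \<Otimes>\<^sub>M \<kappa> (snd p)) B * indicator A p \<partial>(\<mu> \<Otimes>\<^sub>M \<mu>))"
  proof -
    have "(\<lambda>p. emeasure ((\<lambda>(x1, x2). \<kappa> x1 \<Otimes>\<^sub>M \<kappa> x2) p) B) \<in> borel_measurable (N \<Otimes>\<^sub>M N)"
      by (rule measurable_emeasure_kernel[OF measurable_prob_algebraD[OF pair_kernel_measurable]]) measurable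
    then have [measurable]: "(\<lambda>p. emeasure (\<kappa> (fst p) \<Otimes>\<^sub>M \<kappa> (snd p)) B) \<in> borel_measurable (\<mu> \<Otimes>\<^sub>M \<mu>)"
      by (simp add: case_prod_unfold measurable_cong_sets[OF sets_pair_measure_cong[OF sets_mu sets_mu] refl])
    show ?thesis by (subst mu.nn_integral_fst[symmetric]) (auto simp: sets_pair_measure_cong[OF sets_mu sets_mu])
  qed
  finally show ?thesis .
qed

text \<open>Both coordinates are shifted by the same prediction, which cancels.\<close>

lemma pair_kernel_sq_diff:
  "(\<integral>\<^sup>+y. ennreal ((fst y - snd y)\<^sup>2) \<partial>(\<kappa> x \<Otimes>\<^sub>M \<kappa> x)) = (\<integral>\<^sup>+z1. \<integral>\<^sup>+z2. ennreal ((z1 - z2)\<^sup>2) \<partial>\<nu> \<partial>\<nu>)"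
proof -
  interpret k: prob_space "\<kappa> x" by (rule prob_kernel)
  have "(\<integral>\<^sup>+y. ennreal ((fst y - snd y)\<^sup>2) \<partial>(\<kappa> x \<Otimes>\<^sub>M \<kappa> x)) = (\<integral>\<^sup>+y1. \<integral>\<^sup>+y2. ennreal ((y1 - y2)\<^sup>2) \<partial>\<kappa> x \<partial>\<kappa> x)"
    by (subst k.nn_integral_fst[symmetric]) auto
  also have "\<dots> = (\<integral>\<^sup>+y1. \<integral>\<^sup>+z2. ennreal ((y1 - (r x + z2))\<^sup>2) \<partial>\<nu> \<partial>\<kappa> x)"
    by (intro nn_integral_cong nn_integral_kernel) measurable
  also have "\<dots> = (\<integral>\<^sup>+z1. \<integral>\<^sup>+z2. ennreal ((r x + z1 - (r x + z2))\<^sup>2) \<partial>\<nu> \<partial>\<nu>)"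
    by (rule nn_integral_kernel) measurable
  finally show ?thesis by simp
qed

end

lemma norm_cis_diff_le: "norm (cis x - cis y) \<le> \<bar>x - y\<bar>"
proof -
  have "cis x - cis y = cis y * (cis (x - y) - 1)"
    by (simp add: cis_mult right_diff_distrib)
  then have "norm (cis x - cis y) = norm (cis (x - y) - 1)" by (simp add: norm_mult)
  also have "\<dots> \<le> \<bar>x - y\<bar>" using iexp_approx1[of "x - y" 0] by (simp add: cis_conv_exp)
  finally show ?thesis .
qed

context observed_process
begin

section \<open>Linear combinations of finitely many values\<close>

definition combination :: "real set \<Rightarrow> ('w \<Rightarrow> real) \<Rightarrow> bool" where
  "combination D W \<longleftrightarrow> (\<exists>F c. finite F \<and> F \<subseteq> D \<and> W = (\<lambda>\<omega>. \<Sum>t\<in>F. c t * X \<omega> t))"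

lemma combination_X: "t \<in> D \<Longrightarrow> combination D (\<lambda>\<omega>. X \<omega> t)"
  unfolding combination_def by (intro exI[of _ "{t}"] exI[of _ "\<lambda>_. 1"]) simp

lemma combination_cmult: "combination D W \<Longrightarrow> combination D (\<lambda>\<omega>. k * W \<omega>)"
proof -
  assume "combination D W"
  then obtain F c where "finite F" "F \<subseteq> D" "W = (\<lambda>\<omega>. \<Sum>t\<in>F. c t * X \<omega> t)" by (auto simp: combination_def)
  then show ?thesis unfolding combination_def
    by (intro exI[of _ F] exI[of _ "\<lambda>t. k * c t"]) (simp add: sum_distrib_left mult.assoc)
qed

lemma combination_add:
  assumes "combination D V" "combination D W"
  shows "combination D (\<lambda>\<omega>. V \<omega> + W \<omega>)"
proof -
  obtain F c where F: "finite F" "F \<subseteq> D" "V = (\<lambda>\<omega>. \<Sum>t\<in>F. c t * X \<omega> t)" using assms(1) by (auto simp: combination_def)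
  obtain G d where G: "finite G" "G \<subseteq> D" "W = (\<lambda>\<omega>. \<Sum>t\<in>G. d t * X \<omega> t)" using assms(2) by (auto simp: combination_def)
  let ?e = "\<lambda>t. (if t \<in> F then c t else 0) + (if t \<in> G then d t else 0)"
  have "V \<omega> + W \<omega> = (\<Sum>t\<in>F \<union> G. ?e t * X \<omega> t)" for \<omega>
  proof -
    have "(\<Sum>t\<in>F. c t * X \<omega> t) = (\<Sum>t\<in>F \<union> G. (if t \<in> F then c t else 0) * X \<omega> t)"
      using F(1) G(1) by (intro sum.mono_neutral_cong_left) auto
    moreover have "(\<Sum>t\<in>G. d t * X \<omega> t) = (\<Sum>t\<in>F \<union> G. (if t \<in> G then d t else 0) * X \<omega> t)"
      using F(1) G(1) by (intro sum.mono_neutral_cong_left) auto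
    ultimately show ?thesis by (simp add: F(3) G(3) distrib_right sum.distrib)
  qed
  then show ?thesis unfolding combination_def
    using F G by (intro exI[of _ "F \<union> G"] exI[of _ ?e]) auto
qed

lemma combination_mono: "combination D W \<Longrightarrow> D \<subseteq> E \<Longrightarrow> combination E W"
  unfolding combination_def by blast

lemma sq_combination:
  assumes "combination D W" "D \<subseteq> {a..b}" shows "sq_integrable P W"
  using assms unfolding combination_def
  by (auto intro!: sq_integrable_sum sq_integrable_cmult sq_X)

text \<open>Approximability in mean square stands for membership in a closed subspace of \<open>L\<^sup>2(P)\<close>; no classes
  modulo null sets are formed.\<close>

definition observed_span :: "('w \<Rightarrow> real) \<Rightarrow> bool" where
  "observed_span W \<longleftrightarrow> sq_integrable P W \<and> (\<forall>e>0. \<exists>V. combination S V \<and> (\<integral>\<omega>. (W \<omega> - V \<omega>)\<^sup>2 \<partial>P) < e)"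

lemma observed_span_sequence:
  assumes "observed_span W" and e: "\<And>n. 0 < e n"
  obtains V where "\<And>n. combination S (V n)" "\<And>n. (\<integral>\<omega>. (W \<omega> - V n \<omega>)\<^sup>2 \<partial>P) < e n"
proof -
  have "\<forall>n. \<exists>V. combination S V \<and> (\<integral>\<omega>. (W \<omega> - V \<omega>)\<^sup>2 \<partial>P) < e n"
    using assms by (simp add: observed_span_def)
  then show thesis using that by (elim choice[THEN exE]) blast
qed

lemma observed_spanI:
  assumes W: "sq_integrable P W" and V: "\<And>n. observed_span (V n)" and c: "L2_conv P V W"
  shows "observed_span W"
  unfolding observed_span_def
proof (intro conjI W allI impI)
  fix e :: real assume e: "0 < e"
  have "\<forall>\<^sub>F n in sequentially. (\<integral>\<omega>. (W \<omega> - V n \<omega>)\<^sup>2 \<partial>P) < e / 4"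
    by (rule order_tendstoD(2)[OF c[unfolded L2_conv_def]]) (use e in simp)
  then obtain n where n: "(\<integral>\<omega>. (W \<omega> - V n \<omega>)\<^sup>2 \<partial>P) < e / 4" by (auto simp: eventually_sequentially)
  obtain U where U: "combination S U" "(\<integral>\<omega>. (V n \<omega> - U \<omega>)\<^sup>2 \<partial>P) < e / 4"
    using V[of n] e unfolding observed_span_def by (meson divide_pos_pos zero_less_numeral)
  have sV: "sq_integrable P (V n)" using V[of n] by (simp add: observed_span_def)
  have "(\<integral>\<omega>. (W \<omega> - U \<omega>)\<^sup>2 \<partial>P) = (\<integral>\<omega>. ((W \<omega> - V n \<omega>) + (V n \<omega> - U \<omega>))\<^sup>2 \<partial>P)" by simp
  also have "\<dots> \<le> 2 * (\<integral>\<omega>. (W \<omega> - V n \<omega>)\<^sup>2 \<partial>P) + 2 * (\<integral>\<omega>. (V n \<omega> - U \<omega>)\<^sup>2 \<partial>P)"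
    by (intro integral_square_add_le sq_integrable_diff W sV sq_combination[OF U(1) S_subset])
  also have "\<dots> < e" using n U(2) by simp
  finally show "\<exists>U. combination S U \<and> (\<integral>\<omega>. (W \<omega> - U \<omega>)\<^sup>2 \<partial>P) < e" using U(1) by blast
qed

lemma observed_span_combination:
  assumes "combination S W" shows "observed_span W"
  unfolding observed_span_def using assms sq_combination[OF assms S_subset] by (auto intro!: exI[of _ W])

lemma observed_span_add:
  assumes V: "observed_span V" and W: "observed_span W"
  shows "observed_span (\<lambda>\<omega>. V \<omega> + W \<omega>)"
  unfolding observed_span_def
proof (intro conjI allI impI)
  have sV: "sq_integrable P V" and sW: "sq_integrable P W" using V W by (auto simp: observed_span_def)
  then show "sq_integrable P (\<lambda>\<omega>. V \<omega> + W \<omega>)" by (rule sq_integrable_add)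
  fix e :: real assume e: "0 < e"
  then have e4: "0 < e / 4" by simp
  obtain V' where V': "combination S V'" "(\<integral>\<omega>. (V \<omega> - V' \<omega>)\<^sup>2 \<partial>P) < e / 4"
    using V e4 unfolding observed_span_def by blast
  obtain W' where W': "combination S W'" "(\<integral>\<omega>. (W \<omega> - W' \<omega>)\<^sup>2 \<partial>P) < e / 4"
    using W e4 unfolding observed_span_def by blast
  have "(\<integral>\<omega>. (V \<omega> + W \<omega> - (V' \<omega> + W' \<omega>))\<^sup>2 \<partial>P) = (\<integral>\<omega>. ((V \<omega> - V' \<omega>) + (W \<omega> - W' \<omega>))\<^sup>2 \<partial>P)"
    by (simp add: algebra_simps)
  also have "\<dots> \<le> 2 * (\<integral>\<omega>. (V \<omega> - V' \<omega>)\<^sup>2 \<partial>P) + 2 * (\<integral>\<omega>. (W \<omega> - W' \<omega>)\<^sup>2 \<partial>P)"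
    by (intro integral_square_add_le sq_integrable_diff sV sW sq_combination[OF V'(1) S_subset] sq_combination[OF W'(1) S_subset])
  also have "\<dots> < e" using V'(2) W'(2) by simp
  finally show "\<exists>U. combination S U \<and> (\<integral>\<omega>. (V \<omega> + W \<omega> - U \<omega>)\<^sup>2 \<partial>P) < e"
    using combination_add[OF V'(1) W'(1)] by (intro exI[of _ "\<lambda>\<omega>. V' \<omega> + W' \<omega>"]) simp
qed

lemma observed_span_cmult:
  assumes W: "observed_span W" shows "observed_span (\<lambda>\<omega>. k * W \<omega>)"
proof -
  have s: "sq_integrable P W" using W by (simp add: observed_span_def)
  obtain V where V: "\<And>n. combination S (V n)" "\<And>n. (\<integral>\<omega>. (W \<omega> - V n \<omega>)\<^sup>2 \<partial>P) < 1 / Suc n"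
    using observed_span_sequence[OF W, of "\<lambda>n. 1 / Suc n"] by auto
  have "L2_conv P V W"
    unfolding L2_conv_def
    by (rule Lim_null_comparison[OF _ LIMSEQ_Suc[OF lim_1_over_n]])
       (use V(2) in \<open>auto intro!: always_eventually less_imp_le\<close>)
  from L2_conv_cmult[OF this] show ?thesis
    by (rule observed_spanI[OF sq_integrable_cmult[OF s] observed_span_combination[OF combination_cmult[OF V(1)]]])
qed

lemma observed_span_sum:
  "(\<And>i. i \<in> I \<Longrightarrow> observed_span (W i)) \<Longrightarrow> finite I \<Longrightarrow> observed_span (\<lambda>\<omega>. \<Sum>i\<in>I. W i \<omega>)"
proof (induction I rule: infinite_finite_induct)
  case empty
  have "combination S (\<lambda>\<omega>. 0)" unfolding combination_def by (intro exI[of _ "{}"]) simp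
  then show ?case using observed_span_combination by simp
next
  case (insert i I)
  then show ?case using observed_span_add[of "W i" "\<lambda>\<omega>. \<Sum>i\<in>I. W i \<omega>"] by simp
qed simp

text \<open>Replacing the path by a step function with finitely many values turns the integral that
  defines the score into a finite combination; the error is controlled by the mean square
  increments of the process.\<close>

lemma score_in_observed_span: "observed_span (\<xi> k)"
proof -
  define h where "h n v = round_to S n v" for n v
  define G where "G n = round_in S n ` ((\<lambda>v. \<lfloor>real (Suc n) * v\<rfloor>) ` S)" for n
  define V where "V n \<omega> = (\<Sum>t\<in>G n. (\<integral>v. indicator {v. h n v = t} v * \<phi> k v \<partial>LS) * X \<omega> t)" for n \<omega>
  interpret L: finite_measure LS by (rule finite_LS)
  have hS: "h n v \<in> S" if "v \<in> S" for n v using round_to(1)[OF that] by (simp add: h_def)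
  have hab: "h n v \<in> {a..b}" if "v \<in> S" for n v using hS[OF that] S_subset by blast
  have finG: "finite (G n)" for n
    unfolding G_def by (intro finite_imageI finite_floor_image compact_imp_bounded S_compact)
  have hG: "h n v \<in> G n" if "v \<in> S" for n v using that by (auto simp: h_def G_def)
  have G_sub: "G n \<subseteq> S" for n using round_to(1) by (auto simp: G_def)
  have [measurable]: "(\<lambda>v. v) \<in> LS \<rightarrow>\<^sub>M borel"
    by (intro measurable_restrict_space1 measurable_completion) simp
  have [measurable]: "h n \<in> borel_measurable LS" for n
    unfolding h_def
    by (rule measurable_compose_countable[where f="\<lambda>i v. round_in S n i"]) measurable
  have [measurable]: "(\<lambda>v. indicator {v. h n v = t} v :: real) \<in> borel_measurable LS" for n t
  proof -
    have "(\<lambda>v. indicator {t} (h n v) :: real) \<in> borel_measurable LS" by measurable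
    then show ?thesis by (simp add: indicator_def)
  qed
  have combV: "combination S (V n)" for n
    unfolding combination_def using finG G_sub by (intro exI[of _ "G n"]) (auto simp: V_def fun_eq_iff)
  have sV: "sq_integrable P (V n)" for n by (rule sq_combination[OF combV S_subset])
  have step: "X \<omega> (h n v) = (\<Sum>t\<in>G n. indicator {v. h n v = t} v * X \<omega> t)" if "v \<in> S" for \<omega> n v
    using hG[OF that] finG by (simp add: indicator_def of_bool_def if_distrib[of "\<lambda>x. x * _"] sum.delta cong: if_cong)
  have [measurable]: "(\<lambda>\<omega>. X \<omega> t) \<in> borel_measurable P" if "t \<in> S" for t
    using sq_X[of t] that S_subset by (auto dest: sq_integrable_measurable)
  have [measurable]: "(\<lambda>(\<omega>, v). X \<omega> v) \<in> borel_measurable (P \<Otimes>\<^sub>M LS)" by (rule X_pair_measurable[OF S_subset])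
  have "(\<lambda>(\<omega>, v). \<Sum>t\<in>G n. indicator {v. h n v = t} v * X \<omega> t) \<in> borel_measurable (P \<Otimes>\<^sub>M LS)" for n
    unfolding case_prod_unfold
  proof (rule borel_measurable_sum)
    fix t assume "t \<in> G n"
    then have "t \<in> {a..b}" using G_sub S_subset by blast
    then have [measurable]: "(\<lambda>\<omega>. X \<omega> t) \<in> borel_measurable P" by (intro sq_integrable_measurable sq_X)
    show "(\<lambda>p. indicator {v. h n v = t} (snd p) * X (fst p) t) \<in> borel_measurable (P \<Otimes>\<^sub>M LS)" by measurable
  qed
  then have mh [measurable]: "(\<lambda>(\<omega>, v). X \<omega> (h n v)) \<in> borel_measurable (P \<Otimes>\<^sub>M LS)" for n
    by (rule measurable_cong[THEN iffD1, rotated]) (auto simp: space_pair_measure step)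
  have hlim: "(\<lambda>n. h n v) \<longlonglongrightarrow> v" if "v \<in> S" for v
    unfolding h_def by (rule round_to_tendsto[OF that])
  obtain B where B: "0 \<le> B" "\<And>u. u \<in> {a..b} \<Longrightarrow> \<gamma> u u \<le> B" using cov_diag_bound by blast
  have incB: "increment u v \<le> 4 * B" if "u \<in> {a..b}" "v \<in> {a..b}" for u v
  proof -
    have "increment u v \<le> 2 * (\<integral>\<omega>. (X \<omega> u)\<^sup>2 \<partial>P) + 2 * (\<integral>\<omega>. (- X \<omega> v)\<^sup>2 \<partial>P)"
      unfolding increment_def
      using integral_square_add_le[OF sq_X[OF that(1)] sq_integrable_cmult[OF sq_X[OF that(2)], of "-1"]] by simp
    also have "\<dots> \<le> 2 * B + 2 * B" using B(2)[OF that(1)] B(2)[OF that(2)] by (simp add: cov_diag)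
    finally show ?thesis by simp
  qed
  have incS: "increment v (h n v) \<le> 4 * B" if "v \<in> S" for n v
    using incB[OF subsetD[OF S_subset that] subsetD[OF S_subset hS[OF that]]] .
  have nn: "(\<integral>\<^sup>+\<omega>. ennreal ((X \<omega> v - X \<omega> (h n v))\<^sup>2) \<partial>P) = ennreal (increment v (h n v))" if "v \<in> S" for n v
  proof -
    have "v \<in> {a..b}" "h n v \<in> {a..b}" using that hS S_subset by blast+
    then have "sq_integrable P (\<lambda>\<omega>. X \<omega> v - X \<omega> (h n v))" by (intro sq_integrable_diff sq_X)
    then show ?thesis
      unfolding increment_def by (intro nn_integral_eq_integral) (auto simp: sq_integrable_def)
  qed
  have mD: "(\<lambda>(\<omega>, v). X \<omega> v - X \<omega> (h n v)) \<in> borel_measurable (P \<Otimes>\<^sub>M LS)" for n by measurable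
  have sD: "sq_integrable (P \<Otimes>\<^sub>M LS) (\<lambda>(\<omega>, v). X \<omega> v - X \<omega> (h n v))" for n
  proof (rule sq_integrable_pair[OF sigma_finite_measure_axioms sigma_finite_lebesgue_on[OF S_sets S_subset] mD])
    have "(\<integral>\<^sup>+v. \<integral>\<^sup>+\<omega>. ennreal ((X \<omega> v - X \<omega> (h n v))\<^sup>2) \<partial>P \<partial>LS) \<le> (\<integral>\<^sup>+v. ennreal (4 * B) \<partial>LS)"
      using incS by (intro nn_integral_mono) (auto simp: nn intro!: ennreal_leI)
    also have "\<dots> < \<infinity>"
      by (simp add: ennreal_mult_less_top less_top L.emeasure_eq_measure del: emeasure_completion)
    finally show "(\<integral>\<^sup>+v. \<integral>\<^sup>+\<omega>. ennreal ((X \<omega> v - X \<omega> (h n v))\<^sup>2) \<partial>P \<partial>LS) < \<infinity>" .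
  qed
  interpret pair_sigma_finite P LS
    using sigma_finite_lebesgue_on[OF S_sets S_subset] prob_space_imp_sigma_finite[OF prob_space_axioms]
    by (simp add: pair_sigma_finite_def)
  have iD: "integrable (P \<Otimes>\<^sub>M LS) (\<lambda>(\<omega>, v). (X \<omega> v - X \<omega> (h n v))\<^sup>2)" for n
    using sq_integrable_square[OF sD[of n]] by (simp add: case_prod_unfold)
  have swap: "(\<integral>\<omega>. \<integral>v. (X \<omega> v - X \<omega> (h n v))\<^sup>2 \<partial>LS \<partial>P) = (\<integral>v. increment v (h n v) \<partial>LS)" for n
    using Fubini_integral[OF iD] by (simp add: increment_def)
  have path: "\<xi> k \<omega> - V n \<omega> = (\<integral>v. (X \<omega> v - X \<omega> (h n v)) * \<phi> k v \<partial>LS) \<and> sq_integrable LS (\<lambda>v. X \<omega> v - X \<omega> (h n v))"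
    if \<omega>: "\<omega> \<in> space P" for n \<omega>
  proof -
    have sh: "sq_integrable LS (\<lambda>v. X \<omega> (h n v))"
    proof -
      have "sq_integrable LS (\<lambda>v. indicator {v. h n v = t} v)" for t
        unfolding sq_integrable_def by (auto intro!: L.integrable_const_bound[where B=1] simp: indicator_def)
      then have "sq_integrable LS (\<lambda>v. \<Sum>t\<in>G n. X \<omega> t * indicator {v. h n v = t} v)"
        by (intro sq_integrable_sum sq_integrable_cmult)
      then show ?thesis
        unfolding sq_integrable_def
        by (elim conjE, intro conjI)
           (erule measurable_cong[THEN iffD1, rotated] Bochner_Integration.integrable_cong[THEN iffD1, rotated 2];
            simp add: step mult.commute)+
    qed
    have i: "integrable LS (\<lambda>v. indicator {v. h n v = t} v * \<phi> k v)" for t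
    proof (rule Bochner_Integration.integrable_bound)
      show "integrable LS (\<phi> k)"
        using sq_integrable_times[OF sq_phi[of k], of "\<lambda>_. 1"] by (simp add: sq_integrable_def)
      have [measurable]: "\<phi> k \<in> borel_measurable LS" using sq_phi by (rule sq_integrable_measurable)
      show "(\<lambda>v. indicator {v. h n v = t} v * \<phi> k v) \<in> borel_measurable LS" by measurable
      show "AE v in LS. norm (indicator {v. h n v = t} v * \<phi> k v) \<le> norm (\<phi> k v)"
        by (simp add: indicator_def)
    qed
    have "V n \<omega> = (\<integral>v. (\<Sum>t\<in>G n. indicator {v. h n v = t} v * \<phi> k v * X \<omega> t) \<partial>LS)"
      unfolding V_def using i by simp
    also have "\<dots> = (\<integral>v. X \<omega> (h n v) * \<phi> k v \<partial>LS)"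
      by (intro Bochner_Integration.integral_cong refl) (simp add: step sum_distrib_left sum_distrib_right mult_ac)
    finally have "\<xi> k \<omega> - V n \<omega> = (\<integral>v. X \<omega> v * \<phi> k v \<partial>LS) - (\<integral>v. X \<omega> (h n v) * \<phi> k v \<partial>LS)"
      by (simp add: score_def l2_inner_def)
    also have "\<dots> = (\<integral>v. (X \<omega> v - X \<omega> (h n v)) * \<phi> k v \<partial>LS)"
      using sq_integrable_times[OF sq_X_path[OF \<omega>] sq_phi] sq_integrable_times[OF sh sq_phi]
      by (simp add: left_diff_distrib)
    finally show ?thesis using sq_integrable_diff[OF sq_X_path[OF \<omega>] sh] by simp
  qed
  have le: "(\<integral>\<omega>. (\<xi> k \<omega> - V n \<omega>)\<^sup>2 \<partial>P) \<le> (\<integral>v. increment v (h n v) \<partial>LS)" for n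
  proof -
    have "(\<integral>\<omega>. (\<xi> k \<omega> - V n \<omega>)\<^sup>2 \<partial>P) \<le> (\<integral>\<omega>. \<integral>v. (X \<omega> v - X \<omega> (h n v))\<^sup>2 \<partial>LS \<partial>P)"
    proof (rule integral_mono)
      show "integrable P (\<lambda>\<omega>. (\<xi> k \<omega> - V n \<omega>)\<^sup>2)"
        by (rule sq_integrable_square[OF sq_integrable_diff[OF sq_score sV]])
      show "integrable P (\<lambda>\<omega>. \<integral>v. (X \<omega> v - X \<omega> (h n v))\<^sup>2 \<partial>LS)"
        using integrable_fst'[OF iD] by simp
      fix \<omega> assume "\<omega> \<in> space P"
      from path[OF this, of n] have p: "\<xi> k \<omega> - V n \<omega> = (\<integral>v. (X \<omega> v - X \<omega> (h n v)) * \<phi> k v \<partial>LS)"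
        and s: "sq_integrable LS (\<lambda>v. X \<omega> v - X \<omega> (h n v))" by auto
      have "(\<integral>v. (\<phi> k v)\<^sup>2 \<partial>LS) = 1" using orth_phi[of k k] by (simp add: l2_inner_def power2_eq_square)
      then show "(\<xi> k \<omega> - V n \<omega>)\<^sup>2 \<le> (\<integral>v. (X \<omega> v - X \<omega> (h n v))\<^sup>2 \<partial>LS)"
        unfolding p using integral_Cauchy_Schwarz[OF s sq_phi[of k]] by simp
    qed
    then show ?thesis unfolding swap .
  qed
  have "(\<lambda>n. \<integral>v. increment v (h n v) \<partial>LS) \<longlonglongrightarrow> (\<integral>v. 0 \<partial>LS)"
  proof (rule integral_dominated_convergence)
    show "(\<lambda>v. increment v (h n v)) \<in> borel_measurable LS" for n
      unfolding increment_def by measurable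
    show "AE v in LS. (\<lambda>n. increment v (h n v)) \<longlonglongrightarrow> 0"
      by (rule AE_I2, rule increment_tendsto) (simp_all add: hlim hab subsetD[OF S_subset] del: atLeastAtMost_iff)
    show "AE v in LS. norm (increment v (h n v)) \<le> 4 * B" for n
    proof (rule AE_I2)
      fix v assume "v \<in> space LS"
      then have "increment v (h n v) \<le> 4 * B" by (intro incS) simp
      then show "norm (increment v (h n v)) \<le> 4 * B" by (simp add: increment_def)
    qed
  qed auto
  then have lim0: "(\<lambda>n. \<integral>v. increment v (h n v) \<partial>LS) \<longlonglongrightarrow> 0" by simp
  have "L2_conv P V (\<xi> k)"
    unfolding L2_conv_def by (rule Lim_null_comparison[OF _ lim0]) (use le in simp)
  then show ?thesis by (rule observed_spanI[OF sq_score observed_span_combination[OF combV]])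
qed

section \<open>Gaussian processes\<close>

text \<open>The characteristic function at 1 is that of a centered normal variable with the same variance;
  variance 0 is allowed. Imposed on all multiples of \<open>W\<close> this says that \<open>W\<close> is normal, and unlike a
  density it survives limits in mean square.\<close>

definition gaussian_char :: "('w \<Rightarrow> real) \<Rightarrow> bool" where
  "gaussian_char W \<longleftrightarrow> (\<integral>\<omega>. cis (W \<omega>) \<partial>P) = of_real (exp (- (\<integral>\<omega>. (W \<omega>)\<^sup>2 \<partial>P) / 2))"

lemma gaussian_char_combination:
  assumes g: "gaussian_process P a b X" and W: "combination {a..b} W"
  shows "gaussian_char W"
proof -
  obtain F c where F: "finite F" "F \<subseteq> {a..b}" "W = (\<lambda>\<omega>. \<Sum>t\<in>F. c t * X \<omega> t)"
    using W by (auto simp: combination_def)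
  have sW: "sq_integrable P W" by (rule sq_combination[OF W]) simp
  note [measurable] = sq_integrable_measurable[OF sW]
  have iX: "integrable P (\<lambda>\<omega>. X \<omega> t)" if "t \<in> F" for t
    using sq_integrable_times[OF sq_X const_sq, of t 1] that F(2) by auto
  have mean: "expectation W = 0"
    unfolding F(3) using iX F(2) by (simp add: mean_X subset_iff)
  consider (normal) m s where "0 < s" "distributed P lborel W (\<lambda>x. ennreal (normal_density m s x))"
    | (const) m where "AE \<omega> in P. W \<omega> = m"
    using g F unfolding gaussian_process_def by blast
  then show ?thesis
  proof cases
    case normal
    note s = normal(1) and D = normal(2)
    have m0: "m = 0" using normal_distributed_expectation[OF s D] mean by simp
    have var: "(\<integral>\<omega>. (W \<omega>)\<^sup>2 \<partial>P) = s\<^sup>2" using normal_distributed_variance[OF s D] mean by simp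
    have "distributed P lborel (\<lambda>\<omega>. W \<omega> / s) std_normal_density"
      using normal_standard_normal_convert[OF s, of W 0] D m0 by simp
    then have d: "distr P lborel (\<lambda>\<omega>. W \<omega> / s) = std_normal_distribution"
      by (rule distributed_distr_eq_density)
    have "(\<integral>\<omega>. cis (W \<omega>) \<partial>P) = (\<integral>\<omega>. cis (s * (W \<omega> / s)) \<partial>P)" using s by simp
    also have "\<dots> = (\<integral>x. cis (s * x) \<partial>distr P lborel (\<lambda>\<omega>. W \<omega> / s))"
      by (subst integral_distr) (auto simp: cis_conv_exp)
    also have "\<dots> = char std_normal_distribution s"
      unfolding d char_def by (simp add: cis_conv_exp)
    also have "\<dots> = of_real (exp (- s\<^sup>2 / 2))" by (simp add: char_std_normal_distribution)
    finally show ?thesis by (simp add: gaussian_char_def var)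
  next
    case const
    have "expectation W = (\<integral>\<omega>. m \<partial>P)" by (rule integral_cong_AE) (use const in auto)
    then have m: "m = 0" using mean by (simp add: prob_space)
    have "(\<integral>\<omega>. cis (W \<omega>) \<partial>P) = (\<integral>\<omega>. 1 \<partial>P)"
      by (rule integral_cong_AE) (use const m in \<open>auto simp: cis_conv_exp\<close>)
    moreover have "(\<integral>\<omega>. (W \<omega>)\<^sup>2 \<partial>P) = (\<integral>\<omega>. 0 \<partial>P)"
      by (rule integral_cong_AE) (use const m in auto)
    ultimately show ?thesis by (simp add: gaussian_char_def prob_space)
  qed
qed

text \<open>Both sides are continuous in mean square: \<open>cis\<close> is Lipschitz, and the variance is a squared norm.\<close>

lemma gaussian_char_limit:
  assumes V: "\<And>n. sq_integrable P (V n)" and g: "\<And>n. gaussian_char (V n)"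
    and W: "sq_integrable P W" and c: "L2_conv P V W"
  shows "gaussian_char W"
proof -
  note [measurable] = sq_integrable_measurable[OF V] sq_integrable_measurable[OF W]
  have ic: "integrable P (\<lambda>\<omega>. cis (f \<omega>))" if [measurable]: "f \<in> borel_measurable P" for f
    by (rule integrable_const_bound[where B=1]) (auto simp: cis_conv_exp)
  have d: "sq_integrable P (\<lambda>\<omega>. W \<omega> - V n \<omega>)" for n by (intro sq_integrable_diff V W)
  have "(\<lambda>n. \<integral>\<omega>. cis (V n \<omega>) \<partial>P) \<longlonglongrightarrow> (\<integral>\<omega>. cis (W \<omega>) \<partial>P)"
  proof (rule LIM_zero_cancel, rule Lim_null_comparison)
    show "\<forall>\<^sub>F n in sequentially. norm ((\<integral>\<omega>. cis (V n \<omega>) \<partial>P) - (\<integral>\<omega>. cis (W \<omega>) \<partial>P)) \<le> sqrt (\<integral>\<omega>. (W \<omega> - V n \<omega>)\<^sup>2 \<partial>P)"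
    proof (intro always_eventually allI)
      fix n
      have ab: "sq_integrable P (\<lambda>\<omega>. \<bar>W \<omega> - V n \<omega>\<bar>)" using d[of n] by (auto simp: sq_integrable_def)
      have "(\<integral>\<omega>. cis (V n \<omega>) \<partial>P) - (\<integral>\<omega>. cis (W \<omega>) \<partial>P) = (\<integral>\<omega>. cis (V n \<omega>) - cis (W \<omega>) \<partial>P)"
        by (rule Bochner_Integration.integral_diff[symmetric]) (auto intro: ic)
      also have "norm \<dots> \<le> (\<integral>\<omega>. norm (cis (V n \<omega>) - cis (W \<omega>)) \<partial>P)"
        by (rule integral_norm_bound)
      also have "\<dots> \<le> (\<integral>\<omega>. \<bar>W \<omega> - V n \<omega>\<bar> \<partial>P)"
      proof (rule integral_mono)
        show "integrable P (\<lambda>\<omega>. norm (cis (V n \<omega>) - cis (W \<omega>)))"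
          by (intro integrable_norm Bochner_Integration.integrable_diff ic) auto
        show "integrable P (\<lambda>\<omega>. \<bar>W \<omega> - V n \<omega>\<bar>)" using sq_integrable_times[OF ab const_sq[of 1]] by simp
        show "norm (cis (V n \<omega>) - cis (W \<omega>)) \<le> \<bar>W \<omega> - V n \<omega>\<bar>" for \<omega>
          using norm_cis_diff_le[of "V n \<omega>" "W \<omega>"] by (simp add: abs_minus_commute)
      qed
      also have "\<dots> \<le> sqrt (\<integral>\<omega>. (W \<omega> - V n \<omega>)\<^sup>2 \<partial>P)"
        using integral_abs_times_le[OF ab const_sq[of 1]] by (simp add: prob_space)
      finally show "norm ((\<integral>\<omega>. cis (V n \<omega>) \<partial>P) - (\<integral>\<omega>. cis (W \<omega>) \<partial>P)) \<le> sqrt (\<integral>\<omega>. (W \<omega> - V n \<omega>)\<^sup>2 \<partial>P)" .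
    qed
    show "(\<lambda>n. sqrt (\<integral>\<omega>. (W \<omega> - V n \<omega>)\<^sup>2 \<partial>P)) \<longlonglongrightarrow> 0"
      using tendsto_real_sqrt[OF c[unfolded L2_conv_def]] by simp
  qed
  moreover have "(\<lambda>n. \<integral>\<omega>. cis (V n \<omega>) \<partial>P) \<longlonglongrightarrow> of_real (exp (- (\<integral>\<omega>. (W \<omega>)\<^sup>2 \<partial>P) / 2))"
    unfolding g[unfolded gaussian_char_def] by (intro tendsto_intros L2_conv_square V W c) simp
  ultimately show ?thesis unfolding gaussian_char_def by (rule LIMSEQ_unique)
qed

lemma observed_measurable [measurable]: "D \<subseteq> {a..b} \<Longrightarrow> observed X D \<in> P \<rightarrow>\<^sub>M path_space D"
  unfolding observed_def[abs_def] using sq_X by (intro measurable_restrict) (auto dest: sq_integrable_measurable)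

end

section \<open>Conditioning a Gaussian process on its observed part\<close>

context reconstructed_process
begin

lemma R_in_observed_span:
  assumes u: "u \<in> T" shows "observed_span (\<lambda>\<omega>. R \<omega> u)"
proof (rule observed_spanI[OF sq_R[OF u] _ R_limit[OF u]])
  fix n
  have "observed_span (\<lambda>\<omega>. \<Sum>k<n. scores.coef (\<lambda>\<omega>. X \<omega> u) k * \<xi> k \<omega>)"
    by (intro observed_span_sum observed_span_cmult score_in_observed_span) simp
  then show "observed_span (scores.proj (\<lambda>\<omega>. X \<omega> u) n)"
    by (simp add: scores.proj_def[abs_def] mult.commute)
qed

text \<open>The reconstruction lies in the closure of the span of the observed values, so \<open>V + t Z\<close> is a mean
  square limit of combinations of values of the process.\<close>

lemma gaussian_char_observed_plus_error:
  assumes g: "gaussian_process P a b X" and u: "u \<in> T" and V: "combination S V"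
  shows "gaussian_char (\<lambda>\<omega>. V \<omega> + t * Z \<omega> u)"
proof -
  obtain R' where R': "\<And>n. combination S (R' n)" "\<And>n. (\<integral>\<omega>. (R \<omega> u - R' n \<omega>)\<^sup>2 \<partial>P) < 1 / Suc n"
    using observed_span_sequence[OF R_in_observed_span[OF u], of "\<lambda>n. 1 / Suc n"] by auto
  let ?W = "\<lambda>n \<omega>. V \<omega> + (t * X \<omega> u + (- t) * R' n \<omega>)"
  have comb: "combination {a..b} (?W n)" for n
    by (intro combination_add combination_cmult combination_X combination_mono[OF V S_subset]
      combination_mono[OF R'(1) S_subset] T_interval[OF u])
  show ?thesis
  proof (rule gaussian_char_limit)
    show "sq_integrable P (?W n)" for n by (rule sq_combination[OF comb]) simp
    show "gaussian_char (?W n)" for n by (rule gaussian_char_combination[OF g comb])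
    show "sq_integrable P (\<lambda>\<omega>. V \<omega> + t * Z \<omega> u)"
      by (intro sq_integrable_add sq_integrable_cmult sq_Z u sq_combination[OF V S_subset])
    show "L2_conv P ?W (\<lambda>\<omega>. V \<omega> + t * Z \<omega> u)"
      unfolding L2_conv_def
    proof (rule Lim_null_comparison)
      have "(\<integral>\<omega>. (V \<omega> + t * Z \<omega> u - ?W n \<omega>)\<^sup>2 \<partial>P) = t\<^sup>2 * (\<integral>\<omega>. (R \<omega> u - R' n \<omega>)\<^sup>2 \<partial>P)" for n
      proof -
        have "(V \<omega> + t * Z \<omega> u - ?W n \<omega>)\<^sup>2 = t\<^sup>2 * (R \<omega> u - R' n \<omega>)\<^sup>2" for \<omega>
          by (simp add: Z_def power2_eq_square algebra_simps)
        then show ?thesis by simp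
      qed
      then show "\<forall>\<^sub>F n in sequentially. norm (\<integral>\<omega>. (V \<omega> + t * Z \<omega> u - ?W n \<omega>)\<^sup>2 \<partial>P) \<le> t\<^sup>2 * (1 / Suc n)"
        using mult_left_mono[OF less_imp_le[OF R'(2)] zero_le_power2[of t]]
        by (intro always_eventually allI) simp
      show "(\<lambda>n. t\<^sup>2 * (1 / Suc n)) \<longlonglongrightarrow> 0"
        by (rule tendsto_mult_right_zero[OF LIMSEQ_Suc[OF lim_1_over_n]])
    qed
  qed
qed

text \<open>Uncorrelated jointly Gaussian variables: the variance in the exponent of the characteristic
  function is additive, so the characteristic function factorises.\<close>

lemma char_factorises:
  assumes g: "gaussian_process P a b X" and u: "u \<in> T" and V: "combination S V"
  shows "(\<integral>\<omega>. cis (V \<omega> + t * Z \<omega> u) \<partial>P) = (\<integral>\<omega>. cis (V \<omega>) \<partial>P) * (\<integral>\<omega>. cis (t * Z \<omega> u) \<partial>P)"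
proof -
  have sV: "sq_integrable P V" by (rule sq_combination[OF V S_subset])
  have zero: "combination S (\<lambda>\<omega>. 0)" unfolding combination_def by (intro exI[of _ "{}"]) simp
  have orth: "(\<integral>\<omega>. V \<omega> * Z \<omega> u \<partial>P) = 0"
  proof -
    obtain F c where F: "finite F" "F \<subseteq> S" "V = (\<lambda>\<omega>. \<Sum>t\<in>F. c t * X \<omega> t)" using V by (auto simp: combination_def)
    have i: "integrable P (\<lambda>\<omega>. X \<omega> t * Z \<omega> u)" if "t \<in> F" for t
      using X_Z_integrable[OF u] that F(2) S_subset by blast
    have "(\<integral>\<omega>. V \<omega> * Z \<omega> u \<partial>P) = (\<integral>\<omega>. (\<Sum>t\<in>F. c t * (X \<omega> t * Z \<omega> u)) \<partial>P)"
      by (simp add: F(3) sum_distrib_right mult.assoc)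
    also have "\<dots> = (\<Sum>t\<in>F. c t * (\<integral>\<omega>. X \<omega> t * Z \<omega> u \<partial>P))"
      using i by simp
    also have "\<dots> = 0" using F(2) Z_orthogonal_observed[OF u] by (intro sum.neutral) auto
    finally show ?thesis .
  qed
  have "(\<integral>\<omega>. (V \<omega> - (- t) * Z \<omega> u)\<^sup>2 \<partial>P) = (\<integral>\<omega>. (V \<omega>)\<^sup>2 \<partial>P) + t\<^sup>2 * (\<integral>\<omega>. (Z \<omega> u)\<^sup>2 \<partial>P)"
    unfolding integral_square_diff[OF sV sq_Z[OF u]] by (simp add: orth)
  then have sq: "(\<integral>\<omega>. (V \<omega> + t * Z \<omega> u)\<^sup>2 \<partial>P) = (\<integral>\<omega>. (V \<omega>)\<^sup>2 \<partial>P) + (\<integral>\<omega>. (t * Z \<omega> u)\<^sup>2 \<partial>P)"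
    by (simp add: power_mult_distrib)
  have gV: "gaussian_char V"
    using gaussian_char_observed_plus_error[OF g u V, of 0] by simp
  have gZ: "gaussian_char (\<lambda>\<omega>. t * Z \<omega> u)"
    using gaussian_char_observed_plus_error[OF g u zero, of t] by simp
  show ?thesis
    using gaussian_char_observed_plus_error[OF g u V, of t] gV gZ
    by (simp add: gaussian_char_def sq add_divide_distrib exp_add[symmetric] of_real_mult[symmetric] diff_divide_distrib
        del: of_real_mult)
qed

lemma Z_measurable: "u \<in> T \<Longrightarrow> (\<lambda>\<omega>. Z \<omega> u) \<in> borel_measurable P"
  using sq_Z by (rule sq_integrable_measurable)

text \<open>The error is attached to the unobserved index \<open>u\<close>, which does not belong to \<open>S\<close>. Observed part and error
  then form one process on \<open>insert u S\<close>, and the Cramer-Wold lemma compares its law with the law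
  of the same process built from two independent points of the sample space.\<close>

lemma observed_independent_error:
  assumes g: "gaussian_process P a b X" and u: "u \<in> T" "u \<notin> S"
  shows "distr P (path_space S \<Otimes>\<^sub>M borel) (\<lambda>\<omega>. (observed X S \<omega>, Z \<omega> u))
    = distr P (path_space S) (observed X S) \<Otimes>\<^sub>M distr P borel (\<lambda>\<omega>. Z \<omega> u)"
proof -
  note [measurable] = Z_measurable[OF u(1)] observed_measurable[OF S_subset]
  have mX [measurable]: "(\<lambda>\<omega>. X \<omega> t) \<in> borel_measurable P" if "t \<in> S" for t
    using sq_X[of t] that S_subset by (auto dest: sq_integrable_measurable)
  interpret PP: pair_prob_space P P ..
  let ?I = "insert u S"
  let ?Y = "\<lambda>p. \<lambda>i\<in>?I. if i = u then Z (snd p) u else X (fst p) i"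
  have Y: "?Y \<in> P \<Otimes>\<^sub>M P \<rightarrow>\<^sub>M path_space ?I"
  proof (rule measurable_restrict)
    fix i assume i: "i \<in> ?I"
    show "(\<lambda>p. if i = u then Z (snd p) u else X (fst p) i) \<in> borel_measurable (P \<Otimes>\<^sub>M P)"
    proof (cases "i = u")
      case False
      with i have [measurable]: "(\<lambda>\<omega>. X \<omega> i) \<in> borel_measurable P" by (intro mX) simp
      from False show ?thesis by simp
    qed simp
  qed
  have diag: "(\<lambda>\<omega>. (\<omega>, \<omega>)) \<in> P \<rightarrow>\<^sub>M P \<Otimes>\<^sub>M P" by measurable
  have Yd: "(\<lambda>\<omega>. ?Y (\<omega>, \<omega>)) \<in> P \<rightarrow>\<^sub>M path_space ?I"
    by (rule measurable_compose[OF diag Y])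
  have law: "distr P (path_space ?I) (\<lambda>\<omega>. ?Y (\<omega>, \<omega>)) = distr (P \<Otimes>\<^sub>M P) (path_space ?I) ?Y"
  proof (rule Cramer_Wold)
    show "finite_measure (distr P (path_space ?I) (\<lambda>\<omega>. ?Y (\<omega>, \<omega>)))"
      by (intro prob_space.finite_measure prob_space_distr Yd)
    show "finite_measure (distr (P \<Otimes>\<^sub>M P) (path_space ?I) ?Y)"
      by (intro prob_space.finite_measure PP.prob_space_distr Y)
    fix F and c :: "real \<Rightarrow> real" assume F: "finite F" "F \<subseteq> ?I"
    define V where "V \<omega> = (\<Sum>i\<in>F - {u}. c i * X \<omega> i)" for \<omega>
    define t where "t = (if u \<in> F then c u else 0)"
    have V: "combination S V"
      unfolding combination_def V_def[abs_def] using F by (intro exI[of _ "F - {u}"] exI[of _ c]) auto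
    have [measurable]: "V \<in> borel_measurable P" using sq_combination[OF V S_subset] by (rule sq_integrable_measurable)
    have dot: "(\<Sum>i\<in>F. c i * ?Y p i) = V (fst p) + t * Z (snd p) u" for p
    proof -
      have "(\<Sum>i\<in>F - {u}. c i * ?Y p i) = V (fst p)"
        unfolding V_def using F by (intro sum.cong) auto
      then show ?thesis
        using F by (cases "u \<in> F") (auto simp: t_def sum.remove)
    qed
    have m: "(\<lambda>x. cis (\<Sum>i\<in>F. c i * x i)) \<in> borel_measurable (path_space ?I)"
    proof -
      have "(\<lambda>x. \<Sum>i\<in>F. c i * x i) \<in> borel_measurable (path_space ?I)"
        using F by (intro borel_measurable_sum borel_measurable_times borel_measurable_const measurable_component_singleton) auto
      then show ?thesis unfolding cis_conv_exp by measurable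
    qed
    have ic: "integrable P (\<lambda>\<omega>. cis (f \<omega>))" if [measurable]: "f \<in> borel_measurable P" for f
      by (rule integrable_const_bound[where B=1]) (auto simp: cis_conv_exp)
    have "(\<integral>x. cis (\<Sum>i\<in>F. c i * x i) \<partial>distr (P \<Otimes>\<^sub>M P) (path_space ?I) ?Y)
        = (\<integral>p. cis (V (fst p) + t * Z (snd p) u) \<partial>(P \<Otimes>\<^sub>M P))"
      unfolding integral_distr[OF Y m] dot ..
    also have "\<dots> = (\<integral>\<omega>. \<integral>\<omega>'. cis (V \<omega> + t * Z \<omega>' u) \<partial>P \<partial>P)"
    proof (rule PP.integral_fst'[where f="\<lambda>p. cis (V (fst p) + t * Z (snd p) u)", symmetric, simplified])
      show "integrable (P \<Otimes>\<^sub>M P) (\<lambda>p. cis (V (fst p) + t * Z (snd p) u))"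
        by (rule PP.integrable_const_bound[where B=1]) (auto simp: cis_conv_exp)
    qed
    also have "\<dots> = (\<integral>\<omega>. cis (V \<omega>) * (\<integral>\<omega>'. cis (t * Z \<omega>' u) \<partial>P) \<partial>P)"
      unfolding cis_mult[symmetric] by simp
    also have "\<dots> = (\<integral>\<omega>. cis (V \<omega>) \<partial>P) * (\<integral>\<omega>. cis (t * Z \<omega> u) \<partial>P)" by simp
    also have "\<dots> = (\<integral>\<omega>. cis (V \<omega> + t * Z \<omega> u) \<partial>P)" by (rule char_factorises[OF g u(1) V, symmetric])
    also have "\<dots> = (\<integral>x. cis (\<Sum>i\<in>F. c i * x i) \<partial>distr P (path_space ?I) (\<lambda>\<omega>. ?Y (\<omega>, \<omega>)))"
      unfolding integral_distr[OF Yd m] dot by simp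
    finally show "(\<integral>x. cis (\<Sum>i\<in>F. c i * x i) \<partial>distr P (path_space ?I) (\<lambda>\<omega>. ?Y (\<omega>, \<omega>)))
        = (\<integral>x. cis (\<Sum>i\<in>F. c i * x i) \<partial>distr (P \<Otimes>\<^sub>M P) (path_space ?I) ?Y)" ..
  qed simp_all
  let ?h = "\<lambda>y. (restrict y S, y u)"
  have h: "?h \<in> path_space ?I \<rightarrow>\<^sub>M path_space S \<Otimes>\<^sub>M borel"
    by (intro measurable_Pair measurable_restrict_subset measurable_component_singleton) auto
  have hY: "?h (?Y p) = (observed X S (fst p), Z (snd p) u)" for p
    using u(2) by (auto simp: observed_def restrict_def fun_eq_iff)
  have "distr P (path_space S \<Otimes>\<^sub>M borel) (\<lambda>\<omega>. (observed X S \<omega>, Z \<omega> u))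
      = distr (distr P (path_space ?I) (\<lambda>\<omega>. ?Y (\<omega>, \<omega>))) (path_space S \<Otimes>\<^sub>M borel) ?h"
    unfolding distr_distr[OF h Yd] comp_def hY by simp
  also have "\<dots> = distr (P \<Otimes>\<^sub>M P) (path_space S \<Otimes>\<^sub>M borel) (\<lambda>(\<omega>, \<omega>'). (observed X S \<omega>, Z \<omega>' u))"
    unfolding law distr_distr[OF h Y] comp_def hY by (simp add: case_prod_unfold)
  also have "\<dots> = distr P (path_space S) (observed X S) \<Otimes>\<^sub>M distr P borel (\<lambda>\<omega>. Z \<omega> u)"
    by (rule pair_measure_distr[symmetric])
      (auto intro!: prob_space_imp_sigma_finite prob_space_distr)
  finally show ?thesis .
qed

text \<open>Finite combinations of observed values are functions of the observed path. A rapidly converging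
  sequence of them converges almost surely, and its limit is again a function of the path.\<close>

lemma R_function_of_observed:
  assumes u: "u \<in> T"
  obtains r where "r \<in> borel_measurable (path_space S)" "AE \<omega> in P. r (observed X S \<omega>) = R \<omega> u"
proof -
  obtain V where V: "\<And>n. combination S (V n)" "\<And>n. (\<integral>\<omega>. (R \<omega> u - V n \<omega>)\<^sup>2 \<partial>P) < (1/4) ^ n"
    using observed_span_sequence[OF R_in_observed_span[OF u], of "\<lambda>n. (1/4) ^ n"] by auto
  have "\<forall>n. \<exists>F c. finite F \<and> F \<subseteq> S \<and> V n = (\<lambda>\<omega>. \<Sum>t\<in>F. c t * X \<omega> t)"
    using V(1) by (simp add: combination_def)
  then obtain F c where F: "\<And>n. finite (F n)" "\<And>n. F n \<subseteq> S" "\<And>n. V n = (\<lambda>\<omega>. \<Sum>t\<in>F n. c n t * X \<omega> t)"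
    by metis
  define r where "r x = lim (\<lambda>n. \<Sum>t\<in>F n. c n t * x t)" for x :: "real \<Rightarrow> real"
  have r: "r \<in> borel_measurable (path_space S)"
    unfolding r_def
  proof (rule borel_measurable_lim_metric)
    show "(\<lambda>x. \<Sum>t\<in>F n. c n t * x t) \<in> borel_measurable (path_space S)" for n
      using F(2)[of n] by (intro borel_measurable_sum borel_measurable_times borel_measurable_const measurable_component_singleton) auto
  qed
  have "AE \<omega> in P. (\<lambda>n. V n \<omega>) \<longlonglongrightarrow> R \<omega> u"
    using V by (intro AE_tendsto_of_geometric_mean_squares finite_measure_axioms sq_R u sq_combination[OF V(1) S_subset])
      (auto intro: less_imp_le)
  then have "AE \<omega> in P. r (observed X S \<omega>) = R \<omega> u"
  proof eventually_elim
    case (elim \<omega>)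
    have "(\<Sum>t\<in>F n. c n t * observed X S \<omega> t) = V n \<omega>" for n
      using F(2)[of n] by (auto simp: F(3) observed_def intro!: sum.cong)
    then show ?case using limI[OF elim] by (simp add: r_def)
  qed
  with r that show thesis by blast
qed

text \<open>The error is centered, so the mixed term vanishes and each copy contributes its variance.\<close>

lemma error_sq_diff:
  assumes u: "u \<in> T"
  shows "(\<integral>\<^sup>+z1. \<integral>\<^sup>+z2. ennreal ((z1 - z2)\<^sup>2) \<partial>distr P borel (\<lambda>\<omega>. Z \<omega> u) \<partial>distr P borel (\<lambda>\<omega>. Z \<omega> u))
    = ennreal (2 * (\<integral>\<omega>. (Z \<omega> u)\<^sup>2 \<partial>P))"
proof -
  note [measurable] = Z_measurable[OF u]
  let ?\<nu> = "distr P borel (\<lambda>\<omega>. Z \<omega> u)" and ?v = "\<integral>\<omega>. (Z \<omega> u)\<^sup>2 \<partial>P"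
  have sZ: "integrable P (\<lambda>\<omega>. (Z \<omega> u)\<^sup>2)" by (rule sq_integrable_square[OF sq_Z[OF u]])
  have iZ: "integrable P (\<lambda>\<omega>. Z \<omega> u)" using sq_integrable_times[OF sq_Z[OF u] const_sq[of 1]] by simp
  have v: "0 \<le> ?v" by simp
  have inner: "(\<integral>\<^sup>+z2. ennreal ((z1 - z2)\<^sup>2) \<partial>?\<nu>) = ennreal (z1\<^sup>2 + ?v)" for z1
  proof -
    have "(\<integral>\<^sup>+z2. ennreal ((z1 - z2)\<^sup>2) \<partial>?\<nu>) = (\<integral>\<^sup>+\<omega>. ennreal ((z1 - Z \<omega> u)\<^sup>2) \<partial>P)"
      by (rule nn_integral_distr) measurable
    also have "\<dots> = ennreal (\<integral>\<omega>. (z1 - Z \<omega> u)\<^sup>2 \<partial>P)"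
      using sq_integrable_diff[OF const_sq sq_Z[OF u]] by (intro nn_integral_eq_integral) (auto simp: sq_integrable_def)
    also have "(\<integral>\<omega>. (z1 - Z \<omega> u)\<^sup>2 \<partial>P) = z1\<^sup>2 + ?v"
      using integral_square_diff[OF const_sq sq_Z[OF u], of z1 1] by (simp add: mean_Z[OF u] prob_space)
    finally show ?thesis .
  qed
  have "(\<integral>\<^sup>+z1. \<integral>\<^sup>+z2. ennreal ((z1 - z2)\<^sup>2) \<partial>?\<nu> \<partial>?\<nu>) = (\<integral>\<^sup>+\<omega>. ennreal ((Z \<omega> u)\<^sup>2 + ?v) \<partial>P)"
    unfolding inner by (rule nn_integral_distr) measurable
  also have "\<dots> = ennreal (\<integral>\<omega>. (Z \<omega> u)\<^sup>2 + ?v \<partial>P)"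
    using sZ v by (intro nn_integral_eq_integral) auto
  also have "(\<integral>\<omega>. (Z \<omega> u)\<^sup>2 + ?v \<partial>P) = 2 * ?v" using sZ by (simp add: prob_space)
  finally show ?thesis .
qed

lemma joint_law:
  assumes g: "gaussian_process P a b X" and u: "u \<in> T" "u \<notin> S"
    and r [measurable]: "r \<in> borel_measurable (path_space S)" and rR: "AE \<omega> in P. r (observed X S \<omega>) = R \<omega> u"
  shows "shift_kernel (distr P (path_space S) (observed X S)) (distr P borel (\<lambda>\<omega>. Z \<omega> u)) (path_space S) r" (is ?k)
    and "distr P (path_space S \<Otimes>\<^sub>M borel) (\<lambda>\<omega>. (observed X S \<omega>, X \<omega> u))
      = shift_kernel.\<tau> (distr P (path_space S) (observed X S)) (distr P borel (\<lambda>\<omega>. Z \<omega> u)) (path_space S) r"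
proof -
  note [measurable] = Z_measurable[OF u(1)] observed_measurable[OF S_subset]
  have [measurable]: "(\<lambda>\<omega>. X \<omega> u) \<in> borel_measurable P"
    using sq_X[OF T_interval[OF u(1)]] by (rule sq_integrable_measurable)
  let ?N = "path_space S"
  interpret K: shift_kernel "distr P ?N (observed X S)" "distr P borel (\<lambda>\<omega>. Z \<omega> u)" ?N r
    by (intro shift_kernel.intro shift_kernel_axioms.intro prob_space_distr) auto
  show ?k by (rule K.shift_kernel_axioms)
  have "K.\<tau> = distr P (?N \<Otimes>\<^sub>M borel) ((\<lambda>(x, z). (x, r x + z)) \<circ> (\<lambda>\<omega>. (observed X S \<omega>, Z \<omega> u)))"
    unfolding K.\<tau>_def observed_independent_error[OF g u, symmetric]
    by (rule distr_distr) measurable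
  also have "\<dots> = distr P (?N \<Otimes>\<^sub>M borel) (\<lambda>\<omega>. (observed X S \<omega>, X \<omega> u))"
  proof (rule distr_cong_AE)
    show "AE \<omega> in P. ((\<lambda>(x, z). (x, r x + z)) \<circ> (\<lambda>\<omega>. (observed X S \<omega>, Z \<omega> u))) \<omega> = (observed X S \<omega>, X \<omega> u)"
      using rR by eventually_elim (simp add: Z_def)
  qed (auto simp: comp_def)
  finally show "distr P (?N \<Otimes>\<^sub>M borel) (\<lambda>\<omega>. (observed X S \<omega>, X \<omega> u)) = K.\<tau>" ..
qed

text \<open>Existence: given the observed path \<open>x\<close>, the target is \<open>r x\<close> plus the independent error. Conversely, a
  version of product form is tested on sets that restrict one copy only; this shows that each
  factor disintegrates the joint law of observed part and target, which determines it almost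
  everywhere. So on the diagonal both copies have the same prediction, and only the difference of
  two independent errors is left.\<close>

theorem conditional_variance:
  fixes Q :: "'q measure" and X1 X2 :: "'q \<Rightarrow> real \<Rightarrow> real"
  assumes g: "gaussian_process P a b X" and u: "u \<in> T" "u \<notin> S"
    and copies: "independent_copies Q X1 X2 P X a b"
  shows "\<exists>\<kappa>1 \<kappa>2. cond_pair_distribution Q X1 X2 S u \<kappa>1 \<kappa>2" (is ?ex)
    and "cond_pair_distribution Q X1 X2 S u \<kappa>1 \<kappa>2 \<Longrightarrow>
      ennreal (\<integral>\<omega>. (Z \<omega> u)\<^sup>2 \<partial>P) = ennreal (1 / 2) * (\<integral>\<^sup>+x. cond_sq_diff \<kappa>1 \<kappa>2 x \<partial>distr P (path_space S) (observed X S))"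
proof -
  let ?N = "path_space S" and ?A = "path_space {a..b}"
  have uab: "u \<in> {a..b}" by (rule T_interval[OF u(1)])
  obtain r where r: "r \<in> borel_measurable ?N" "AE \<omega> in P. r (observed X S \<omega>) = R \<omega> u"
    using R_function_of_observed[OF u(1)] by blast
  let ?\<mu> = "distr P ?N (observed X S)" and ?\<nu> = "distr P borel (\<lambda>\<omega>. Z \<omega> u)"
  interpret K: shift_kernel ?\<mu> ?\<nu> ?N r by (rule joint_law(1)[OF g u r])
  have tau: "distr P (?N \<Otimes>\<^sub>M borel) (\<lambda>\<omega>. (observed X S \<omega>, X \<omega> u)) = K.\<tau>" by (rule joint_law(2)[OF g u r])
  interpret Q: prob_space Q using copies by (simp add: independent_copies_def)
  have laws: "distr Q ?A (observed X1 {a..b}) = distr P ?A (observed X {a..b})"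
      "distr Q ?A (observed X2 {a..b}) = distr P ?A (observed X {a..b})"
    and ind: "Q.indep_var ?A (observed X1 {a..b}) ?A (observed X2 {a..b})"
    using copies by (auto simp: independent_copies_def)
  have [measurable]: "observed X1 {a..b} \<in> Q \<rightarrow>\<^sub>M ?A" "observed X2 {a..b} \<in> Q \<rightarrow>\<^sub>M ?A"
    using ind unfolding Q.indep_var_distribution_eq by auto
  have [measurable]: "observed X {a..b} \<in> P \<rightarrow>\<^sub>M ?A" by (rule observed_measurable) simp
  let ?\<pi> = "distr P ?A (observed X {a..b})"
  have pi: "prob_space ?\<pi>" by (rule prob_space_distr) measurable
  have pair: "distr Q (?A \<Otimes>\<^sub>M ?A) (\<lambda>\<omega>. (observed X1 {a..b} \<omega>, observed X2 {a..b} \<omega>)) = ?\<pi> \<Otimes>\<^sub>M ?\<pi>"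
    using ind unfolding Q.indep_var_distribution_eq laws by simp
  define h where "h y = (restrict y S, y u)" for y :: "real \<Rightarrow> real"
  have h [measurable]: "h \<in> ?A \<rightarrow>\<^sub>M ?N \<Otimes>\<^sub>M borel"
    unfolding h_def using S_subset uab
    by (intro measurable_Pair measurable_restrict_subset measurable_component_singleton)
  have h_obs: "h (observed Y {a..b} \<omega>) = (observed Y S \<omega>, Y \<omega> u)" for Y :: "'c \<Rightarrow> real \<Rightarrow> real" and \<omega>
    using S_subset uab by (simp add: h_def observed_def Int_absorb1)
  have tau_pi: "K.\<tau> = distr ?\<pi> (?N \<Otimes>\<^sub>M borel) h"
    unfolding tau[symmetric] by (subst distr_distr) (auto simp: comp_def h_obs)
  have mu_pi: "?\<mu> = distr ?\<pi> ?N (\<lambda>y. fst (h y))"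
    by (subst distr_distr) (auto simp: comp_def h_obs)
  have pair_pi: "distr ?\<pi> L f \<Otimes>\<^sub>M distr ?\<pi> L f
      = distr Q (L \<Otimes>\<^sub>M L) (\<lambda>\<omega>. (f (observed X1 {a..b} \<omega>), f (observed X2 {a..b} \<omega>)))"
    if [measurable]: "f \<in> ?A \<rightarrow>\<^sub>M L" for f and L :: "'c measure"
  proof -
    have [measurable]: "f \<in> ?\<pi> \<rightarrow>\<^sub>M L" by simp
    have "distr ?\<pi> L f \<Otimes>\<^sub>M distr ?\<pi> L f = distr (?\<pi> \<Otimes>\<^sub>M ?\<pi>) (L \<Otimes>\<^sub>M L) (\<lambda>(x, y). (f x, f y))"
      by (rule pair_measure_distr) (auto intro!: prob_space_imp_sigma_finite prob_space.prob_space_distr[OF pi])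
    also have "\<dots> = distr Q (L \<Otimes>\<^sub>M L) (\<lambda>\<omega>. (f (observed X1 {a..b} \<omega>), f (observed X2 {a..b} \<omega>)))"
      unfolding pair[symmetric] by (subst distr_distr) (auto simp: comp_def)
    finally show ?thesis .
  qed
  have tau_tau: "K.\<tau> \<Otimes>\<^sub>M K.\<tau> = distr Q ((?N \<Otimes>\<^sub>M borel) \<Otimes>\<^sub>M (?N \<Otimes>\<^sub>M borel))
      (\<lambda>\<omega>. ((observed X1 S \<omega>, X1 \<omega> u), (observed X2 S \<omega>, X2 \<omega> u)))"
    unfolding tau_pi pair_pi[OF h] by (simp only: h_obs)
  have mu_mu: "?\<mu> \<Otimes>\<^sub>M ?\<mu> = distr Q (?N \<Otimes>\<^sub>M ?N) (\<lambda>\<omega>. (observed X1 S \<omega>, observed X2 S \<omega>))"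
    unfolding mu_pi
    using pair_pi[of "\<lambda>y. fst (h y)" ?N] by (simp add: h_obs)
  have law1: "distr Q (?N \<Otimes>\<^sub>M borel) (\<lambda>\<omega>. (observed X1 S \<omega>, X1 \<omega> u)) = K.\<tau>"
    unfolding tau_pi laws(1)[symmetric] by (subst distr_distr) (auto simp: comp_def h_obs)
  have law2: "distr Q (?N \<Otimes>\<^sub>M borel) (\<lambda>\<omega>. (observed X2 S \<omega>, X2 \<omega> u)) = K.\<tau>"
    unfolding tau_pi laws(2)[symmetric] by (subst distr_distr) (auto simp: comp_def h_obs)
  have m1 [measurable]: "(\<lambda>\<omega>. (observed X1 S \<omega>, X1 \<omega> u)) \<in> Q \<rightarrow>\<^sub>M ?N \<Otimes>\<^sub>M borel"
    using measurable_compose[of "observed X1 {a..b}" Q ?A h] by (simp add: h_obs)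
  have m2 [measurable]: "(\<lambda>\<omega>. (observed X2 S \<omega>, X2 \<omega> u)) \<in> Q \<rightarrow>\<^sub>M ?N \<Otimes>\<^sub>M borel"
    using measurable_compose[of "observed X2 {a..b}" Q ?A h] by (simp add: h_obs)
  have o1: "observed X1 S \<in> Q \<rightarrow>\<^sub>M ?N" and o2: "observed X2 S \<in> Q \<rightarrow>\<^sub>M ?N"
    using measurable_compose[OF m1 measurable_fst] measurable_compose[OF m2 measurable_fst] by simp_all
  have split: "emeasure Q {\<omega> \<in> space Q. (observed X1 S \<omega>, observed X2 S \<omega>) \<in> A \<and> (X1 \<omega> u, X2 \<omega> u) \<in> B}
      = (\<integral>\<^sup>+p. emeasure (K.\<kappa> (fst p) \<Otimes>\<^sub>M K.\<kappa> (snd p)) B * indicator A p \<partial>(?\<mu> \<Otimes>\<^sub>M ?\<mu>))"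
    if [measurable]: "A \<in> sets (?N \<Otimes>\<^sub>M ?N)" "B \<in> sets (borel \<Otimes>\<^sub>M borel)" for A B
  proof -
    let ?E = "{p \<in> space ((?N \<Otimes>\<^sub>M borel) \<Otimes>\<^sub>M (?N \<Otimes>\<^sub>M borel)). (fst (fst p), fst (snd p)) \<in> A \<and> (snd (fst p), snd (snd p)) \<in> B}"
    have sp: "space (K.\<tau> \<Otimes>\<^sub>M K.\<tau>) = space ((?N \<Otimes>\<^sub>M borel) \<Otimes>\<^sub>M (?N \<Otimes>\<^sub>M borel))"
      unfolding tau_tau by simp
    have "emeasure (K.\<tau> \<Otimes>\<^sub>M K.\<tau>) ?E = emeasure Q ((\<lambda>\<omega>. ((observed X1 S \<omega>, X1 \<omega> u), (observed X2 S \<omega>, X2 \<omega> u))) -` ?E \<inter> space Q)"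
      unfolding tau_tau by (rule emeasure_distr) measurable
    also have "(\<lambda>\<omega>. ((observed X1 S \<omega>, X1 \<omega> u), (observed X2 S \<omega>, X2 \<omega> u))) -` ?E \<inter> space Q
        = {\<omega> \<in> space Q. (observed X1 S \<omega>, observed X2 S \<omega>) \<in> A \<and> (X1 \<omega> u, X2 \<omega> u) \<in> B}"
      using measurable_space[OF o1] measurable_space[OF o2] by (auto simp: space_pair_measure)
    finally show ?thesis using K.pair_disintegration[OF that] unfolding sp by simp
  qed
  show ?ex
  proof (intro exI)
    show "cond_pair_distribution Q X1 X2 S u K.\<kappa> K.\<kappa>"
      unfolding cond_pair_distribution_def cond_distribution_def
    proof (intro conjI ballI K.kernel_measurable K.pair_kernel_measurable)
      fix A and B :: "(real \<times> real) set" assume "A \<in> sets (?N \<Otimes>\<^sub>M ?N)" "B \<in> sets (borel \<Otimes>\<^sub>M borel)"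
      from split[OF this] show "emeasure Q {\<omega> \<in> space Q. (observed X1 S \<omega>, observed X2 S \<omega>) \<in> A \<and> (X1 \<omega> u, X2 \<omega> u) \<in> B}
        = (\<integral>\<^sup>+y\<in>A. emeasure (case y of (x1, x2) \<Rightarrow> K.\<kappa> x1 \<Otimes>\<^sub>M K.\<kappa> x2) B \<partial>distr Q (?N \<Otimes>\<^sub>M ?N) (\<lambda>\<omega>. (observed X1 S \<omega>, observed X2 S \<omega>)))"
        by (simp add: mu_mu case_prod_unfold)
    qed
  qed
  assume cp: "cond_pair_distribution Q X1 X2 S u \<kappa>1 \<kappa>2"
  then have k1: "\<kappa>1 \<in> ?N \<rightarrow>\<^sub>M prob_algebra borel" and k2: "\<kappa>2 \<in> ?N \<rightarrow>\<^sub>M prob_algebra borel"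
    and dis: "\<And>A B. A \<in> sets (?N \<Otimes>\<^sub>M ?N) \<Longrightarrow> B \<in> sets (borel \<Otimes>\<^sub>M borel) \<Longrightarrow>
      emeasure Q {\<omega> \<in> space Q. (observed X1 S \<omega>, observed X2 S \<omega>) \<in> A \<and> (X1 \<omega> u, X2 \<omega> u) \<in> B}
        = (\<integral>\<^sup>+p. emeasure (\<kappa>1 (fst p) \<Otimes>\<^sub>M \<kappa>2 (snd p)) B * indicator A p \<partial>(?\<mu> \<Otimes>\<^sub>M ?\<mu>))"
    by (auto simp: cond_pair_distribution_def cond_distribution_def mu_mu case_prod_unfold)
  have kp: "prob_space (K' x) \<and> sets (K' x) = sets borel" if "K' \<in> ?N \<rightarrow>\<^sub>M prob_algebra borel" "x \<in> space ?N" for K' :: "(real \<Rightarrow> real) \<Rightarrow> real measure" and x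
    using measurable_space[OF that] by (simp add: space_prob_algebra)
  have km: "(\<lambda>x. emeasure (K' x) B) \<in> borel_measurable ?\<mu>" if "K' \<in> ?N \<rightarrow>\<^sub>M prob_algebra borel" "B \<in> sets borel" for K' :: "(real \<Rightarrow> real) \<Rightarrow> real measure" and B
    using measurable_emeasure_kernel[OF measurable_prob_algebraD[OF that(1)] that(2)] by simp
  have mu1: "emeasure ?\<mu> (space ?N) = 1" using K.mu.emeasure_space_1 by simp
  \<comment> \<open>A set \<open>B \<times> UNIV\<close> integrates out the second factor, a probability measure.\<close>
  have e1: "AE x in ?\<mu>. \<kappa>1 x = K.\<kappa> x"
  proof (rule K.kernel_unique[OF k1])
    fix A and B :: "real set" assume A: "A \<in> sets ?N" and B: "B \<in> sets borel"
    note [measurable] = A B km[OF k1 B]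
    have "emeasure K.\<tau> (A \<times> B) = emeasure Q ((\<lambda>\<omega>. (observed X1 S \<omega>, X1 \<omega> u)) -` (A \<times> B) \<inter> space Q)"
      unfolding law1[symmetric] by (rule emeasure_distr) measurable
    also have "(\<lambda>\<omega>. (observed X1 S \<omega>, X1 \<omega> u)) -` (A \<times> B) \<inter> space Q
        = {\<omega> \<in> space Q. (observed X1 S \<omega>, observed X2 S \<omega>) \<in> A \<times> space ?N \<and> (X1 \<omega> u, X2 \<omega> u) \<in> B \<times> UNIV}"
      using measurable_space[OF o2] by auto
    also have "emeasure Q \<dots> = (\<integral>\<^sup>+p. emeasure (\<kappa>1 (fst p) \<Otimes>\<^sub>M \<kappa>2 (snd p)) (B \<times> UNIV) * indicator (A \<times> space ?N) p \<partial>(?\<mu> \<Otimes>\<^sub>M ?\<mu>))"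
      by (rule dis) (use A B in auto)
    also have "\<dots> = (\<integral>\<^sup>+p. emeasure (\<kappa>1 (fst p)) B * indicator A (fst p) \<partial>(?\<mu> \<Otimes>\<^sub>M ?\<mu>))"
    proof (rule nn_integral_cong)
      fix p assume "p \<in> space (?\<mu> \<Otimes>\<^sub>M ?\<mu>)"
      then have p: "fst p \<in> space ?N" "snd p \<in> space ?N" by (auto simp: space_pair_measure)
      interpret k1: prob_space "\<kappa>1 (fst p)" using kp[OF k1 p(1)] by simp
      interpret k2: prob_space "\<kappa>2 (snd p)" using kp[OF k2 p(2)] by simp
      have "emeasure (\<kappa>1 (fst p) \<Otimes>\<^sub>M \<kappa>2 (snd p)) (B \<times> UNIV) = emeasure (\<kappa>1 (fst p)) B * emeasure (\<kappa>2 (snd p)) UNIV"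
        by (rule k2.emeasure_pair_measure_Times) (use B kp[OF k1 p(1)] kp[OF k2 p(2)] in auto)
      moreover have "emeasure (\<kappa>2 (snd p)) UNIV = 1"
        using k2.emeasure_space_1 sets_eq_imp_space_eq[of "\<kappa>2 (snd p)" borel] kp[OF k2 p(2)] by simp
      ultimately show "emeasure (\<kappa>1 (fst p) \<Otimes>\<^sub>M \<kappa>2 (snd p)) (B \<times> UNIV) * indicator (A \<times> space ?N) p = emeasure (\<kappa>1 (fst p)) B * indicator A (fst p)"
        using p by (cases p) (simp add: indicator_def)
    qed
    also have "\<dots> = (\<integral>\<^sup>+x. emeasure (\<kappa>1 x) B * indicator A x \<partial>?\<mu>)"
      by (subst K.mu.nn_integral_fst[symmetric]) (auto simp: mu1)
    finally show "emeasure K.\<tau> (A \<times> B) = (\<integral>\<^sup>+x. emeasure (\<kappa>1 x) B * indicator A x \<partial>?\<mu>)" .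
  qed
  have e2: "AE x in ?\<mu>. \<kappa>2 x = K.\<kappa> x"
  proof (rule K.kernel_unique[OF k2])
    fix A and B :: "real set" assume A: "A \<in> sets ?N" and B: "B \<in> sets borel"
    note [measurable] = A B km[OF k2 B]
    have "emeasure K.\<tau> (A \<times> B) = emeasure Q ((\<lambda>\<omega>. (observed X2 S \<omega>, X2 \<omega> u)) -` (A \<times> B) \<inter> space Q)"
      unfolding law2[symmetric] by (rule emeasure_distr) measurable
    also have "(\<lambda>\<omega>. (observed X2 S \<omega>, X2 \<omega> u)) -` (A \<times> B) \<inter> space Q
        = {\<omega> \<in> space Q. (observed X1 S \<omega>, observed X2 S \<omega>) \<in> space ?N \<times> A \<and> (X1 \<omega> u, X2 \<omega> u) \<in> UNIV \<times> B}"
      using measurable_space[OF o1] by auto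
    also have "emeasure Q \<dots> = (\<integral>\<^sup>+p. emeasure (\<kappa>1 (fst p) \<Otimes>\<^sub>M \<kappa>2 (snd p)) (UNIV \<times> B) * indicator (space ?N \<times> A) p \<partial>(?\<mu> \<Otimes>\<^sub>M ?\<mu>))"
      by (rule dis) (use A B in auto)
    also have "\<dots> = (\<integral>\<^sup>+p. emeasure (\<kappa>2 (snd p)) B * indicator A (snd p) \<partial>(?\<mu> \<Otimes>\<^sub>M ?\<mu>))"
    proof (rule nn_integral_cong)
      fix p assume "p \<in> space (?\<mu> \<Otimes>\<^sub>M ?\<mu>)"
      then have p: "fst p \<in> space ?N" "snd p \<in> space ?N" by (auto simp: space_pair_measure)
      interpret k1: prob_space "\<kappa>1 (fst p)" using kp[OF k1 p(1)] by simp
      interpret k2: prob_space "\<kappa>2 (snd p)" using kp[OF k2 p(2)] by simp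
      have "emeasure (\<kappa>1 (fst p) \<Otimes>\<^sub>M \<kappa>2 (snd p)) (UNIV \<times> B) = emeasure (\<kappa>1 (fst p)) UNIV * emeasure (\<kappa>2 (snd p)) B"
        by (rule k2.emeasure_pair_measure_Times) (use B kp[OF k1 p(1)] kp[OF k2 p(2)] in auto)
      moreover have "emeasure (\<kappa>1 (fst p)) UNIV = 1"
        using k1.emeasure_space_1 sets_eq_imp_space_eq[of "\<kappa>1 (fst p)" borel] kp[OF k1 p(1)] by simp
      ultimately show "emeasure (\<kappa>1 (fst p) \<Otimes>\<^sub>M \<kappa>2 (snd p)) (UNIV \<times> B) * indicator (space ?N \<times> A) p = emeasure (\<kappa>2 (snd p)) B * indicator A (snd p)"
        using p by (cases p) (simp add: indicator_def)
    qed
    also have "\<dots> = (\<integral>\<^sup>+x. emeasure (\<kappa>2 x) B * indicator A x \<partial>?\<mu>)"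
      by (subst K.mu.nn_integral_fst[symmetric]) (auto simp: mu1)
    finally show "emeasure K.\<tau> (A \<times> B) = (\<integral>\<^sup>+x. emeasure (\<kappa>2 x) B * indicator A x \<partial>?\<mu>)" .
  qed
  have "AE x in ?\<mu>. cond_sq_diff \<kappa>1 \<kappa>2 x = ennreal (2 * (\<integral>\<omega>. (Z \<omega> u)\<^sup>2 \<partial>P))"
    using e1 e2 by eventually_elim (simp add: cond_sq_diff_def K.pair_kernel_sq_diff error_sq_diff[OF u(1)])
  then have "(\<integral>\<^sup>+x. cond_sq_diff \<kappa>1 \<kappa>2 x \<partial>?\<mu>) = (\<integral>\<^sup>+x. ennreal (2 * (\<integral>\<omega>. (Z \<omega> u)\<^sup>2 \<partial>P)) \<partial>?\<mu>)"
    by (rule nn_integral_cong_AE)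
  also have "\<dots> = ennreal (2 * (\<integral>\<omega>. (Z \<omega> u)\<^sup>2 \<partial>P))"
    by (simp only: nn_integral_const K.mu.emeasure_space_1 mult_1_right)
  finally have total: "(\<integral>\<^sup>+x. cond_sq_diff \<kappa>1 \<kappa>2 x \<partial>?\<mu>) = ennreal (2 * (\<integral>\<omega>. (Z \<omega> u)\<^sup>2 \<partial>P))" .
  show "ennreal (\<integral>\<omega>. (Z \<omega> u)\<^sup>2 \<partial>P) = ennreal (1 / 2) * (\<integral>\<^sup>+x. cond_sq_diff \<kappa>1 \<kappa>2 x \<partial>?\<mu>)"
    unfolding total by (subst ennreal_mult[symmetric]) simp_all
qed

end

lemma finite_union_intervals_support:
  fixes A B :: "nat \<Rightarrow> real"
  assumes AB: "\<forall>j<J. A j < B j" and u: "u \<in> (\<Union>j<J. {A j..B j})" and e: "0 < e"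
  shows "\<exists>c d. c < d \<and> {c..d} \<subseteq> (\<Union>j<J. {A j..B j}) \<inter> ball u e"
proof -
  obtain j where j: "j < J" "A j \<le> u" "u \<le> B j" using u by auto
  let ?c = "max (A j) (u - e / 2)" and ?d = "min (B j) (u + e / 2)"
  have "?c < ?d" using AB j e by (auto simp: max_def min_def)
  moreover have "{?c..?d} \<subseteq> {A j..B j} \<inter> ball u e"
    using e by (auto simp: dist_real_def)
  ultimately show ?thesis using j(1) by blast
qed

theorem theorem2p3:
  fixes P :: "'w measure" and X :: "'w \<Rightarrow> real \<Rightarrow> real"
    and Q :: "'q measure" and X1 X2 :: "'q \<Rightarrow> real \<Rightarrow> real"
    and a b :: real and A B :: "nat \<Rightarrow> real" and J :: nat
    and Obs Mis :: "real set"
    and \<phi> :: "nat \<Rightarrow> real \<Rightarrow> real" and l :: "nat \<Rightarrow> real"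
  assumes "prob_space P"
    and "a < b"
    and "centered_process P a b X"
    and "1 \<le> J"
    and "\<forall>j<J. A j < B j"
    and "disjoint_family_on (\<lambda>j. {A j..B j}) {..<J}"
    and "Obs = (\<Union>j<J. {A j..B j})"
    and "Obs \<subseteq> {a..b}"
    and "Mis = {a..b} - Obs"
    and "eigen_system P X Obs \<phi> l"
  shows "(\<exists>R. is_reconstruction P X Obs Mis \<phi> l R) \<and>
    (\<forall>R Z. is_reconstruction P X Obs Mis \<phi> l R \<longrightarrow> Z = (\<lambda>\<omega> u. X \<omega> u - R \<omega> u) \<longrightarrow>
      (AE \<omega> in P. Z \<omega> \<in> L2 Mis) \<and>
      \<comment> \<open>(a)\<close>
      (\<forall>v\<in>Obs. \<forall>u\<in>Mis.
         integrable P (\<lambda>\<omega>. X \<omega> v * Z \<omega> u) \<and> (\<integral>\<omega>. X \<omega> v * Z \<omega> u \<partial>P) = 0) \<and>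
      (\<forall>u\<in>Mis.
         integrable P (\<lambda>\<omega>. (Z \<omega> u)\<^sup>2) \<and>
         variance P (\<lambda>\<omega>. Z \<omega> u) = (\<integral>\<omega>. (Z \<omega> u)\<^sup>2 \<partial>P) \<and>
         summable (\<lambda>k. l k * (phi_tilde P X Obs \<phi> l k u)\<^sup>2) \<and>
         (\<integral>\<omega>. (Z \<omega> u)\<^sup>2 \<partial>P) = cov P X u u - (\<Sum>k. l k * (phi_tilde P X Obs \<phi> l k u)\<^sup>2)) \<and>
      \<comment> \<open>(b)\<close>
      (\<forall>L. reconstruction_operator P X Obs Mis L \<longrightarrow> kl_continuous P X Obs Mis \<phi> L \<longrightarrow>
         (\<forall>u\<in>Mis. (\<integral>\<omega>. (X \<omega> u - L (X \<omega>) u)\<^sup>2 \<partial>P) \<ge> variance P (\<lambda>\<omega>. Z \<omega> u))) \<and>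
      \<comment> \<open>(c)\<close>
      (gaussian_process P a b X \<longrightarrow> independent_copies Q X1 X2 P X a b \<longrightarrow>
         (\<forall>u\<in>Mis.
            (\<exists>\<kappa>1 \<kappa>2. cond_pair_distribution Q X1 X2 Obs u \<kappa>1 \<kappa>2) \<and>
            (\<forall>\<kappa>1 \<kappa>2. cond_pair_distribution Q X1 X2 Obs u \<kappa>1 \<kappa>2 \<longrightarrow>
               ennreal (variance P (\<lambda>\<omega>. Z \<omega> u)) =
                 ennreal (1 / 2) * (\<integral>\<^sup>+x. cond_sq_diff \<kappa>1 \<kappa>2 x
                   \<partial>distr P (path_space Obs) (observed X Obs))))))"
proof -
  have compact: "compact Obs" unfolding assms(7) by (intro compact_UN) auto
  have support: "\<exists>c d. c < d \<and> {c..d} \<subseteq> Obs \<inter> ball u e" if "u \<in> Obs" "0 < e" for u e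
    using finite_union_intervals_support[OF assms(5), of u e] that unfolding assms(7) by blast
  interpret observed_process P a b X Obs \<phi> l
    by (intro observed_process.intro observed_process_axioms.intro assms compact support)
  have Mis: "Mis \<in> sets lebesgue" "Mis \<subseteq> {a..b}"
    using S_sets by (auto simp: assms(9))
  show ?thesis
  proof (intro conjI allI impI)
    show "\<exists>R. is_reconstruction P X Obs Mis \<phi> l R" by (rule reconstruction_exists[OF Mis])
    fix R Z assume R: "is_reconstruction P X Obs Mis \<phi> l R" and Z: "Z = (\<lambda>\<omega> u. X \<omega> u - R \<omega> u)"
    interpret R: reconstructed_process P a b X Obs \<phi> l Mis R
      by (intro reconstructed_process.intro observed_process_axioms reconstructed_process_axioms.intro Mis R)
    have RZ: "R.Z = Z" by (simp add: Z R.Z_def fun_eq_iff)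
    note path = R.Z_path_L2[unfolded RZ] and integrable = R.X_Z_integrable[unfolded RZ]
      and orthogonal = R.Z_orthogonal_observed[unfolded RZ] and sq = R.sq_Z[unfolded RZ]
      and var = R.variance_Z[unfolded RZ] and error = R.mean_square_Z[unfolded RZ]
      and optimal = R.reconstruction_optimal[unfolded RZ] and cond = R.conditional_variance[unfolded RZ]
    show "AE \<omega> in P. Z \<omega> \<in> L2 Mis" by (rule path)
    show "\<forall>v\<in>Obs. \<forall>u\<in>Mis. integrable P (\<lambda>\<omega>. X \<omega> v * Z \<omega> u) \<and> (\<integral>\<omega>. X \<omega> v * Z \<omega> u \<partial>P) = 0"
      using integrable orthogonal S_subset by blast
    show "\<forall>u\<in>Mis. integrable P (\<lambda>\<omega>. (Z \<omega> u)\<^sup>2) \<and> Defs.variance P (\<lambda>\<omega>. Z \<omega> u) = (\<integral>\<omega>. (Z \<omega> u)\<^sup>2 \<partial>P) \<and>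
        summable (\<lambda>k. l k * (phi_tilde P X Obs \<phi> l k u)\<^sup>2) \<and>
        (\<integral>\<omega>. (Z \<omega> u)\<^sup>2 \<partial>P) = cov P X u u - (\<Sum>k. l k * (phi_tilde P X Obs \<phi> l k u)\<^sup>2)"
      by (intro ballI conjI sq_integrable_square sq var error psi_Bessel(1) R.T_interval)
    show "\<forall>u\<in>Mis. Defs.variance P (\<lambda>\<omega>. Z \<omega> u) \<le> (\<integral>\<omega>. (X \<omega> u - L (X \<omega>) u)\<^sup>2 \<partial>P)"
      if "reconstruction_operator P X Obs Mis L" "kl_continuous P X Obs Mis \<phi> L" for L
      using optimal[OF that] by (simp add: var)
    assume g: "gaussian_process P a b X" and copies: "independent_copies Q X1 X2 P X a b"
    show "\<forall>u\<in>Mis. (\<exists>\<kappa>1 \<kappa>2. cond_pair_distribution Q X1 X2 Obs u \<kappa>1 \<kappa>2) \<and>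
        (\<forall>\<kappa>1 \<kappa>2. cond_pair_distribution Q X1 X2 Obs u \<kappa>1 \<kappa>2 \<longrightarrow>
           ennreal (Defs.variance P (\<lambda>\<omega>. Z \<omega> u)) =
             ennreal (1 / 2) * (\<integral>\<^sup>+x. cond_sq_diff \<kappa>1 \<kappa>2 x \<partial>distr P (path_space Obs) (observed X Obs)))"
    proof (intro ballI conjI allI impI)
      fix u assume u: "u \<in> Mis"
      then have u': "u \<notin> Obs" by (simp add: assms(9))
      show "\<exists>\<kappa>1 \<kappa>2. cond_pair_distribution Q X1 X2 Obs u \<kappa>1 \<kappa>2" by (rule cond(1)[OF g u u' copies])
      show "ennreal (Defs.variance P (\<lambda>\<omega>. Z \<omega> u)) =
          ennreal (1 / 2) * (\<integral>\<^sup>+x. cond_sq_diff \<kappa>1 \<kappa>2 x \<partial>distr P (path_space Obs) (observed X Obs))"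
        if "cond_pair_distribution Q X1 X2 Obs u \<kappa>1 \<kappa>2" for \<kappa>1 \<kappa>2
        unfolding var[OF u] by (rule cond(2)[OF g u u' copies that])
    qed
  qed
qed

end
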